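(* (i) Fix $s\ge1$, $r>\frac d2+\frac32$ and $K_0>0$, and let $\theta_0$ and $S$ be of Gevrey-class $s$ with radius of convergence $\tau_0>0$ and satisfy $\|\Lambda^re^{\tau_0\Lambda^{1/s}}\theta_0\|_{L^2}\le K_0$ and $\|\Lambda^re^{\tau_0\Lambda^{1/s}}S\|_{L^2}\le K_0$. Assume A1, A2, A3, A4 and A5$_1$. Let $\bar T,\bar\tau>0$ be such that, for $\nu>0$ and $\nu=0$ respectively, $\theta^\nu$ and $\theta^0$ are the Gevrey-class $s$ solutions to (AS$_\nu$) and (AS$_0$) with initial datum $\theta_0$ on $\mathbb{T}^d\times[0,\bar T]$ with radius of convergence at least $\bar\tau$, satisfying for a constant $C=C(K_0)>0$ the bounds $\|\Lambda^re^{\bar\tau\Lambda^{1/s}}\theta^\nu(\cdot,t)\|_{L^2}\le C$ for all $t\in[0,\bar T]$ and all $\nu\ge0$. Then there exist $T\in(0,\bar T)$ and $\tau=\tau(t)\in(0,\bar\tau)$ such that, for $t\in[0,T]$, $$\lim_{\nu\to0}\|(\Lambda^re^{\tau\Lambda^{1/s}}\theta^\nu-\Lambda^re^{\tau\Lambda^{1/s}}\theta^0)(\cdot,t)\|_{L^2}=0.$$ (ii) Let $d\ge2$, $s>\frac d2+1$, and let $\theta_0,S\in H^s(\mathbb{T}^d)$ have zero mean on $\mathbb{T}^d$. Assume A1, A2, A3, A4 and A5$_2$. Let $T>0$ and let $\theta^0\in L^\infty(0,T;H^s(\mathbb{T}^d))$ be the unique smooth solution to (AS$_0$) on $[0,T]$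 given by local wellposedness in $H^s$, and for $\nu>0$ let $\theta^\nu$ be the $H^s$ solution to (AS$_\nu$) with the same $\theta_0$ and $S$ on $[0,T]$. Then for $t\in[0,T]$, $$\lim_{\nu\to0}\|(\theta^\nu-\theta^0)(\cdot,t)\|_{H^{s-1}}=0.$$
   Context: Setting. Let $d\ge2$ and $\mathbb{T}^d=[0,2\pi]^d$ with periodic boundary conditions. For $\nu\ge0$, (AS$_\nu$) denotes the problem $$\partial_t\theta^\nu+u^\nu\cdot\nabla\theta^\nu=S,\qquad u^\nu_j=\partial_{x_i}T^\nu_{ij}[\theta^\nu]\ (\text{summed over } i),\qquad \theta^\nu(x,0)=\theta_0(x),$$ where $S=S(x)$ is a given time-independent forcing. Standing assumption: $\int_{\mathbb{T}^d}\theta^\nu(x,t)\,dx=\int_{\mathbb{T}^d}S(x)\,dx=0$ for all $t\ge0$. $\{T^\nu_{ij}\}_{\nu\ge0}$, $1\le i,j\le d$, is a given family of Fourier multiplier operators with symbols $\widehat T^\nu_{ij}(k)$, $k\in\mathbb{Z}^d$. $H^s=W^{s,2}$. Assumptions: A1: $\partial_i\partial_jT^\nu_{ij}f=0$ (repeated indices summed) for all smooth $f$ and all $\nu\ge0$. A2: $T^\nu_{ij}:L^\infty(\mathbb{T}^d)\to BMO(\mathbb{T}^d)$ is bounded for all $\nu\ge0$. A3: for each $\nu>0$ there is $C_\nu>0$ such that for all $1\le i,j\le d$, $|\widehat T^\nu_{ij}(k)|\le C_\nu|k|^{-3}$ for all $k\in\mathbb{Z}^d\setminus\{0\}$. A4: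 for each $1\le i,j\le d$, $\lim_{\nu\to0}\sum_{k\in\mathbb{Z}^d}|\widehat T^\nu_{ij}(k)-\widehat T^0_{ij}(k)|^2|\widehat g(k)|^2=0$ for all $g\in L^2$. A5$_1$: there is $C_0>0$ independent of $\nu$ such that for all $1\le i,j\le d$, $\sup_{\nu\in(0,1]}\sup_{k\in\mathbb{Z}^d}|\widehat T^\nu_{ij}(k)|\le C_0$ and $\sup_{k\in\mathbb{Z}^d}|\widehat T^0_{ij}(k)|\le C_0$. A5$_2$: there is $C_0>0$ independent of $\nu$ such that for all $1\le i,j\le d$, $\sup_{\nu\in(0,1]}\sup_{k\in\mathbb{Z}^d}|k_i\widehat T^\nu_{ij}(k)|\le C_0$ and $\sup_{k\in\mathbb{Z}^d}|k_i\widehat T^0_{ij}(k)|\le C_0$. Gevrey classes. $\Lambda=(-\Delta)^{1/2}$ and $\mathbb{Z}^d_*=\mathbb{Z}^d\setminus\{0\}$. For $s\ge1$, $r\ge0$, $\tau>0$ put $$\|\Lambda^re^{\tau\Lambda^{1/s}}f\|_{L^2}^2=\sum_{k\in\mathbb{Z}^d_*}|k|^{2r}e^{2\tau|k|^{1/s}}|\hat f(k)|^2.$$ The Gevrey-class $s$ is $\bigcup_{\tau>0}\mathcal{D}(\Lambda^re^{\tau\Lambda^{1/s}})$ (for any $r\ge0$), and $\tau=\tau(t)>0$ is called the radius of convergence: $f$ has radius of convergence at least $\tau$ when $f\in\mathcal{D}(\Lambda^re^{\tau\Lambda^{1/s}})$. *)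

theory Defs
  imports "HOL-Analysis.Analysis"
begin

section \<open>Functions and Fourier coefficients on the torus\<close>

text \<open>
  Functions on the torus are functions on \<open>real ^ 'n\<close> that are \<open>2\<pi>\<close>-periodic in every
  coordinate; \<open>CARD('n)\<close> is the dimension and frequencies are elements of \<open>int ^ 'n\<close>.
\<close>

definition periodic :: "(real ^ 'n \<Rightarrow> 'b) \<Rightarrow> bool" where
  "periodic f \<longleftrightarrow> (\<forall>x i. f (x + (2 * pi) *\<^sub>R axis i 1) = f x)"

definition cell :: "(real ^ 'n) set" where
  "cell = cbox 0 (\<chi> i. 2 * pi)"

abbreviation cx :: "('a \<Rightarrow> real) \<Rightarrow> 'a \<Rightarrow> complex" where
  "cx f \<equiv> (\<lambda>x. complex_of_real (f x))"

definition freq :: "int ^ 'n \<Rightarrow> real ^ 'n" where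
  "freq k = (\<chi> i. real_of_int (k $ i))"

definition fourier_coeff :: "(real ^ 'n \<Rightarrow> complex) \<Rightarrow> int ^ 'n \<Rightarrow> complex" where
  "fourier_coeff f k =
     (LINT x:cell|lebesgue. f x * cis (- (freq k \<bullet> x))) / of_real ((2 * pi) ^ CARD('n))"

definition L2_torus :: "(real ^ 'n \<Rightarrow> complex) \<Rightarrow> bool" where
  "L2_torus f \<longleftrightarrow> periodic f \<and> f \<in> borel_measurable lebesgue \<and>
     set_integrable lebesgue cell (\<lambda>x. (norm (f x))\<^sup>2)"

definition zero_mean :: "(real ^ 'n \<Rightarrow> real) \<Rightarrow> bool" where
  "zero_mean f \<longleftrightarrow> set_integrable lebesgue cell f \<and> (LINT x:cell|lebesgue. f x) = 0"

definition partial :: "'n::finite \<Rightarrow> (real ^ 'n \<Rightarrow> 'b::real_normed_vector) \<Rightarrow> real ^ 'n \<Rightarrow> 'b" where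
  "partial i f x = frechet_derivative f (at x) (axis i 1)"

definition smooth_torus :: "(real ^ 'n \<Rightarrow> complex) \<Rightarrow> bool" where
  "smooth_torus f \<longleftrightarrow> periodic f \<and>
     (\<forall>is. \<forall>x. foldr partial is f differentiable (at x))"

section \<open>Gevrey and Sobolev norms\<close>

text \<open>
  The sums of squares are formed in \<open>ennreal\<close>, so divergence is visible as \<open>\<infinity>\<close>. The real-valued
  norms below are meaningful only together with membership in the corresponding space.
\<close>

definition gevrey_sum :: "real \<Rightarrow> real \<Rightarrow> real \<Rightarrow> (real ^ 'n \<Rightarrow> complex) \<Rightarrow> ennreal" where
  "gevrey_sum s r \<tau> f = (\<Sum>\<^sub>\<infinity>k\<in>UNIV - {0}.
     ennreal (norm (freq k) powr (2 * r) * exp (2 * \<tau> * norm (freq k) powr (1 / s))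
              * (norm (fourier_coeff f k))\<^sup>2))"

definition gevrey_dom :: "real \<Rightarrow> real \<Rightarrow> real \<Rightarrow> (real ^ 'n \<Rightarrow> complex) \<Rightarrow> bool" where
  "gevrey_dom s r \<tau> f \<longleftrightarrow> L2_torus f \<and> gevrey_sum s r \<tau> f < \<infinity>"

definition gevrey_norm :: "real \<Rightarrow> real \<Rightarrow> real \<Rightarrow> (real ^ 'n \<Rightarrow> complex) \<Rightarrow> real" where
  "gevrey_norm s r \<tau> f = sqrt (enn2real (gevrey_sum s r \<tau> f))"

definition sobolev_sum :: "real \<Rightarrow> (real ^ 'n \<Rightarrow> complex) \<Rightarrow> ennreal" where
  "sobolev_sum s f = (\<Sum>\<^sub>\<infinity>k. ennreal
     ((1 + (norm (freq k))\<^sup>2) powr s * (norm (fourier_coeff f k))\<^sup>2))"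

definition sobolev_space :: "real \<Rightarrow> (real ^ 'n \<Rightarrow> complex) \<Rightarrow> bool" where
  "sobolev_space s f \<longleftrightarrow> L2_torus f \<and> sobolev_sum s f < \<infinity>"

definition sobolev_norm :: "real \<Rightarrow> (real ^ 'n \<Rightarrow> complex) \<Rightarrow> real" where
  "sobolev_norm s f = sqrt (enn2real (sobolev_sum s f))"

section \<open>Fourier multipliers\<close>

text \<open>
  Pointwise action of a multiplier, used where the series converges absolutely: for a symbol of
  at most polynomial growth this covers all smooth functions.
\<close>

definition mult_op :: "(int ^ 'n \<Rightarrow> complex) \<Rightarrow> (real ^ 'n \<Rightarrow> complex) \<Rightarrow> real ^ 'n \<Rightarrow> complex" where
  "mult_op m f x = (\<Sum>\<^sub>\<infinity>k. m k * fourier_coeff f k * cis (freq k \<bullet> x))"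

definition mean_on :: "(real ^ 'n) set \<Rightarrow> (real ^ 'n \<Rightarrow> 'b::{banach, second_countable_topology}) \<Rightarrow> 'b" where
  "mean_on Q f = (LINT x:Q|lebesgue. f x) /\<^sub>R measure lebesgue Q"

definition bmo_with_bound :: "(real ^ 'n \<Rightarrow> complex) \<Rightarrow> real \<Rightarrow> bool" where
  "bmo_with_bound g B \<longleftrightarrow> periodic g \<and> g \<in> borel_measurable lebesgue \<and>
     set_integrable lebesgue cell g \<and>
     (\<forall>a h. 0 < h \<and> h \<le> 2 * pi \<longrightarrow>
        (let Q = cbox a (a + (\<chi> i. h)) in mean_on Q (\<lambda>x. norm (g x - mean_on Q g)) \<le> B))"

definition Linf_with_bound :: "(real ^ 'n \<Rightarrow> complex) \<Rightarrow> real \<Rightarrow> bool" where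
  "Linf_with_bound f M \<longleftrightarrow> periodic f \<and> f \<in> borel_measurable lebesgue \<and>
     (AE x in lebesgue. norm (f x) \<le> M)"

text \<open>
  For merely bounded \<open>f\<close> the Fourier series need not converge pointwise, so the image under the
  multiplier is the function \<open>g\<close> (unique a.e.) with the prescribed Fourier coefficients.
\<close>

definition bounded_Linf_BMO :: "(int ^ 'n \<Rightarrow> complex) \<Rightarrow> bool" where
  "bounded_Linf_BMO m \<longleftrightarrow> (\<exists>B. \<forall>f M. Linf_with_bound f M \<longrightarrow>
     (\<exists>g. bmo_with_bound g (B * M) \<and>
          (\<forall>k. fourier_coeff g k = m k * fourier_coeff f k)))"

section \<open>Assumptions on the family of symbols\<close>

text \<open>\<open>m \<nu> i j k\<close> is the symbol of the operator with parameter \<open>\<nu>\<close> and indices \<open>i, j\<close> at \<open>k\<close>.\<close>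

type_synonym 'n symbols = "'n \<Rightarrow> 'n \<Rightarrow> int ^ 'n \<Rightarrow> complex"

definition A1 :: "(real \<Rightarrow> 'n::finite symbols) \<Rightarrow> bool" where
  "A1 m \<longleftrightarrow> (\<forall>\<nu>\<ge>0. \<forall>f. smooth_torus f \<longrightarrow>
     (\<forall>x. (\<Sum>i\<in>UNIV. \<Sum>j\<in>UNIV. partial i (partial j (mult_op (m \<nu> i j) f)) x) = 0))"

definition A2 :: "(real \<Rightarrow> 'n::finite symbols) \<Rightarrow> bool" where
  "A2 m \<longleftrightarrow> (\<forall>\<nu>\<ge>0. \<forall>i j. bounded_Linf_BMO (m \<nu> i j))"

definition A3 :: "(real \<Rightarrow> 'n::finite symbols) \<Rightarrow> bool" where
  "A3 m \<longleftrightarrow> (\<forall>\<nu>>0. \<exists>C>0. \<forall>i j k. k \<noteq> 0 \<longrightarrow> norm (m \<nu> i j k) \<le> C / norm (freq k) ^ 3)"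

definition A4 :: "(real \<Rightarrow> 'n::finite symbols) \<Rightarrow> bool" where
  "A4 m \<longleftrightarrow> (\<forall>i j g. L2_torus g \<longrightarrow>
     ((\<lambda>\<nu>. \<Sum>\<^sub>\<infinity>k. ennreal ((norm (m \<nu> i j k - m 0 i j k))\<^sup>2 * (norm (fourier_coeff g k))\<^sup>2))
        \<longlongrightarrow> 0) (at_right 0))"

definition A5_1 :: "(real \<Rightarrow> 'n::finite symbols) \<Rightarrow> bool" where
  "A5_1 m \<longleftrightarrow> (\<exists>C0>0. \<forall>i j.
     (\<forall>\<nu>\<in>{0<..1}. \<forall>k. norm (m \<nu> i j k) \<le> C0) \<and> (\<forall>k. norm (m 0 i j k) \<le> C0))"

definition A5_2 :: "(real \<Rightarrow> 'n::finite symbols) \<Rightarrow> bool" where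
  "A5_2 m \<longleftrightarrow> (\<exists>C0>0. \<forall>i j.
     (\<forall>\<nu>\<in>{0<..1}. \<forall>k. norm (of_int (k $ i) * m \<nu> i j k) \<le> C0) \<and>
     (\<forall>k. norm (of_int (k $ i) * m 0 i j k) \<le> C0))"

section \<open>The active scalar equation\<close>

definition velocity :: "'n::finite symbols \<Rightarrow> (real ^ 'n \<Rightarrow> real) \<Rightarrow> 'n \<Rightarrow> real ^ 'n \<Rightarrow> complex" where
  "velocity m f j x = (\<Sum>i\<in>UNIV. partial i (mult_op (m i j) (cx f)) x)"

text \<open>
  The scalar is real-valued. No symmetry of the symbols forcing the velocity to be real is
  assumed, so the equation is stated in the complex numbers. In the regularity classes used
  below (where the scalar is continuously differentiable in space), the equation holds
  classically for the representative that is continuous in space and time; the time derivative is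
  one-sided at the endpoints.
\<close>

definition AS_solution ::
  "'n::finite symbols \<Rightarrow> (real ^ 'n \<Rightarrow> real) \<Rightarrow> (real ^ 'n \<Rightarrow> real) \<Rightarrow> real
     \<Rightarrow> (real \<Rightarrow> real ^ 'n \<Rightarrow> real) \<Rightarrow> bool" where
  "AS_solution m \<theta>0 S T \<theta> \<longleftrightarrow>
     \<theta> 0 = \<theta>0 \<and>
     (\<forall>t\<in>{0..T}. periodic (\<theta> t) \<and> zero_mean (\<theta> t) \<and>
        (\<forall>x. \<theta> t differentiable (at x) \<and>
          (\<exists>D. ((\<lambda>t'. \<theta> t' x) has_real_derivative D) (at t within {0..T}) \<and>
            complex_of_real D + (\<Sum>j\<in>UNIV. velocity m (\<theta> t) j x * of_real (partial j (\<theta> t) x))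
              = complex_of_real (S x))))"

definition gevrey_solution ::
  "'n::finite symbols \<Rightarrow> (real ^ 'n \<Rightarrow> real) \<Rightarrow> (real ^ 'n \<Rightarrow> real) \<Rightarrow> real \<Rightarrow> real \<Rightarrow> real
     \<Rightarrow> real \<Rightarrow> real \<Rightarrow> (real \<Rightarrow> real ^ 'n \<Rightarrow> real) \<Rightarrow> bool" where
  "gevrey_solution m \<theta>0 S s r \<tau> C T \<theta> \<longleftrightarrow>
     AS_solution m \<theta>0 S T \<theta> \<and>
     (\<forall>t\<in>{0..T}. gevrey_dom s r \<tau> (cx (\<theta> t)) \<and> gevrey_norm s r \<tau> (cx (\<theta> t)) \<le> C)"

text \<open>
  ``The'' Gevrey-class solution: uniqueness is only required within the class of solutions having
  the same radius and obeying the same bound.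
\<close>

definition the_gevrey_solution ::
  "'n::finite symbols \<Rightarrow> (real ^ 'n \<Rightarrow> real) \<Rightarrow> (real ^ 'n \<Rightarrow> real) \<Rightarrow> real \<Rightarrow> real \<Rightarrow> real
     \<Rightarrow> real \<Rightarrow> real \<Rightarrow> (real \<Rightarrow> real ^ 'n \<Rightarrow> real) \<Rightarrow> bool" where
  "the_gevrey_solution m \<theta>0 S s r \<tau> C T \<theta> \<longleftrightarrow>
     gevrey_solution m \<theta>0 S s r \<tau> C T \<theta> \<and>
     (\<forall>\<theta>'. gevrey_solution m \<theta>0 S s r \<tau> C T \<theta>' \<longrightarrow> (\<forall>t\<in>{0..T}. \<theta>' t = \<theta> t))"

text \<open>Solutions bounded in time with values in the Sobolev space of order \<open>s\<close>.\<close>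

definition sobolev_solution ::
  "'n::finite symbols \<Rightarrow> (real ^ 'n \<Rightarrow> real) \<Rightarrow> (real ^ 'n \<Rightarrow> real) \<Rightarrow> real \<Rightarrow> real
     \<Rightarrow> (real \<Rightarrow> real ^ 'n \<Rightarrow> real) \<Rightarrow> bool" where
  "sobolev_solution m \<theta>0 S s T \<theta> \<longleftrightarrow>
     AS_solution m \<theta>0 S T \<theta> \<and>
     (\<exists>M. \<forall>t\<in>{0..T}. sobolev_space s (cx (\<theta> t)) \<and> sobolev_norm s (cx (\<theta> t)) \<le> M)"

end

theory Submission
  imports Defs "HOL-Complex_Analysis.Great_Picard"
begin

text \<open>
  Both limits are read off the Fourier coefficients of the scalar. For a solution in either class
  the gradient and the velocity are absolutely convergent Fourier series, and the equation becomes
  a system of ordinary differential equations for the coefficients, in which the advection term is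
  the convolution \<open>transport\<close> (\<open>fourier_coeff_advection\<close>, \<open>fourier_coeff_ode\<close>). Tested on characters,
  the assumptions on the operators say that the symbols are bounded and divergence free and converge
  frequency by frequency.

  In Sobolev spaces the velocity is an operator of order zero applied to the scalar, and energy
  estimates apply. Because the velocity is divergence free and the scalar is real, only a commutator
  contributes to weighted energies (\<open>weighted_transport_le_commutator\<close>). With weights of order \<open>s\<close>
  this bounds the growth of the \<open>H\<^sup>s\<close> norm in terms of the weighted \<open>\<ell>\<^sup>1\<close> norm \<open>w1\<close>
  (\<open>sobolev_growth\<close>); with weights of order zero it makes the difference of two solutions small in
  \<open>L\<^sup>2\<close> when their velocity operators are close (\<open>L2_stability\<close>). The bound on the \<open>H\<^sup>s\<close> norm of
  \<open>\<theta> \<nu>\<close> is not assumed to be uniform in \<open>\<nu>\<close>. It is recovered by a bootstrap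
  (\<open>sobolev_differences_vanish\<close>): as long as the difference to \<open>\<theta> 0\<close> is at most 1 in the \<open>w1\<close> norm,
  the \<open>H\<^sup>s\<close> norm of \<open>\<theta> \<nu>\<close> is under control, and interpolation between this bound and smallness in
  \<open>L\<^sup>2\<close> makes the difference at most 1/2. Interpolation once more gives convergence in \<open>H\<close> of order
  \<open>s - 1\<close>.

  In Gevrey classes the velocity loses a derivative and the argument is compactness instead. The
  uniform bound makes the solutions equicontinuous in space and time, so along every sequence
  \<open>\<nu> \<rightarrow> 0\<close> a subsequence converges uniformly. The limit solves the equation for \<open>\<nu> = 0\<close> with the
  same bound and is therefore \<open>\<theta> 0\<close>, by uniqueness in that class (\<open>gevrey_subsequence\<close>). Convergence
  of each Fourier coefficient improves to convergence in the Gevrey norm with half the radius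
  (\<open>weighted_tail_tendsto\<close>, \<open>gevrey_weight_small\<close>), at every time; any \<open>T\<close> below the given final
  time will do.
\<close>


section \<open>The frequency lattice\<close>

definition bracket :: "int ^ 'n \<Rightarrow> real" where
  "bracket k = sqrt (1 + (norm (freq k))\<^sup>2)"

lemma freq_0 [simp]: "freq 0 = 0"
  by (simp add: freq_def vec_eq_iff)

lemma freq_add: "freq (k + l) = freq k + freq l"
  by (simp add: freq_def vec_eq_iff)

lemma freq_diff: "freq (k - l) = freq k - freq l"
  by (simp add: freq_def vec_eq_iff)

lemma freq_minus: "freq (- k) = - freq k"
  by (simp add: freq_def vec_eq_iff)

lemma freq_nth [simp]: "freq k $ i = real_of_int (k $ i)"
  by (simp add: freq_def)

lemma freq_eq_0_iff [simp]: "freq k = 0 \<longleftrightarrow> k = 0"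
  by (simp add: vec_eq_iff)

lemma bracket_ge_1: "1 \<le> bracket k"
  by (simp add: bracket_def)

lemma bracket_pos [simp]: "0 < bracket k"
  using bracket_ge_1[of k] by linarith

lemma bracket_nonneg [simp]: "0 \<le> bracket k"
  using bracket_pos[of k] by linarith

lemma bracket_neq_0 [simp]: "bracket k \<noteq> 0"
  using bracket_pos[of k] by linarith

lemma bracket_minus [simp]: "bracket (- k) = bracket k"
  by (simp add: bracket_def freq_minus)

lemma norm_freq_le_bracket: "norm (freq k) \<le> bracket k"
  unfolding bracket_def by (rule real_le_rsqrt) simp

lemma abs_component_le_bracket: "\<bar>real_of_int (k $ i)\<bar> \<le> bracket k"
  using component_le_norm_cart[of "freq k" i] norm_freq_le_bracket[of k] by simp

lemma bracket_powr_ge_1: "0 \<le> s \<Longrightarrow> 1 \<le> bracket k powr s"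
  using bracket_ge_1[of k] by (simp add: ge_one_powr_ge_zero)

lemma bracket_powr_double: "bracket k powr (2 * s) = (1 + (norm (freq k))\<^sup>2) powr s"
  unfolding bracket_def by (simp add: powr_half_sqrt[symmetric] powr_powr)

lemma bracket_lipschitz: "\<bar>bracket k - bracket l\<bar> \<le> norm (freq (k - l))"
proof -
  have *: "bracket k = norm (1::real, freq k)" for k :: "int ^ 'a"
    by (simp add: bracket_def norm_Pair)
  have "\<bar>bracket k - bracket l\<bar> \<le> norm ((1::real, freq k) - (1, freq l))"
    unfolding * by (rule norm_triangle_ineq3)
  also have "\<dots> = norm (freq (k - l))" by (simp add: freq_diff norm_Pair)
  finally show ?thesis .
qed

lemma bracket_triangle: "bracket k \<le> bracket l + bracket (k - l)"
  using bracket_lipschitz[of k l] norm_freq_le_bracket[of "k - l"] by linarith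

lemma summable_int_powr:
  fixes q :: real
  assumes "q > 1"
  shows "(\<lambda>i::int. (1 + \<bar>real_of_int i\<bar>) powr - q) summable_on UNIV"
proof -
  have s: "summable (\<lambda>n. (1 + real n) powr - q)"
    using summable_Suc_iff[of "\<lambda>n. real n powr - q"] summable_real_powr_iff[of "- q"] assms
    by (simp add: add.commute)
  then have n: "(\<lambda>n::nat. (1 + real n) powr - q) summable_on UNIV"
    by (subst summable_on_UNIV_nonneg_real_iff) auto
  have p: "(\<lambda>i::int. (1 + \<bar>real_of_int i\<bar>) powr - q) summable_on range int"
    using n by (subst summable_on_reindex) (auto simp: o_def)
  have m: "(\<lambda>i::int. (1 + \<bar>real_of_int i\<bar>) powr - q) summable_on range (\<lambda>n. - int n)"
    using n by (subst summable_on_reindex) (auto simp: o_def inj_on_def)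
  have U: "(UNIV::int set) = range int \<union> range (\<lambda>n. - int n)"
    by (auto simp: image_iff) (metis int_cases2)
  show ?thesis
    unfolding U by (rule summable_on_union[OF p m])
qed

text \<open>
  A lattice sum over \<open>\<int>\<^sup>n\<close> is compared with an \<open>n\<close>-fold product of one-dimensional sums: every
  factor \<open>(1 + \<bar>k\<^sub>i\<bar>)/2\<close> is at most \<open>bracket k\<close>.
\<close>

lemma summable_bracket_powr:
  fixes p :: real
  assumes p: "p > CARD('n)"
  shows "(\<lambda>k::int ^ 'n::finite. bracket k powr - p) summable_on UNIV"
proof -
  define q where "q = p / CARD('n)"
  have q: "q > 1" using p by (simp add: q_def field_simps)
  let ?f = "\<lambda>i::int. 2 powr q * (1 + \<bar>real_of_int i\<bar>) powr - q"
  have "(\<lambda>i. norm (?f i)) summable_on UNIV"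
    using summable_on_cmult_right[OF summable_int_powr[OF q], of "2 powr q"] by simp
  then have f: "Infinite_Set_Sum.abs_summable_on ?f UNIV"
    unfolding abs_summable_equivalent[symmetric] .
  have "Infinite_Set_Sum.abs_summable_on (\<lambda>g. \<Prod>x\<in>UNIV. ?f (g x))
      (PiE (UNIV::'n set) (\<lambda>_. UNIV::int set))"
    by (rule abs_summable_on_prod_PiE) (auto intro: f)
  then have g: "(\<lambda>g::'n \<Rightarrow> int. norm (\<Prod>x\<in>UNIV. ?f (g x))) summable_on UNIV"
    by (simp add: abs_summable_equivalent[symmetric])
  have b: "bij_betw (\<lambda>k::int^'n. ($) k) UNIV UNIV"
    by (rule bij_betwI[where g = vec_lambda]) (auto simp: vec_lambda_eta)
  have "(\<lambda>k::int^'n. norm (\<Prod>x\<in>UNIV. ?f (k $ x))) summable_on UNIV"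
    using g summable_on_reindex_bij_betw[OF b, of "\<lambda>g. norm (\<Prod>x\<in>UNIV. ?f (g x))"] by simp
  then show ?thesis
  proof (rule summable_on_comparison_test)
    fix k :: "int ^ 'n"
    have "bracket k powr - q \<le> ?f (k $ i)" for i
    proof -
      have "1 + \<bar>real_of_int (k $ i)\<bar> \<le> 2 * bracket k"
        using abs_component_le_bracket[of k i] bracket_ge_1[of k] by linarith
      then have "(2 * bracket k) powr - q \<le> (1 + \<bar>real_of_int (k $ i)\<bar>) powr - q"
        using q by (intro powr_mono2') auto
      then have "2 powr q * (2 * bracket k) powr - q \<le> ?f (k $ i)"
        by (intro mult_left_mono) auto
      moreover have "2 powr q * (2 * bracket k) powr - q = bracket k powr - q"
        by (simp add: powr_mult mult.assoc[symmetric] powr_add[symmetric])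
      ultimately show ?thesis by simp
    qed
    then have "(\<Prod>i\<in>(UNIV::'n set). bracket k powr - q) \<le> (\<Prod>i\<in>UNIV. ?f (k $ i))"
      by (intro prod_mono) auto
    moreover have "(\<Prod>i\<in>(UNIV::'n set). bracket k powr - q) = bracket k powr - p"
      by (simp add: powr_power q_def)
    ultimately show "bracket k powr - p \<le> norm (\<Prod>x\<in>UNIV. ?f (k $ x))"
      by simp
  qed auto
qed

lemma finite_bracket_le: "finite {k::int ^ 'n::finite. bracket k \<le> N}"
proof -
  define M where "M = \<lfloor>\<bar>N\<bar>\<rfloor>"
  have "{k::int ^ 'n. bracket k \<le> N} \<subseteq> vec_lambda ` (PiE UNIV (\<lambda>_. {- M..M}))"
  proof
    fix k :: "int ^ 'n" assume "k \<in> {k. bracket k \<le> N}"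
    then have "\<bar>real_of_int (k $ i)\<bar> \<le> \<bar>N\<bar>" for i
      using order_trans[OF abs_component_le_bracket[of k i], of N] by auto
    then have "\<bar>k $ i\<bar> \<le> M" for i
      unfolding M_def le_floor_iff by simp
    then have "($) k \<in> PiE UNIV (\<lambda>_. {- M..M})"
      by (auto simp: abs_le_iff minus_le_iff)
    then show "k \<in> vec_lambda ` (PiE UNIV (\<lambda>_. {- M..M}))"
      by (metis image_eqI vec_lambda_eta)
  qed
  then show ?thesis
    by (rule finite_subset) (intro finite_imageI finite_PiE; simp)
qed

section \<open>Weighted sequence spaces\<close>

text \<open>
  Square-summability is recorded through bounds on finite partial sums, so that no summability has
  to be carried along; only weighted \<open>\<ell>\<^sup>1\<close> sums are formed as infinite sums.
\<close>

definition hs_le :: "real \<Rightarrow> real \<Rightarrow> (int ^ 'n \<Rightarrow> complex) \<Rightarrow> bool" where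
  "hs_le s M a \<longleftrightarrow>
     (\<forall>F. finite F \<longrightarrow> (\<Sum>k\<in>F. bracket k powr (2 * s) * (norm (a k))\<^sup>2) \<le> M)"

lemma hs_leD: "hs_le s M a \<Longrightarrow> finite F \<Longrightarrow> (\<Sum>k\<in>F. bracket k powr (2 * s) * (norm (a k))\<^sup>2) \<le> M"
  by (simp add: hs_le_def)

lemma hs_le_nonneg: "hs_le s M a \<Longrightarrow> 0 \<le> M"
  using hs_leD[of s M a "{}"] by simp

lemma hs_le_mono: "hs_le s M a \<Longrightarrow> M \<le> M' \<Longrightarrow> hs_le s M' a"
  unfolding hs_le_def by (meson order_trans)

lemma hs_le_exponent:
  assumes "hs_le s M a" "s' \<le> s"
  shows "hs_le s' M a"
  unfolding hs_le_def
proof (intro allI impI)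
  fix F :: "(int ^ 'a) set" assume F: "finite F"
  have "(\<Sum>k\<in>F. bracket k powr (2 * s') * (norm (a k))\<^sup>2)
      \<le> (\<Sum>k\<in>F. bracket k powr (2 * s) * (norm (a k))\<^sup>2)"
    using assms(2) bracket_ge_1 by (intro sum_mono mult_right_mono powr_mono) auto
  also have "\<dots> \<le> M" by (rule hs_leD[OF assms(1) F])
  finally show "(\<Sum>k\<in>F. bracket k powr (2 * s') * (norm (a k))\<^sup>2) \<le> M" .
qed

lemma norm_diff_square_le: "(norm (x - y))\<^sup>2 \<le> 2 * (norm x)\<^sup>2 + 2 * (norm (y::'a::real_normed_vector))\<^sup>2"
proof -
  have "(norm (x - y))\<^sup>2 \<le> (norm x + norm y)\<^sup>2"
    by (intro power_mono norm_triangle_ineq4) simp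
  moreover have "0 \<le> (norm x - norm y)\<^sup>2" by simp
  ultimately show ?thesis by (simp add: power2_sum power2_diff)
qed

lemma hs_le_diff:
  assumes "hs_le s M a" "hs_le s M' b"
  shows "hs_le s (2 * (M + M')) (\<lambda>k. a k - b k)"
  unfolding hs_le_def
proof (intro allI impI)
  fix F :: "(int ^ 'a) set" assume F: "finite F"
  have "(\<Sum>k\<in>F. bracket k powr (2 * s) * (norm (a k - b k))\<^sup>2)
      \<le> (\<Sum>k\<in>F. bracket k powr (2 * s) * (2 * (norm (a k))\<^sup>2 + 2 * (norm (b k))\<^sup>2))"
    by (intro sum_mono mult_left_mono norm_diff_square_le) auto
  also have "\<dots> = 2 * (\<Sum>k\<in>F. bracket k powr (2 * s) * (norm (a k))\<^sup>2)
                + 2 * (\<Sum>k\<in>F. bracket k powr (2 * s) * (norm (b k))\<^sup>2)"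
    by (simp add: sum.distrib sum_distrib_left algebra_simps)
  also have "\<dots> \<le> 2 * (M + M')"
    using hs_leD[OF assms(1) F] hs_leD[OF assms(2) F] by simp
  finally show "(\<Sum>k\<in>F. bracket k powr (2 * s) * (norm (a k - b k))\<^sup>2) \<le> 2 * (M + M')" .
qed

lemma hs_le_norm: "hs_le s M a \<Longrightarrow> (norm (a k))\<^sup>2 * bracket k powr (2 * s) \<le> M"
  using hs_leD[of s M a "{k}"] by (simp add: mult.commute)

lemma cauchy_schwarz_sum:
  fixes f g :: "'a \<Rightarrow> real"
  assumes "(\<Sum>k\<in>F. (f k)\<^sup>2) \<le> A" "(\<Sum>k\<in>F. (g k)\<^sup>2) \<le> B"
  shows "(\<Sum>k\<in>F. \<bar>f k * g k\<bar>) \<le> sqrt A * sqrt B"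
proof -
  have "(\<Sum>k\<in>F. \<bar>f k * g k\<bar>) \<le> L2_set f F * L2_set g F"
    using L2_set_mult_ineq[of f g F] by (simp add: abs_mult)
  also have "\<dots> \<le> sqrt A * sqrt B"
    unfolding L2_set_def using assms order_trans[OF sum_nonneg assms(1)]
    by (intro mult_mono real_sqrt_le_mono) (auto intro!: sum_nonneg)
  finally show ?thesis .
qed

lemma nonneg_summable_onI:
  fixes f :: "'a \<Rightarrow> real"
  assumes "\<And>x. x \<in> A \<Longrightarrow> 0 \<le> f x" "\<And>F. finite F \<Longrightarrow> F \<subseteq> A \<Longrightarrow> sum f F \<le> B"
  shows "f summable_on A"
  using assms by (intro nonneg_bdd_above_summable_on) (auto simp: bdd_above_def)

lemma nonneg_infsum_leI:
  fixes f :: "'a \<Rightarrow> real"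
  assumes "\<And>x. x \<in> A \<Longrightarrow> 0 \<le> f x" "\<And>F. finite F \<Longrightarrow> F \<subseteq> A \<Longrightarrow> sum f F \<le> B"
  shows "infsum f A \<le> B"
  using nonneg_summable_onI[OF assms] assms(2) by (rule infsum_le_finite_sums)

definition w1 :: "(int ^ 'n \<Rightarrow> complex) \<Rightarrow> int ^ 'n \<Rightarrow> real" where
  "w1 a k = bracket k * norm (a k)"

lemma w1_nonneg [simp]: "0 \<le> w1 a k"
  by (simp add: w1_def)

lemma norm_le_w1: "norm (a k) \<le> w1 a k"
  using mult_right_mono[OF bracket_ge_1[of k], of "norm (a k)"] by (simp add: w1_def)

text \<open>
  Sobolev embedding on the Fourier side: Cauchy--Schwarz against the lattice sum of
  \<open>bracket k powr (2 - 2 * s)\<close>, which converges precisely because \<open>s > n/2 + 1\<close>. Its tails make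
  those of the \<open>w1\<close> sums small, uniformly on bounded sets.
\<close>

lemma w1_sum_le_sqrt:
  fixes a :: "int ^ 'n::finite \<Rightarrow> complex"
  assumes "hs_le s M a" "finite G" "(\<Sum>k\<in>G. bracket k powr - (2 * s - 2)) \<le> L"
  shows "(\<Sum>k\<in>G. w1 a k) \<le> sqrt L * sqrt M"
proof -
  have "(\<Sum>k\<in>G. w1 a k) = (\<Sum>k\<in>G. \<bar>bracket k powr - (s - 1) * (bracket k powr s * norm (a k))\<bar>)"
  proof (intro sum.cong refl)
    fix k :: "int ^ 'n"
    have "bracket k = bracket k powr (- (s - 1) + s)" by simp
    also have "\<dots> = bracket k powr - (s - 1) * bracket k powr s" by (rule powr_add)
    finally show "w1 a k = \<bar>bracket k powr - (s - 1) * (bracket k powr s * norm (a k))\<bar>"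
      by (simp add: w1_def abs_mult)
  qed
  also have "\<dots> \<le> sqrt L * sqrt M"
  proof (rule cauchy_schwarz_sum)
    have "(bracket k powr - (s - 1))\<^sup>2 = bracket k powr - (2 * s - 2)" for k :: "int ^ 'n"
      by (simp add: power2_eq_square powr_add[symmetric])
    then show "(\<Sum>k\<in>G. (bracket k powr - (s - 1))\<^sup>2) \<le> L" using assms(3) by simp
    have "(bracket k powr s * norm (a k))\<^sup>2 = bracket k powr (2 * s) * (norm (a k))\<^sup>2" for k
      by (simp add: power2_eq_square powr_add[symmetric])
    then show "(\<Sum>k\<in>G. (bracket k powr s * norm (a k))\<^sup>2) \<le> M"
      using hs_leD[OF assms(1,2)] by simp
  qed
  finally show ?thesis .
qed

lemma w1_uniform_tail:
  assumes s: "s > CARD('n) / 2 + 1" and e: "e > 0"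
  obtains F :: "(int ^ 'n::finite) set" where "finite F"
    "\<And>a G. hs_le s M a \<Longrightarrow> finite G \<Longrightarrow> G \<inter> F = {} \<Longrightarrow> (\<Sum>k\<in>G. w1 a k) \<le> e"
proof -
  let ?b = "\<lambda>k::int ^ 'n. bracket k powr - (2 * s - 2)"
  define L where "L = e\<^sup>2 / (\<bar>M\<bar> + 1)"
  have L: "L > 0" using e by (simp add: L_def add_nonneg_pos)
  have sm: "?b summable_on UNIV"
    by (rule summable_bracket_powr[where p = "2 * s - 2"]) (use s in \<open>simp add: field_simps\<close>)
  obtain F where F: "finite F" "dist (sum ?b F) (infsum ?b UNIV) \<le> L"
    using infsum_finite_approximation[OF sm L] by auto
  have tail: "(\<Sum>k\<in>G. ?b k) \<le> L" if "finite G" "G \<inter> F = {}" for G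
  proof -
    have "sum ?b (F \<union> G) \<le> infsum ?b UNIV"
      using F that by (intro finite_sum_le_infsum sm) auto
    then show ?thesis
      using F(2) that F(1) by (subst (asm) sum.union_disjoint) (auto simp: dist_real_def)
  qed
  show thesis
  proof (rule that[OF F(1)])
    fix a :: "int ^ 'n \<Rightarrow> complex" and G
    assume a: "hs_le s M a" "finite G" "G \<inter> F = {}"
    have "(\<Sum>k\<in>G. w1 a k) \<le> sqrt L * sqrt M"
      by (rule w1_sum_le_sqrt[OF a(1,2) tail[OF a(2,3)]])
    also have "\<dots> = sqrt (e\<^sup>2 * (M / (\<bar>M\<bar> + 1)))"
      by (simp add: L_def real_sqrt_mult[symmetric])
    also have "\<dots> \<le> sqrt (e\<^sup>2 * 1)"
      by (intro real_sqrt_le_mono mult_left_mono) auto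
    also have "\<dots> = e" using e by simp
    finally show "(\<Sum>k\<in>G. w1 a k) \<le> e" .
  qed
qed

lemma w1_bounded:
  assumes s: "s > CARD('n) / 2 + 1"
  obtains A where "A > 0"
    "\<And>a::int ^ 'n::finite \<Rightarrow> complex. hs_le s M a \<Longrightarrow> w1 a summable_on UNIV \<and> infsum (w1 a) UNIV \<le> A"
proof -
  let ?b = "\<lambda>k::int ^ 'n. bracket k powr - (2 * s - 2)"
  have sm: "?b summable_on UNIV"
    by (rule summable_bracket_powr[where p = "2 * s - 2"]) (use s in \<open>simp add: field_simps\<close>)
  define A where "A = sqrt (infsum ?b UNIV) * sqrt \<bar>M\<bar> + 1"
  have A: "A > 0" unfolding A_def by (intro add_nonneg_pos mult_nonneg_nonneg) (auto intro: infsum_nonneg)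
  show thesis
  proof (rule that[OF A], intro conjI)
    fix a :: "int ^ 'n \<Rightarrow> complex" assume a: "hs_le s M a"
    have fin: "sum (w1 a) G \<le> A" if "finite G" for G
    proof -
      have "sum (w1 a) G \<le> sqrt (infsum ?b UNIV) * sqrt M"
        by (rule w1_sum_le_sqrt[OF a that]) (use that sm in \<open>auto intro: finite_sum_le_infsum\<close>)
      then show ?thesis using hs_le_nonneg[OF a] by (simp add: A_def)
    qed
    show "w1 a summable_on UNIV" by (rule nonneg_summable_onI[where B = A]) (auto intro: fin)
    show "infsum (w1 a) UNIV \<le> A" by (rule nonneg_infsum_leI) (auto intro: fin)
  qed
qed

text \<open>
  Outside a finite set the weak weight is a small multiple of the strong one, for which there is a
  bound; inside that set convergence of each single mode suffices.
\<close>

lemma weighted_tail_tendsto: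
  fixes w W :: "'k \<Rightarrow> real" and \<phi> :: "'i \<Rightarrow> 'k \<Rightarrow> real"
  assumes w: "\<And>k. 0 \<le> w k"
    and small: "\<And>e. e > 0 \<Longrightarrow> \<exists>F. finite F \<and> (\<forall>k. k \<notin> F \<longrightarrow> w k \<le> e * W k)"
    and bound: "eventually (\<lambda>i. \<forall>F. finite F \<longrightarrow> (\<Sum>k\<in>F. W k * (\<phi> i k)\<^sup>2) \<le> B) net"
    and lim: "\<And>k. ((\<lambda>i. \<phi> i k) \<longlongrightarrow> 0) net"
    and e: "e > 0"
  shows "eventually (\<lambda>i. \<forall>F. finite F \<longrightarrow> (\<Sum>k\<in>F. w k * (\<phi> i k)\<^sup>2) \<le> e) net"
proof -
  define d where "d = e / (2 * (\<bar>B\<bar> + 1))"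
  have d: "d > 0" using e by (simp add: d_def)
  obtain H where H: "finite H" "\<And>k. k \<notin> H \<Longrightarrow> w k \<le> d * W k"
    using small[OF d] by auto
  have "((\<lambda>i. \<Sum>k\<in>H. w k * (\<phi> i k)\<^sup>2) \<longlongrightarrow> (\<Sum>k\<in>H. w k * 0\<^sup>2)) net"
    by (intro tendsto_intros lim)
  then have "eventually (\<lambda>i. (\<Sum>k\<in>H. w k * (\<phi> i k)\<^sup>2) < e / 2) net"
    using e by (intro order_tendstoD) auto
  with bound show ?thesis
  proof eventually_elim
    case (elim i)
    show ?case
    proof (intro allI impI)
      fix F :: "'k set" assume F: "finite F"
      have "(\<Sum>k\<in>F. w k * (\<phi> i k)\<^sup>2) \<le> (\<Sum>k\<in>(F - H) \<union> H. w k * (\<phi> i k)\<^sup>2)"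
        using F H(1) w by (intro sum_mono2) auto
      also have "\<dots> = (\<Sum>k\<in>F - H. w k * (\<phi> i k)\<^sup>2) + (\<Sum>k\<in>H. w k * (\<phi> i k)\<^sup>2)"
        using F H(1) by (intro sum.union_disjoint) auto
      also have "(\<Sum>k\<in>F - H. w k * (\<phi> i k)\<^sup>2) \<le> (\<Sum>k\<in>F - H. d * (W k * (\<phi> i k)\<^sup>2))"
        using H(2) by (intro sum_mono) (auto simp: mult.assoc[symmetric] intro!: mult_right_mono)
      also have "\<dots> = d * (\<Sum>k\<in>F - H. W k * (\<phi> i k)\<^sup>2)" by (simp add: sum_distrib_left)
      also have "\<dots> \<le> d * (\<bar>B\<bar> + 1)"
      proof (rule mult_left_mono)
        have "(\<Sum>k\<in>F - H. W k * (\<phi> i k)\<^sup>2) \<le> B" using elim(1) F by blast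
        then show "(\<Sum>k\<in>F - H. W k * (\<phi> i k)\<^sup>2) \<le> \<bar>B\<bar> + 1" by linarith
      qed (use d in simp)
      also have "d * (\<bar>B\<bar> + 1) = e / 2" by (simp add: d_def field_simps)
      finally show "(\<Sum>k\<in>F. w k * (\<phi> i k)\<^sup>2) \<le> e"
        using elim(2) by simp
    qed
  qed
qed

section \<open>Transport on the Fourier side\<close>

lemma infsum_shift:
  fixes f :: "int ^ 'n \<Rightarrow> int ^ 'n \<Rightarrow> 'b::{topological_comm_monoid_add, t2_space}"
  shows "(\<Sum>\<^sub>\<infinity>l. f (k - l) l) = (\<Sum>\<^sub>\<infinity>m. f m (k - m))"
  by (rule infsum_reindex_bij_witness[where i = "\<lambda>m. k - m" and j = "\<lambda>l. k - l"]) auto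

lemma summable_on_shift:
  fixes f :: "int ^ 'n \<Rightarrow> int ^ 'n \<Rightarrow> 'b::{topological_comm_monoid_add, t2_space}"
  shows "(\<lambda>l. f (k - l) l) summable_on UNIV \<longleftrightarrow> (\<lambda>m. f m (k - m)) summable_on UNIV"
  by (rule summable_on_reindex_bij_witness[where i = "\<lambda>m. k - m" and j = "\<lambda>l. k - l"]) auto

lemma summable_infsum_of_finite_sum:
  fixes f :: "'k \<Rightarrow> 'm \<Rightarrow> 'b::{topological_comm_monoid_add, t2_space}"
  assumes "finite F" "\<And>k. k \<in> F \<Longrightarrow> f k summable_on A"
  shows "(\<lambda>m. \<Sum>k\<in>F. f k m) summable_on A \<and> (\<Sum>\<^sub>\<infinity>m\<in>A. \<Sum>k\<in>F. f k m) = (\<Sum>k\<in>F. infsum (f k) A)"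
  using assms
proof (induction F rule: finite_induct)
  case (insert x F)
  then have "(\<lambda>m. \<Sum>k\<in>F. f k m) summable_on A"
    "(\<Sum>\<^sub>\<infinity>m\<in>A. \<Sum>k\<in>F. f k m) = (\<Sum>k\<in>F. infsum (f k) A)" "f x summable_on A"
    by auto
  then show ?case
    using insert.hyps by (simp add: summable_on_add infsum_add)
qed simp

lemmas summable_on_finite_sum = conjunct1[OF summable_infsum_of_finite_sum]
lemmas infsum_finite_sum = conjunct2[OF summable_infsum_of_finite_sum]

definition l2_le :: "('k \<Rightarrow> real) \<Rightarrow> real \<Rightarrow> bool" where
  "l2_le g \<Gamma> \<longleftrightarrow> (\<forall>F. finite F \<longrightarrow> (\<Sum>k\<in>F. (g k)\<^sup>2) \<le> \<Gamma>)"

lemma l2_leD: "l2_le g \<Gamma> \<Longrightarrow> finite F \<Longrightarrow> (\<Sum>k\<in>F. (g k)\<^sup>2) \<le> \<Gamma>"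
  by (simp add: l2_le_def)

lemma l2_le_bound: "l2_le g \<Gamma> \<Longrightarrow> \<bar>g k\<bar> \<le> sqrt \<Gamma>"
  using l2_leD[of g \<Gamma> "{k}"] by (simp add: real_le_rsqrt)

lemma l2_le_nonneg: "l2_le g \<Gamma> \<Longrightarrow> 0 \<le> \<Gamma>"
  using l2_leD[of g \<Gamma> "{}"] by simp

lemma hs_le_l2: "hs_le s M a \<longleftrightarrow> l2_le (\<lambda>k. bracket k powr s * norm (a k)) M"
  by (simp add: hs_le_def l2_le_def power_mult_distrib power2_eq_square[of "bracket _ powr s"]
        powr_add[symmetric])

text \<open>
  Young's convolution inequality \<open>\<ell>\<^sup>1 * \<ell>\<^sup>2 \<subseteq> \<ell>\<^sup>2\<close> in dual form: after the shift \<open>l = k - m\<close> the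
  sum over \<open>k\<close> is estimated by Cauchy--Schwarz for every fixed \<open>m\<close>.
\<close>

lemma convolution_summable:
  fixes f g :: "int ^ 'n \<Rightarrow> real"
  assumes f: "f summable_on UNIV" "\<And>m. 0 \<le> f m" and g: "l2_le g \<Gamma>" "\<And>m. 0 \<le> g m"
  shows "(\<lambda>l. f (k - l) * g l) summable_on UNIV" "(\<lambda>l. g (k - l) * f l) summable_on UNIV"
proof -
  have *: "(\<lambda>m. f m * g (k - m)) summable_on UNIV"
  proof (rule summable_on_comparison_test)
    show "(\<lambda>m. f m * sqrt \<Gamma>) summable_on UNIV" by (intro summable_on_cmult_left f(1))
    show "f m * g (k - m) \<le> f m * sqrt \<Gamma>" for m
      using l2_le_bound[OF g(1), of "k - m"] f(2) by (intro mult_left_mono) auto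
  qed (simp add: f g)
  then show "(\<lambda>l. f (k - l) * g l) summable_on UNIV"
    by (subst summable_on_shift[of "\<lambda>m l. f m * g l"])
  show "(\<lambda>l. g (k - l) * f l) summable_on UNIV"
    using * by (simp add: mult.commute)
qed

lemma young_trilinear:
  fixes f g h :: "int ^ 'n \<Rightarrow> real"
  assumes f: "f summable_on UNIV" "\<And>m. 0 \<le> f m" and g: "l2_le g \<Gamma>" "\<And>m. 0 \<le> g m"
    and F: "finite F" and h: "(\<Sum>k\<in>F. (h k)\<^sup>2) \<le> H" "\<And>m. 0 \<le> h m"
    and A: "infsum f UNIV \<le> A"
  shows "(\<Sum>k\<in>F. h k * (\<Sum>\<^sub>\<infinity>l. f (k - l) * g l)) \<le> A * (sqrt H * sqrt \<Gamma>)"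
    and "(\<Sum>k\<in>F. h k * (\<Sum>\<^sub>\<infinity>l. g (k - l) * f l)) \<le> A * (sqrt H * sqrt \<Gamma>)"
proof -
  have H: "0 \<le> H" by (rule order_trans[OF sum_nonneg h(1)]) simp
  have s: "(\<lambda>m. f m * g (k - m)) summable_on UNIV" for k
    using convolution_summable(2)[OF f g] by (simp add: mult.commute)
  have "(\<Sum>k\<in>F. h k * (\<Sum>\<^sub>\<infinity>m. f m * g (k - m))) = (\<Sum>k\<in>F. \<Sum>\<^sub>\<infinity>m. h k * (f m * g (k - m)))"
    by (intro sum.cong refl infsum_cmult_right[symmetric] s)
  also have "\<dots> = (\<Sum>\<^sub>\<infinity>m. \<Sum>k\<in>F. h k * (f m * g (k - m)))"
    by (intro infsum_finite_sum[symmetric] summable_on_cmult_right s F)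
  also have "\<dots> \<le> (\<Sum>\<^sub>\<infinity>m. f m * (sqrt H * sqrt \<Gamma>))"
  proof (rule infsum_mono)
    show "(\<lambda>m. \<Sum>k\<in>F. h k * (f m * g (k - m))) summable_on UNIV"
      by (intro summable_on_finite_sum summable_on_cmult_right s F)
    show "(\<lambda>m. f m * (sqrt H * sqrt \<Gamma>)) summable_on UNIV"
      by (intro summable_on_cmult_left f)
    fix m
    have "(\<Sum>k\<in>F. h k * (f m * g (k - m))) = f m * (\<Sum>k\<in>F. h k * g (k - m))"
      by (simp add: sum_distrib_left algebra_simps)
    also have "\<dots> \<le> f m * (sqrt H * sqrt \<Gamma>)"
    proof (rule mult_left_mono[OF _ f(2)])
      have "(\<Sum>k\<in>F. (g (k - m))\<^sup>2) = (\<Sum>k\<in>(\<lambda>k. k - m) ` F. (g k)\<^sup>2)"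
        by (subst sum.reindex) (auto simp: inj_on_def)
      also have "\<dots> \<le> \<Gamma>" using F by (intro l2_leD[OF g(1)]) simp
      finally have "(\<Sum>k\<in>F. \<bar>h k * g (k - m)\<bar>) \<le> sqrt H * sqrt \<Gamma>"
        by (intro cauchy_schwarz_sum h(1))
      then show "(\<Sum>k\<in>F. h k * g (k - m)) \<le> sqrt H * sqrt \<Gamma>"
        using h(2) g(2) by simp
    qed
    finally show "(\<Sum>k\<in>F. h k * (f m * g (k - m))) \<le> f m * (sqrt H * sqrt \<Gamma>)" .
  qed
  also have "\<dots> = infsum f UNIV * (sqrt H * sqrt \<Gamma>)" by (intro infsum_cmult_left f)
  also have "\<dots> \<le> A * (sqrt H * sqrt \<Gamma>)"
    using H l2_le_nonneg[OF g(1)] by (intro mult_right_mono A) simp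
  finally have *: "(\<Sum>k\<in>F. h k * (\<Sum>\<^sub>\<infinity>m. f m * g (k - m))) \<le> A * (sqrt H * sqrt \<Gamma>)" .
  show "(\<Sum>k\<in>F. h k * (\<Sum>\<^sub>\<infinity>l. f (k - l) * g l)) \<le> A * (sqrt H * sqrt \<Gamma>)"
    using * by (subst infsum_shift[of "\<lambda>m l. f m * g l"])
  show "(\<Sum>k\<in>F. h k * (\<Sum>\<^sub>\<infinity>l. g (k - l) * f l)) \<le> A * (sqrt H * sqrt \<Gamma>)"
    using * by (simp add: mult.commute)
qed

definition transport_term ::
  "('n::finite \<Rightarrow> int ^ 'n \<Rightarrow> complex) \<Rightarrow> (int ^ 'n \<Rightarrow> complex) \<Rightarrow> int ^ 'n \<Rightarrow> int ^ 'n \<Rightarrow> complex" where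
  "transport_term U a k l = (\<Sum>j\<in>UNIV. U j (k - l) * (\<i> * of_int (l $ j))) * a l"

definition transport ::
  "('n::finite \<Rightarrow> int ^ 'n \<Rightarrow> complex) \<Rightarrow> (int ^ 'n \<Rightarrow> complex) \<Rightarrow> int ^ 'n \<Rightarrow> complex" where
  "transport U a k = (\<Sum>\<^sub>\<infinity>l. transport_term U a k l)"

definition speed :: "('n::finite \<Rightarrow> int ^ 'n \<Rightarrow> complex) \<Rightarrow> int ^ 'n \<Rightarrow> real" where
  "speed U m = (\<Sum>j\<in>UNIV. norm (U j m))"

lemma speed_nonneg [simp]: "0 \<le> speed U m"
  by (simp add: speed_def sum_nonneg)

lemma norm_transport_term: "norm (transport_term U a k l) \<le> speed U (k - l) * w1 a l"
proof -
  have "norm (\<Sum>j\<in>UNIV. U j (k - l) * (\<i> * of_int (l $ j))) \<le> (\<Sum>j\<in>UNIV. norm (U j (k - l)) * bracket l)"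
    using abs_component_le_bracket[of l]
    by (intro sum_norm_le) (auto simp: norm_mult intro!: mult_left_mono)
  also have "\<dots> = speed U (k - l) * bracket l" by (simp add: speed_def sum_distrib_right)
  finally have "norm (transport_term U a k l) \<le> speed U (k - l) * bracket l * norm (a l)"
    unfolding transport_term_def norm_mult by (rule mult_right_mono) simp
  then show ?thesis by (simp add: w1_def mult.assoc)
qed

lemma transport_term_summable:
  assumes "w1 a summable_on UNIV" "\<And>m. speed U m \<le> B"
  shows "(\<lambda>l. norm (transport_term U a k l)) summable_on UNIV"
proof (rule Infinite_Sum.abs_summable_on_comparison_test')
  show "(\<lambda>l. B * w1 a l) summable_on UNIV" by (intro summable_on_cmult_right assms)
  show "norm (transport_term U a k l) \<le> B * w1 a l" for l
    using norm_transport_term[of U a k l] mult_right_mono[OF assms(2), of "w1 a l" "k - l"] by auto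
qed

text \<open>
  The energy identity \<open>\<integral> (u \<cdot> \<nabla>f) f = 0\<close> for divergence-free \<open>u\<close> and real \<open>f\<close>, truncated to a
  symmetric set of modes: the map \<open>(k, l) \<mapsto> (- l, - k)\<close> changes the sign of the summand. Reality
  of \<open>f\<close> enters through \<open>a (- k)\<close>, which stands for the conjugate of \<open>a k\<close>.
\<close>

lemma transport_cancels:
  fixes a :: "int ^ 'n::finite \<Rightarrow> complex" and w :: "int ^ 'n \<Rightarrow> real"
  assumes divfree: "\<And>m. (\<Sum>j\<in>UNIV. of_int (m $ j) * U j m) = 0"
    and even: "\<And>k. w (- k) = w k"
    and F: "\<And>k. k \<in> F \<Longrightarrow> - k \<in> F"
  shows "(\<Sum>k\<in>F. \<Sum>l\<in>F. of_real (w k * w l) * transport_term U a k l * a (- k)) = 0"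
proof -
  define Q where "Q = (\<lambda>(k, l). of_real (w k * w l) * transport_term U a k l * a (- k))"
  have anti: "Q (k, l) = - Q (- l, - k)" for k l
  proof -
    have "Q (k, l) + Q (- l, - k)
        = of_real (w k * w l) * a l * a (- k)
          * (\<Sum>j\<in>UNIV. U j (k - l) * (\<i> * of_int (l $ j)) + U j (k - l) * (\<i> * of_int (- k $ j)))"
      unfolding Q_def transport_term_def sum.distrib by (simp add: even algebra_simps)
    also have "(\<Sum>j\<in>UNIV. U j (k - l) * (\<i> * of_int (l $ j)) + U j (k - l) * (\<i> * of_int (- k $ j)))
        = - \<i> * (\<Sum>j\<in>UNIV. of_int ((k - l) $ j) * U j (k - l))"
      unfolding sum_distrib_left by (intro sum.cong refl) (simp add: algebra_simps)
    finally have "Q (k, l) + Q (- l, - k) = 0" unfolding divfree by simp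
    then show ?thesis by (simp only: eq_neg_iff_add_eq_0)
  qed
  have anti': "Q (- l, - k) = - Q (k, l)" for k l using anti[of k l] by simp
  have "sum Q (F \<times> F) = sum (\<lambda>(k, l). Q (- l, - k)) (F \<times> F)"
    by (rule sum.reindex_bij_witness[where i = "\<lambda>(k, l). (- l, - k)" and j = "\<lambda>(k, l). (- l, - k)"])
       (auto intro: F)
  also have "\<dots> = - sum Q (F \<times> F)"
    unfolding sum_negf[symmetric] by (intro sum.cong refl) (auto intro: anti')
  finally have "sum Q (F \<times> F) = 0" by simp
  then show ?thesis by (simp add: Q_def sum.cartesian_product)
qed

text \<open>
  One factor \<open>w k\<close> of the weight is exchanged for \<open>w l\<close>; the term with \<open>w k * w l\<close> cancels, and the
  commutator \<open>w k - w l\<close> remains.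
\<close>

lemma weighted_transport_le_commutator:
  fixes a :: "int ^ 'n::finite \<Rightarrow> complex" and w :: "int ^ 'n \<Rightarrow> real"
  assumes divfree: "\<And>m. (\<Sum>j\<in>UNIV. of_int (m $ j) * U j m) = 0"
    and real: "\<And>k. a (- k) = cnj (a k)"
    and even: "\<And>k. w (- k) = w k" and w: "\<And>k. 0 \<le> w k"
    and F: "finite F" "\<And>k. k \<in> F \<Longrightarrow> - k \<in> F" and supp: "\<And>k. k \<notin> F \<Longrightarrow> w k = 0"
    and sm: "\<And>k. (\<lambda>l. norm (transport_term U a k l)) summable_on UNIV"
    and comm: "\<And>k l. \<bar>w k - w l\<bar> * norm (transport_term U a k l) \<le> K k l"
    and Ksm: "\<And>k. K k summable_on UNIV"
  shows "\<bar>\<Sum>k\<in>F. (w k)\<^sup>2 * (a k \<bullet> transport U a k)\<bar>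
       \<le> (\<Sum>k\<in>F. w k * norm (a k) * (\<Sum>\<^sub>\<infinity>l. K k l))"
proof -
  let ?R = "\<lambda>k. (\<Sum>\<^sub>\<infinity>l. of_real (w k - w l) * transport_term U a k l)"
  let ?Z = "\<lambda>k. (\<Sum>l\<in>F. of_real (w l) * transport_term U a k l)"
  have comm': "norm (of_real (w k - w l) * transport_term U a k l) \<le> K k l" for k l
    using comm[of k l] by (simp only: norm_mult norm_of_real)
  have Rsm: "(\<lambda>l. norm (of_real (w k - w l) * transport_term U a k l)) summable_on UNIV" for k
    by (rule Infinite_Sum.abs_summable_on_comparison_test', rule Ksm[of k], rule comm')
  have split: "of_real (w k) * transport U a k = ?R k + ?Z k" for k
  proof -
    have fin: "(\<Sum>\<^sub>\<infinity>l. of_real (w l) * transport_term U a k l) = ?Z k"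
      using infsum_cong_neutral[of F UNIV "\<lambda>l. of_real (w l) * transport_term U a k l"
          "\<lambda>l. of_real (w l) * transport_term U a k l"] supp F(1) by auto
    have "of_real (w k) * transport U a k = (\<Sum>\<^sub>\<infinity>l. of_real (w k) * transport_term U a k l)"
      unfolding transport_def by (rule infsum_cmult_right[symmetric], rule abs_summable_summable, rule sm)
    also have "\<dots> = (\<Sum>\<^sub>\<infinity>l. of_real (w k - w l) * transport_term U a k l
                       + of_real (w l) * transport_term U a k l)"
      by (simp add: algebra_simps)
    also have "\<dots> = ?R k + (\<Sum>\<^sub>\<infinity>l. of_real (w l) * transport_term U a k l)"
    proof (rule infsum_add)
      show "(\<lambda>l. of_real (w k - w l) * transport_term U a k l) summable_on UNIV"
        by (rule abs_summable_summable[OF Rsm])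
      show "(\<lambda>l. of_real (w l) * transport_term U a k l) summable_on UNIV"
        using F(1) by (rule finite_nonzero_values_imp_summable_on[OF finite_subset, rotated])
          (use supp in auto)
    qed
    finally show ?thesis by (simp add: fin)
  qed
  have "(\<Sum>k\<in>F. of_real ((w k)\<^sup>2) * (transport U a k * a (- k)))
      = (\<Sum>k\<in>F. of_real (w k) * a (- k) * ?R k) + (\<Sum>k\<in>F. of_real (w k) * a (- k) * ?Z k)"
    unfolding sum.distrib[symmetric] distrib_left[symmetric] split[symmetric]
    by (intro sum.cong refl) (simp add: power2_eq_square algebra_simps)
  also have "(\<Sum>k\<in>F. of_real (w k) * a (- k) * ?Z k)
      = (\<Sum>k\<in>F. \<Sum>l\<in>F. of_real (w k * w l) * transport_term U a k l * a (- k))"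
    by (simp add: sum_distrib_left algebra_simps)
  also have "\<dots> = 0" by (rule transport_cancels[where w = w and F = F, OF divfree even F(2)])
  finally have eq: "(\<Sum>k\<in>F. of_real ((w k)\<^sup>2) * (transport U a k * a (- k)))
      = (\<Sum>k\<in>F. of_real (w k) * a (- k) * ?R k)" by simp
  have "(\<Sum>k\<in>F. (w k)\<^sup>2 * (a k \<bullet> transport U a k))
      = Re (\<Sum>k\<in>F. of_real ((w k)\<^sup>2) * (transport U a k * a (- k)))"
    by (simp add: real inner_complex_def algebra_simps)
  also have "\<bar>\<dots>\<bar> \<le> norm (\<Sum>k\<in>F. of_real (w k) * a (- k) * ?R k)"
    unfolding eq by (rule abs_Re_le_cmod)
  also have "\<dots> \<le> (\<Sum>k\<in>F. w k * norm (a k) * (\<Sum>\<^sub>\<infinity>l. K k l))"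
  proof (rule sum_norm_le)
    fix k
    have "norm (?R k) \<le> (\<Sum>\<^sub>\<infinity>l. norm (of_real (w k - w l) * transport_term U a k l))"
      by (rule norm_infsum_bound[OF Rsm])
    also have "\<dots> \<le> (\<Sum>\<^sub>\<infinity>l. K k l)"
      by (rule infsum_mono, rule Rsm, rule Ksm, rule comm')
    finally show "norm (of_real (w k) * a (- k) * ?R k) \<le> w k * norm (a k) * (\<Sum>\<^sub>\<infinity>l. K k l)"
      using w by (simp add: norm_mult real mult_left_mono)
  qed
  finally show ?thesis .
qed

subsection \<open>Truncated Sobolev weights\<close>

text \<open>
  The weight \<open>bracket powr s\<close> is cut off linearly at \<open>N\<close>, not sharply: energies become finite sums,
  and the weight keeps a Lipschitz bound like that of \<open>bracket powr s\<close>, uniformly in \<open>N\<close>.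
\<close>

definition hat :: "real \<Rightarrow> real \<Rightarrow> int ^ 'n \<Rightarrow> real" where
  "hat s N k = bracket k powr s * max 0 (1 - bracket k / N)"

text \<open>
  The slope of the cutoff costs no more than that of the power: where the cutoff is active,
  \<open>x powr s / N\<close> is at most \<open>y powr (s - 1)\<close>. The exponent \<open>s = 0\<close> is included because it gives
  the \<open>L\<^sup>2\<close> energy.
\<close>

lemma powr_hat_lipschitz:
  fixes s x y N :: real
  assumes s: "s = 0 \<or> 1 \<le> s" and xy: "0 < x" "x \<le> y" and N: "0 < N"
  shows "\<bar>y powr s * max 0 (1 - y / N) - x powr s * max 0 (1 - x / N)\<bar> \<le> (s + 1) * (y - x) * y powr (s - 1)"
proof -
  let ?c = "\<lambda>x. max 0 (1 - x / N)"
  have c: "0 \<le> ?c y" "?c y \<le> 1" using xy N by auto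
  have m: "\<bar>y powr s - x powr s\<bar> \<le> s * (y - x) * y powr (s - 1)"
  proof (cases "s = 0 \<or> x = y")
    case False
    then have s1: "1 \<le> s" and lt: "x < y" using s xy by auto
    have "\<exists>z>x. z < y \<and> y powr s - x powr s = (y - x) * (s * z powr (s - 1))"
      by (rule MVT2[OF lt]) (use xy in \<open>auto intro!: derivative_eq_intros\<close>)
    then obtain z where z: "x < z" "z < y" "y powr s - x powr s = (y - x) * (s * z powr (s - 1))"
      by blast
    have "z powr (s - 1) \<le> y powr (s - 1)" using z xy s1 by (intro powr_mono2) auto
    then have "(y - x) * (s * z powr (s - 1)) \<le> (y - x) * (s * y powr (s - 1))"
      using xy s1 by (intro mult_left_mono) auto
    moreover have "x powr s \<le> y powr s" using xy s1 by (intro powr_mono2) auto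
    ultimately show ?thesis using z by (simp add: algebra_simps)
  qed (use xy in auto)
  have d: "x powr s * \<bar>?c y - ?c x\<bar> \<le> (y - x) * y powr (s - 1)"
  proof -
    have "\<bar>?c y - ?c x\<bar> \<le> (y - x) / y"
    proof (cases "y \<le> N")
      case True
      then have "\<bar>?c y - ?c x\<bar> = (y - x) / N" using xy N by (auto simp: field_simps)
      also have "\<dots> \<le> (y - x) / y" using True xy by (intro divide_left_mono) auto
      finally show ?thesis .
    next
      case False
      show ?thesis
      proof (cases "x \<le> N")
        case True
        have "x / y \<le> x / N" using xy N False by (intro divide_left_mono) auto
        then show ?thesis using True False xy N by (auto simp: diff_divide_distrib)
      qed (use False xy N in \<open>auto simp: max_def\<close>)
    qed
    then have "x powr s * \<bar>?c y - ?c x\<bar> \<le> y powr s * ((y - x) / y)"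
      using xy s by (intro mult_mono powr_mono2) auto
    also have "\<dots> = (y - x) * y powr (s - 1)" using xy by (simp add: powr_diff)
    finally show ?thesis .
  qed
  have "y powr s * ?c y - x powr s * ?c x = (y powr s - x powr s) * ?c y + x powr s * (?c y - ?c x)"
    by (simp add: algebra_simps)
  also have "\<bar>\<dots>\<bar> \<le> \<bar>y powr s - x powr s\<bar> * ?c y + x powr s * \<bar>?c y - ?c x\<bar>"
    by (rule order_trans[OF abs_triangle_ineq]) (use c in \<open>simp add: abs_mult\<close>)
  also have "\<dots> \<le> \<bar>y powr s - x powr s\<bar> * 1 + x powr s * \<bar>?c y - ?c x\<bar>"
    by (intro add_mono mult_left_mono c order_refl) simp
  also have "\<dots> \<le> s * (y - x) * y powr (s - 1) + (y - x) * y powr (s - 1)"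
    using m by (intro add_mono d) simp
  also have "\<dots> = (s + 1) * (y - x) * y powr (s - 1)" by (simp only: ring_distribs mult_1_left)
  finally show ?thesis .
qed

lemma hat_lipschitz:
  assumes s: "s = 0 \<or> 1 \<le> s" and N: "0 < N"
  shows "\<bar>hat s N k - hat s N l\<bar> \<le> (s + 1) * norm (freq (k - l)) * max (bracket k) (bracket l) powr (s - 1)"
proof -
  have *: "\<bar>hat s N k - hat s N l\<bar> \<le> (s + 1) * norm (freq (k - l)) * bracket k powr (s - 1)"
    if "bracket l \<le> bracket k" for k l :: "int ^ 'a"
  proof -
    have "\<bar>hat s N k - hat s N l\<bar> \<le> (s + 1) * (bracket k - bracket l) * bracket k powr (s - 1)"
      unfolding hat_def by (rule powr_hat_lipschitz[OF s _ that N]) simp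
    also have "\<dots> \<le> (s + 1) * norm (freq (k - l)) * bracket k powr (s - 1)"
      using bracket_lipschitz[of k l] s by (intro mult_right_mono mult_left_mono) auto
    finally show ?thesis .
  qed
  show ?thesis
  proof (cases "bracket l \<le> bracket k")
    case True then show ?thesis using *[OF True] by (simp add: max_absorb1)
  next
    case False
    then have kl: "bracket k \<le> bracket l" by simp
    show ?thesis using *[OF kl] kl
      by (simp add: max_absorb2 abs_minus_commute freq_diff norm_minus_commute)
  qed
qed

lemma hat_nonneg [simp]: "0 \<le> hat s N k"
  by (simp add: hat_def)

lemma hat_minus [simp]: "hat s N (- k) = hat s N k"
  by (simp add: hat_def)

lemma hat_le: "0 < N \<Longrightarrow> hat s N k \<le> bracket k powr s"
  unfolding hat_def using mult_left_mono[of "max 0 (1 - bracket k / N)" 1 "bracket k powr s"] by simp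

definition modes :: "real \<Rightarrow> (int ^ 'n) set" where
  "modes N = {k. bracket k \<le> N}"

lemma finite_modes [simp]: "finite (modes N :: (int ^ 'n::finite) set)"
  unfolding modes_def by (rule finite_bracket_le)

lemma modes_minus: "k \<in> modes N \<Longrightarrow> - k \<in> modes N"
  by (simp add: modes_def)

lemma hat_outside: "0 < N \<Longrightarrow> k \<notin> modes N \<Longrightarrow> hat s N k = 0"
  by (simp add: hat_def modes_def max_def field_simps)

definition energy :: "real \<Rightarrow> real \<Rightarrow> (int ^ 'n \<Rightarrow> complex) \<Rightarrow> real" where
  "energy s N a = (\<Sum>k\<in>modes N. (hat s N k)\<^sup>2 * (norm (a k))\<^sup>2)"

lemma energy_nonneg: "0 \<le> energy s N a"
  by (simp add: energy_def sum_nonneg)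

lemma energy_le:
  fixes a :: "int ^ 'n::finite \<Rightarrow> complex"
  assumes "hs_le s M a" "0 < N"
  shows "energy s N a \<le> M"
proof -
  have "energy s N a \<le> (\<Sum>k\<in>modes N. bracket k powr (2 * s) * (norm (a k))\<^sup>2)"
    unfolding energy_def
  proof (intro sum_mono mult_right_mono)
    fix k :: "int ^ 'n"
    have "(hat s N k)\<^sup>2 \<le> (bracket k powr s)\<^sup>2" by (intro power_mono hat_le assms) simp
    then show "(hat s N k)\<^sup>2 \<le> bracket k powr (2 * s)"
      by (simp add: power2_eq_square[of "bracket k powr s"] powr_add[symmetric])
  qed simp
  also have "\<dots> \<le> M" by (rule hs_leD[OF assms(1)]) simp
  finally show ?thesis .
qed

text \<open>Conversely, as the cutoff is removed, the truncated energies recover the full norm.\<close>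

lemma hs_le_energyI:
  fixes a :: "int ^ 'n::finite \<Rightarrow> complex"
  assumes "\<And>n. energy s (real (Suc n)) a \<le> \<Gamma>"
  shows "hs_le s \<Gamma> a"
  unfolding hs_le_def
proof (intro allI impI)
  fix F :: "(int ^ 'n) set" assume F: "finite F"
  have lim: "(\<lambda>n. hat s (real (Suc n)) k) \<longlonglongrightarrow> bracket k powr s" for k :: "int ^ 'n"
  proof -
    have "(\<lambda>n. bracket k / real (Suc n)) \<longlonglongrightarrow> 0"
      using tendsto_mult[OF tendsto_const[of "bracket k"] LIMSEQ_inverse_real_of_nat] by (simp add: field_simps)
    then have "(\<lambda>n. bracket k powr s * max 0 (1 - bracket k / real (Suc n)))
        \<longlonglongrightarrow> bracket k powr s * max 0 (1 - 0)"
      by (intro tendsto_intros)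
    then show ?thesis by (simp add: hat_def)
  qed
  have "(\<lambda>n. \<Sum>k\<in>F. (hat s (real (Suc n)) k)\<^sup>2 * (norm (a k))\<^sup>2)
      \<longlonglongrightarrow> (\<Sum>k\<in>F. (bracket k powr s)\<^sup>2 * (norm (a k))\<^sup>2)"
    by (intro tendsto_intros lim)
  moreover have "(\<Sum>k\<in>F. (hat s (real (Suc n)) k)\<^sup>2 * (norm (a k))\<^sup>2) \<le> \<Gamma>" for n
  proof -
    let ?w = "\<lambda>k. (hat s (real (Suc n)) k)\<^sup>2 * (norm (a k))\<^sup>2"
    have "sum ?w F \<le> sum ?w (F \<union> modes (real (Suc n)))" using F by (intro sum_mono2) auto
    also have "\<dots> = sum ?w (modes (real (Suc n)))"
      using F by (intro sum.mono_neutral_right) (auto simp: hat_outside)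
    also have "\<dots> \<le> \<Gamma>" using assms[of n] by (simp add: energy_def)
    finally show ?thesis .
  qed
  ultimately have "(\<Sum>k\<in>F. (bracket k powr s)\<^sup>2 * (norm (a k))\<^sup>2) \<le> \<Gamma>"
    by (intro LIMSEQ_le_const2) auto
  then show "(\<Sum>k\<in>F. bracket k powr (2 * s) * (norm (a k))\<^sup>2) \<le> \<Gamma>"
    by (simp add: power2_eq_square[of "bracket _ powr s"] powr_add[symmetric])
qed

lemma energy_has_derivative:
  fixes a :: "real \<Rightarrow> int ^ 'n::finite \<Rightarrow> complex"
  assumes "\<And>k. ((\<lambda>t. a t k) has_vector_derivative a' k) (at t within X)"
  shows "((\<lambda>t. energy s N (a t)) has_real_derivative
      2 * (\<Sum>k\<in>modes N. (hat s N k)\<^sup>2 * (a t k \<bullet> a' k))) (at t within X)"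
proof -
  have "((\<lambda>t. (norm (a t k))\<^sup>2) has_real_derivative 2 * (a t k \<bullet> a' k)) (at t within X)" for k
  proof -
    have d: "((\<lambda>t. a t k) has_derivative (\<lambda>h. h *\<^sub>R a' k)) (at t within X)"
      using assms[of k] by (simp add: has_vector_derivative_def)
    show ?thesis
      unfolding power2_norm_eq_inner has_field_derivative_def
      by (rule has_derivative_eq_rhs[OF has_derivative_inner[OF d d]])
         (auto simp: fun_eq_iff inner_commute algebra_simps)
  qed
  then have "((\<lambda>t. energy s N (a t)) has_real_derivative
      (\<Sum>k\<in>modes N. (hat s N k)\<^sup>2 * (2 * (a t k \<bullet> a' k)))) (at t within X)"
    unfolding energy_def by (intro DERIV_sum DERIV_cmult)
  then show ?thesis by (simp add: sum_distrib_left algebra_simps)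
qed

text \<open>
  A Gronwall inequality for a family of approximate energies \<open>E n\<close> whose growth is controlled only
  by their supremum. With \<open>Y\<close> the supremum of \<open>exp (- 2 * \<Lambda> * t) * E n t\<close>, integration gives
  \<open>Y \<le> G0 + P * T + Y / 2\<close>; the factor 2 in the exponent is what makes the last term absorbable.
\<close>

lemma gronwall_sup:
  fixes E E' :: "nat \<Rightarrow> real \<Rightarrow> real"
  assumes \<Lambda>: "0 < \<Lambda>" and P: "0 \<le> P"
    and deriv: "\<And>n t. t \<in> {0..T} \<Longrightarrow> (E n has_real_derivative E' n t) (at t within {0..T})"
    and bdd: "\<And>n t. t \<in> {0..T} \<Longrightarrow> E n t \<le> B" and nonneg: "\<And>n t. 0 \<le> E n t"
    and ineq: "\<And>t \<Gamma> n. t \<in> {0..T} \<Longrightarrow> (\<And>n. E n t \<le> \<Gamma>) \<Longrightarrow> E' n t \<le> P + \<Lambda> * \<Gamma>"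
    and init: "\<And>n. E n 0 \<le> G0" and t: "t \<in> {0..T}"
  shows "E n t \<le> 2 * (G0 + P * T) * exp (2 * \<Lambda> * T)"
proof -
  have T: "0 \<le> T" using t by simp
  define e where "e = (\<lambda>(n, t). exp (- (2 * \<Lambda> * t)) * E n t)"
  define Y where "Y = (SUP p\<in>UNIV \<times> {0..T}. e p)"
  have bd: "bdd_above (e ` (UNIV \<times> {0..T}))"
  proof (rule bdd_aboveI2)
    fix p :: "nat \<times> real" assume "p \<in> UNIV \<times> {0..T}"
    then obtain n t where p: "p = (n, t)" "t \<in> {0..T}" by auto
    have "exp (- (2 * \<Lambda> * t)) * E n t \<le> 1 * E n t"
      using p(2) \<Lambda> nonneg by (intro mult_right_mono) auto
    also have "\<dots> \<le> B" using bdd[OF p(2)] by simp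
    finally show "e p \<le> B" by (simp add: e_def p)
  qed
  have EY: "E n t \<le> Y * exp (2 * \<Lambda> * t)" if "t \<in> {0..T}" for n t
  proof -
    have "e (n, t) \<le> Y" unfolding Y_def by (rule cSUP_upper[OF _ bd]) (use that in auto)
    then have "e (n, t) * exp (2 * \<Lambda> * t) \<le> Y * exp (2 * \<Lambda> * t)" by (intro mult_right_mono) auto
    moreover have "e (n, t) * exp (2 * \<Lambda> * t) = E n t"
      by (simp add: e_def exp_minus)
    ultimately show ?thesis by simp
  qed
  have Y0: "0 \<le> Y" using EY[of 0 0] nonneg[of 0 0] T by simp
  have main: "E n t \<le> G0 + P * T + Y / 2 * exp (2 * \<Lambda> * t)" if t: "t \<in> {0..T}" for n t
  proof -
    define h where "h = (\<lambda>t. E n t - (P * t + Y / 2 * exp (2 * \<Lambda> * t)))"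
    have dh: "(h has_real_derivative E' n t - (P + \<Lambda> * (Y * exp (2 * \<Lambda> * t)))) (at t within {0..T})"
      if "t \<in> {0..T}" for t
      unfolding h_def by (rule derivative_eq_intros deriv that refl | simp add: algebra_simps)+
    have hc: "continuous_on {0..T} h"
      unfolding continuous_on_eq_continuous_within by (intro ballI) (rule DERIV_continuous, rule dh)
    have "h t \<le> h 0"
    proof (cases "t = 0")
      case False
      show ?thesis
      proof (rule DERIV_nonpos_imp_decreasing_open[of 0 t h])
        show "0 \<le> t" using t by simp
        show "continuous_on {0..t} h"
          using t by (intro continuous_on_subset[OF hc]) auto
        fix x assume x: "0 < x" "x < t"
        then have xT: "x \<in> {0..T}" "at x within {0..T} = at x"
          using t by (auto intro!: at_within_Icc_at)
        have "E' n x \<le> P + \<Lambda> * (Y * exp (2 * \<Lambda> * x))" using ineq[OF xT(1) EY[OF xT(1)]] .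
        then show "\<exists>y. (h has_real_derivative y) (at x) \<and> y \<le> 0"
          using dh[OF xT(1)] xT(2) by (intro exI[of _ "E' n x - (P + \<Lambda> * (Y * exp (2 * \<Lambda> * x)))"]) auto
      qed
    qed simp
    moreover have "P * t \<le> P * T" using P t by (intro mult_left_mono) auto
    ultimately show ?thesis using init[of n] Y0 by (simp add: h_def)
  qed
  have "Y \<le> G0 + P * T + Y / 2"
    unfolding Y_def
  proof (rule cSUP_least)
    show "UNIV \<times> {0..T} \<noteq> {}" using T by auto
    fix p :: "nat \<times> real" assume "p \<in> UNIV \<times> {0..T}"
    then obtain n t where p: "p = (n, t)" "t \<in> {0..T}" by auto
    have G0: "0 \<le> G0" using init[of 0] nonneg[of 0 0] by linarith
    have "e p \<le> exp (- (2 * \<Lambda> * t)) * (G0 + P * T + Y / 2 * exp (2 * \<Lambda> * t))"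
      unfolding p(1) e_def prod.case by (intro mult_left_mono main p) simp
    also have "\<dots> = exp (- (2 * \<Lambda> * t)) * (G0 + P * T) + Y / 2"
      by (simp add: algebra_simps exp_minus)
    also have "\<dots> \<le> 1 * (G0 + P * T) + Y / 2"
      using p(2) \<Lambda> G0 P T by (intro add_right_mono mult_right_mono) auto
    finally show "e p \<le> G0 + P * T + (SUP p\<in>UNIV \<times> {0..T}. e p) / 2" by (simp add: Y_def)
  qed
  then have Y: "Y \<le> 2 * (G0 + P * T)" by simp
  have "E n t \<le> Y * exp (2 * \<Lambda> * t)" by (rule EY[OF t])
  also have "\<dots> \<le> 2 * (G0 + P * T) * exp (2 * \<Lambda> * T)"
    using Y Y0 t \<Lambda> by (intro mult_mono) auto
  finally show ?thesis .
qed

section \<open>Energy estimates\<close>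

lemma powr_add_le:
  fixes x y p :: real
  assumes "0 < x" "0 < y" "0 \<le> p"
  shows "(x + y) powr p \<le> 2 powr p * (x powr p + y powr p)"
proof -
  have "(x + y) powr p \<le> (2 * max x y) powr p" using assms by (intro powr_mono2) auto
  also have "\<dots> = 2 powr p * max x y powr p" using assms by (simp add: powr_mult)
  also have "\<dots> \<le> 2 powr p * (x powr p + y powr p)"
    by (intro mult_left_mono) (auto simp: max_def)
  finally show ?thesis .
qed

text \<open>
  The weight difference has one power of \<open>bracket (k - l)\<close>; the remaining \<open>s - 1\<close> powers of the
  larger frequency are split between \<open>l\<close> and \<open>k - l\<close>.
\<close>

lemma hat_commutator_weight:
  assumes s: "1 \<le> s" and N: "0 < N"
  shows "\<bar>hat s N k - hat s N l\<bar> * bracket l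
    \<le> (s + 1) * 2 powr (s - 1) *
       (bracket (k - l) * bracket l powr s + bracket (k - l) powr s * bracket l)"
proof -
  let ?p = "s - 1" and ?d = "bracket (k - l)"
  have pow: "x * x powr ?p = x powr s" if "0 < x" for x :: real
    using that powr_add[of x 1 ?p] by simp
  have "max (bracket k) (bracket l) powr ?p \<le> (bracket l + ?d) powr ?p"
    using s bracket_triangle[of k l] by (intro powr_mono2) (auto simp: less_max_iff_disj max_def)
  also have "\<dots> \<le> 2 powr ?p * (bracket l powr ?p + ?d powr ?p)"
    using s by (intro powr_add_le) auto
  finally have m: "max (bracket k) (bracket l) powr ?p \<le> 2 powr ?p * (bracket l powr ?p + ?d powr ?p)" .
  have "\<bar>hat s N k - hat s N l\<bar> \<le> (s + 1) * norm (freq (k - l)) * max (bracket k) (bracket l) powr ?p"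
    using s N by (intro hat_lipschitz) auto
  also have "\<dots> \<le> (s + 1) * ?d * (2 powr ?p * (bracket l powr ?p + ?d powr ?p))"
    using s m by (intro mult_mono norm_freq_le_bracket) auto
  finally have "\<bar>hat s N k - hat s N l\<bar> * bracket l
      \<le> (s + 1) * ?d * (2 powr ?p * (bracket l powr ?p + ?d powr ?p)) * bracket l"
    by (intro mult_right_mono) auto
  also have "\<dots> = (s + 1) * 2 powr ?p *
       (?d * (bracket l * bracket l powr ?p) + (?d * ?d powr ?p) * bracket l)"
    by (simp add: algebra_simps)
  finally show ?thesis by (simp only: pow bracket_pos)
qed

lemma hat_energy_square:
  fixes a :: "int ^ 'n::finite \<Rightarrow> complex"
  assumes "hs_le s \<Gamma> a" "0 < N"
  shows "(\<Sum>k\<in>modes N. (hat s N k * norm (a k))\<^sup>2) \<le> \<Gamma>"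
  using energy_le[OF assms] by (simp add: energy_def power_mult_distrib)

text \<open>
  A Kato--Ponce type bound. In both parts of the split commutator one factor carries \<open>s\<close>
  derivatives and is placed in \<open>\<ell>\<^sup>2\<close>, the other carries one and is placed in \<open>\<ell>\<^sup>1\<close>. Since the velocity
  is an operator of order zero applied to the scalar, the roles of the two are interchangeable.
\<close>

lemma transport_energy_sobolev:
  fixes a :: "int ^ 'n::finite \<Rightarrow> complex"
  assumes s: "1 \<le> s" and N: "0 < N" and c: "0 \<le> c"
    and divfree: "\<And>m. (\<Sum>j\<in>UNIV. of_int (m $ j) * U j m) = 0"
    and real: "\<And>k. a (- k) = cnj (a k)"
    and speed: "\<And>m. speed U m \<le> c * norm (a m)"
    and w1: "w1 a summable_on UNIV" "infsum (w1 a) UNIV \<le> A"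
    and hs: "hs_le s \<Gamma> a"
  shows "\<bar>\<Sum>k\<in>modes N. (hat s N k)\<^sup>2 * (a k \<bullet> transport U a k)\<bar>
    \<le> 2 * ((s + 1) * 2 powr (s - 1)) * c * A * \<Gamma>"
proof -
  define \<kappa> where "\<kappa> = (s + 1) * 2 powr (s - 1)"
  have \<kappa>: "0 \<le> \<kappa>" using s by (simp add: \<kappa>_def)
  let ?g = "\<lambda>k. bracket k powr s * norm (a k)"
  have g: "l2_le ?g \<Gamma>" using hs by (simp add: hs_le_l2)
  have \<Gamma>: "0 \<le> \<Gamma>" by (rule hs_le_nonneg[OF hs])
  define K where "K = (\<lambda>k l. \<kappa> * c * (w1 a (k - l) * ?g l + ?g (k - l) * w1 a l))"
  have sm1: "(\<lambda>l. w1 a (k - l) * ?g l) summable_on UNIV" for k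
    by (rule convolution_summable(1)[OF w1(1) _ g]) auto
  have sm2: "(\<lambda>l. ?g (k - l) * w1 a l) summable_on UNIV" for k
    by (rule convolution_summable(2)[OF w1(1) _ g]) auto
  have Ksm: "K k summable_on UNIV" for k
    unfolding K_def by (intro summable_on_cmult_right summable_on_add sm1 sm2)
  have "speed U m \<le> c * (sqrt \<Gamma> + 1)" for m
  proof -
    have "norm (a m) \<le> ?g m"
      using mult_right_mono[OF bracket_powr_ge_1[of s m], of "norm (a m)"] s by simp
    also have "\<dots> \<le> sqrt \<Gamma> + 1" using l2_le_bound[OF g, of m] by simp
    finally have "c * norm (a m) \<le> c * (sqrt \<Gamma> + 1)" by (intro mult_left_mono c)
    then show ?thesis using speed[of m] by linarith
  qed
  then have tsm: "(\<lambda>l. norm (transport_term U a k l)) summable_on UNIV" for k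
    by (rule transport_term_summable[OF w1(1)])
  have comm: "\<bar>hat s N k - hat s N l\<bar> * norm (transport_term U a k l) \<le> K k l" for k l
  proof -
    have "norm (transport_term U a k l) \<le> c * norm (a (k - l)) * w1 a l"
      by (rule order_trans[OF norm_transport_term mult_right_mono[OF speed]]) simp
    then have "\<bar>hat s N k - hat s N l\<bar> * norm (transport_term U a k l)
        \<le> \<bar>hat s N k - hat s N l\<bar> * (c * norm (a (k - l)) * w1 a l)"
      by (intro mult_left_mono) auto
    also have "\<dots> = (\<bar>hat s N k - hat s N l\<bar> * bracket l) * (c * norm (a (k - l)) * norm (a l))"
      by (simp add: w1_def)
    also have "\<dots> \<le> (\<kappa> * (bracket (k - l) * bracket l powr s + bracket (k - l) powr s * bracket l))
        * (c * norm (a (k - l)) * norm (a l))"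
      unfolding \<kappa>_def using c by (intro mult_right_mono hat_commutator_weight s N) auto
    also have "\<dots> = K k l" by (simp add: K_def w1_def algebra_simps)
    finally show ?thesis .
  qed
  have "\<bar>\<Sum>k\<in>modes N. (hat s N k)\<^sup>2 * (a k \<bullet> transport U a k)\<bar>
      \<le> (\<Sum>k\<in>modes N. hat s N k * norm (a k) * (\<Sum>\<^sub>\<infinity>l. K k l))"
    by (rule weighted_transport_le_commutator[OF divfree real _ _ _ _ _ tsm comm Ksm])
       (use N in \<open>auto simp: modes_minus hat_outside\<close>)
  also have "\<dots> = \<kappa> * c * ((\<Sum>k\<in>modes N. hat s N k * norm (a k) * (\<Sum>\<^sub>\<infinity>l. w1 a (k - l) * ?g l))
       + (\<Sum>k\<in>modes N. hat s N k * norm (a k) * (\<Sum>\<^sub>\<infinity>l. ?g (k - l) * w1 a l)))"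
  proof -
    have "(\<Sum>\<^sub>\<infinity>l. K k l) = \<kappa> * c * ((\<Sum>\<^sub>\<infinity>l. w1 a (k - l) * ?g l) + (\<Sum>\<^sub>\<infinity>l. ?g (k - l) * w1 a l))" for k
      unfolding K_def infsum_add[OF sm1 sm2, symmetric]
      by (rule infsum_cmult_right) (intro summable_on_add sm1 sm2)
    then show ?thesis
      unfolding sum.distrib[symmetric] sum_distrib_left by (intro sum.cong refl) (simp add: algebra_simps)
  qed
  also have "\<dots> \<le> \<kappa> * c * (A * (sqrt \<Gamma> * sqrt \<Gamma>) + A * (sqrt \<Gamma> * sqrt \<Gamma>))"
    using \<kappa> c
    by (intro mult_left_mono add_mono young_trilinear[where f = "w1 a"] w1 g
          hat_energy_square hs N) auto
  finally show ?thesis using \<Gamma> by (simp add: \<kappa>_def algebra_simps)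
qed

text \<open>
  At the level \<open>L\<^sup>2\<close> the velocity and the transported scalar are decoupled: the hat weight loses
  nothing beyond one derivative of the velocity, because
  \<open>\<bar>hat 0 N k - hat 0 N l\<bar> * bracket l \<le> norm (freq (k - l))\<close>.
\<close>

lemma transport_energy_L2:
  fixes \<phi> b :: "int ^ 'n::finite \<Rightarrow> complex"
  assumes N: "0 < N" and c: "0 \<le> c"
    and divfree: "\<And>m. (\<Sum>j\<in>UNIV. of_int (m $ j) * U j m) = 0"
    and real: "\<And>k. \<phi> (- k) = cnj (\<phi> k)"
    and speed: "\<And>m. speed U m \<le> c * norm (b m)"
    and w1: "w1 b summable_on UNIV" "infsum (w1 b) UNIV \<le> A"
    and tsm: "\<And>k. (\<lambda>l. norm (transport_term U \<phi> k l)) summable_on UNIV"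
    and hs: "hs_le 0 \<Gamma> \<phi>"
  shows "\<bar>\<Sum>k\<in>modes N. (hat 0 N k)\<^sup>2 * (\<phi> k \<bullet> transport U \<phi> k)\<bar> \<le> c * A * \<Gamma>"
proof -
  let ?g = "\<lambda>k. norm (\<phi> k)"
  have g: "l2_le ?g \<Gamma>" using hs by (simp add: hs_le_l2)
  have \<Gamma>: "0 \<le> \<Gamma>" by (rule hs_le_nonneg[OF hs])
  define K where "K = (\<lambda>k l. c * (w1 b (k - l) * ?g l))"
  have sm: "(\<lambda>l. w1 b (k - l) * ?g l) summable_on UNIV" for k
    by (rule convolution_summable(1)[OF w1(1) _ g]) auto
  have Ksm: "K k summable_on UNIV" for k
    unfolding K_def by (intro summable_on_cmult_right sm)
  have comm: "\<bar>hat 0 N k - hat 0 N l\<bar> * norm (transport_term U \<phi> k l) \<le> K k l" for k l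
  proof -
    have "\<bar>hat 0 N k - hat 0 N l\<bar> \<le> norm (freq (k - l)) * max (bracket k) (bracket l) powr - 1"
      using hat_lipschitz[of 0 N k l] N by simp
    also have "\<dots> \<le> bracket (k - l) * bracket l powr - 1"
      by (intro mult_mono norm_freq_le_bracket powr_mono2') auto
    finally have "\<bar>hat 0 N k - hat 0 N l\<bar> * bracket l \<le> bracket (k - l) * bracket l powr - 1 * bracket l"
      by (intro mult_right_mono) auto
    then have h: "\<bar>hat 0 N k - hat 0 N l\<bar> * bracket l \<le> bracket (k - l)"
      by (simp add: powr_minus field_simps)
    have "norm (transport_term U \<phi> k l) \<le> c * norm (b (k - l)) * w1 \<phi> l"
      by (rule order_trans[OF norm_transport_term mult_right_mono[OF speed]]) simp
    then have "\<bar>hat 0 N k - hat 0 N l\<bar> * norm (transport_term U \<phi> k l)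
        \<le> \<bar>hat 0 N k - hat 0 N l\<bar> * (c * norm (b (k - l)) * w1 \<phi> l)"
      by (intro mult_left_mono) auto
    also have "\<dots> = (\<bar>hat 0 N k - hat 0 N l\<bar> * bracket l) * (c * norm (b (k - l)) * norm (\<phi> l))"
      by (simp add: w1_def)
    also have "\<dots> \<le> bracket (k - l) * (c * norm (b (k - l)) * norm (\<phi> l))"
      using c by (intro mult_right_mono h) auto
    also have "\<dots> = K k l" by (simp add: K_def w1_def)
    finally show ?thesis .
  qed
  have "\<bar>\<Sum>k\<in>modes N. (hat 0 N k)\<^sup>2 * (\<phi> k \<bullet> transport U \<phi> k)\<bar>
      \<le> (\<Sum>k\<in>modes N. hat 0 N k * norm (\<phi> k) * (\<Sum>\<^sub>\<infinity>l. K k l))"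
    by (rule weighted_transport_le_commutator[OF divfree real _ _ _ _ _ tsm comm Ksm])
       (use N in \<open>auto simp: modes_minus hat_outside\<close>)
  also have "\<dots> = c * (\<Sum>k\<in>modes N. hat 0 N k * norm (\<phi> k) * (\<Sum>\<^sub>\<infinity>l. w1 b (k - l) * ?g l))"
    unfolding K_def sum_distrib_left infsum_cmult_right[OF sm] by (intro sum.cong refl) (simp add: algebra_simps)
  also have "\<dots> \<le> c * (A * (sqrt \<Gamma> * sqrt \<Gamma>))"
    using c
    by (intro mult_left_mono young_trilinear(1)[where f = "w1 b"] w1 g hat_energy_square hs N) auto
  finally show ?thesis using \<Gamma> by simp
qed

lemma transport_forcing_L2:
  fixes \<phi> a :: "int ^ 'n::finite \<Rightarrow> complex"
  assumes N: "0 < N" and V: "l2_le (speed V) Q"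
    and w1: "w1 a summable_on UNIV" "infsum (w1 a) UNIV \<le> A"
    and hs: "hs_le 0 \<Gamma> \<phi>"
  shows "\<bar>\<Sum>k\<in>modes N. (hat 0 N k)\<^sup>2 * (\<phi> k \<bullet> transport V a k)\<bar> \<le> A * (sqrt \<Gamma> * sqrt Q)"
proof -
  have sm: "(\<lambda>l. speed V (k - l) * w1 a l) summable_on UNIV" for k
    by (rule convolution_summable(2)[OF w1(1) _ V]) auto
  have tsm: "(\<lambda>l. norm (transport_term V a k l)) summable_on UNIV" for k
    by (rule transport_term_summable[OF w1(1), of _ "sqrt Q"])
       (use l2_le_bound[OF V] in \<open>auto simp: abs_le_iff\<close>)
  have "\<bar>\<Sum>k\<in>modes N. (hat 0 N k)\<^sup>2 * (\<phi> k \<bullet> transport V a k)\<bar>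
      \<le> (\<Sum>k\<in>modes N. hat 0 N k * norm (\<phi> k) * (\<Sum>\<^sub>\<infinity>l. speed V (k - l) * w1 a l))"
  proof (rule order_trans[OF sum_abs sum_mono])
    fix k :: "int ^ 'n"
    have "norm (transport V a k) \<le> (\<Sum>\<^sub>\<infinity>l. norm (transport_term V a k l))"
      unfolding transport_def by (rule norm_infsum_bound[OF tsm])
    also have "\<dots> \<le> (\<Sum>\<^sub>\<infinity>l. speed V (k - l) * w1 a l)"
      by (rule infsum_mono, rule tsm, rule sm, rule norm_transport_term)
    finally have *: "norm (transport V a k) \<le> (\<Sum>\<^sub>\<infinity>l. speed V (k - l) * w1 a l)" .
    have h: "hat 0 N k \<le> 1" using hat_le[OF N, of 0 k] by simp
    have "\<bar>(hat 0 N k)\<^sup>2 * (\<phi> k \<bullet> transport V a k)\<bar> = (hat 0 N k)\<^sup>2 * \<bar>\<phi> k \<bullet> transport V a k\<bar>"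
      by (simp add: abs_mult)
    also have "\<dots> \<le> (hat 0 N k * 1) * (norm (\<phi> k) * norm (transport V a k))"
      unfolding power2_eq_square
      by (intro mult_mono Cauchy_Schwarz_ineq2 mult_left_mono h) auto
    also have "\<dots> \<le> (hat 0 N k * 1) * (norm (\<phi> k) * (\<Sum>\<^sub>\<infinity>l. speed V (k - l) * w1 a l))"
      by (intro mult_left_mono *) auto
    finally show "\<bar>(hat 0 N k)\<^sup>2 * (\<phi> k \<bullet> transport V a k)\<bar>
        \<le> hat 0 N k * norm (\<phi> k) * (\<Sum>\<^sub>\<infinity>l. speed V (k - l) * w1 a l)" by simp
  qed
  also have "\<dots> \<le> A * (sqrt \<Gamma> * sqrt Q)"
    by (intro young_trilinear(2)[where f = "w1 a"] w1 V hat_energy_square hs N) auto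
  finally show ?thesis .
qed

lemma two_mult_sqrt_le: "0 \<le> x \<Longrightarrow> 0 \<le> y \<Longrightarrow> 2 * (sqrt x * sqrt y) \<le> x + (y::real)"
  using arith_geo_mean_sqrt[of x y] by (simp add: real_sqrt_mult field_simps)

text \<open>
  Gronwall applied to the truncated \<open>H\<^sup>s\<close> energies, whose rate of growth is linear in \<open>A\<close>. The a
  priori bound \<open>M\<close> makes their supremum finite; the conclusion depends on \<open>A\<close> and the data only.
\<close>

lemma sobolev_growth:
  fixes a :: "real \<Rightarrow> int ^ 'n::finite \<Rightarrow> complex"
  assumes s: "1 \<le> s" and c: "0 \<le> c" and A: "0 \<le> A"
    and ode: "\<And>t k. t \<in> {0..T} \<Longrightarrow>
      ((\<lambda>t. a t k) has_vector_derivative (S k - transport (U t) (a t) k)) (at t within {0..T})"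
    and real: "\<And>t k. t \<in> {0..T} \<Longrightarrow> a t (- k) = cnj (a t k)"
    and divfree: "\<And>t m. (\<Sum>j\<in>UNIV. of_int (m $ j) * U t j m) = 0"
    and speed: "\<And>t m. speed (U t) m \<le> c * norm (a t m)"
    and w1: "\<And>t. t \<in> {0..T} \<Longrightarrow> w1 (a t) summable_on UNIV \<and> infsum (w1 (a t)) UNIV \<le> A"
    and bdd: "\<And>t. t \<in> {0..T} \<Longrightarrow> hs_le s M (a t)"
    and S: "hs_le s P S" and init: "hs_le s G0 (a 0)" and t: "t \<in> {0..T}"
  shows "hs_le s (2 * (G0 + P * T) * exp (2 * (1 + 4 * ((s + 1) * 2 powr (s - 1)) * c * A) * T)) (a t)"
proof -
  define \<kappa> where "\<kappa> = (s + 1) * 2 powr (s - 1)"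
  have \<kappa>: "0 \<le> \<kappa>" using s by (simp add: \<kappa>_def)
  define \<Lambda> where "\<Lambda> = 1 + 4 * \<kappa> * c * A"
  have \<Lambda>: "0 < \<Lambda>" unfolding \<Lambda>_def using \<kappa> c A by (intro add_pos_nonneg) auto
  have P: "0 \<le> P" by (rule hs_le_nonneg[OF S])
  let ?E' = "\<lambda>n t. 2 * (\<Sum>k\<in>modes (real (Suc n)). (hat s (real (Suc n)) k)\<^sup>2
      * (a t k \<bullet> (S k - transport (U t) (a t) k)))"
  have "energy s (real (Suc n)) (a t) \<le> 2 * (G0 + P * T) * exp (2 * \<Lambda> * T)" for n
  proof (rule gronwall_sup[where E = "\<lambda>n t. energy s (real (Suc n)) (a t)" and E' = ?E' and B = M
        and T = T, OF \<Lambda> P _ _ energy_nonneg _ _ t])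
    show "((\<lambda>t. energy s (real (Suc n)) (a t)) has_real_derivative ?E' n t) (at t within {0..T})"
      if "t \<in> {0..T}" for n t
      by (rule energy_has_derivative) (rule ode[OF that])
    show "energy s (real (Suc n)) (a t) \<le> M" if "t \<in> {0..T}" for n t
      by (rule energy_le[OF bdd[OF that]]) simp
    show "energy s (real (Suc n)) (a 0) \<le> G0" for n
      by (rule energy_le[OF init]) simp
    fix t \<Gamma> n assume tT: "t \<in> {0..T}" and le: "\<And>n. energy s (real (Suc n)) (a t) \<le> \<Gamma>"
    have hs: "hs_le s \<Gamma> (a t)" by (rule hs_le_energyI[OF le])
    have \<Gamma>: "0 \<le> \<Gamma>" by (rule hs_le_nonneg[OF hs])
    let ?N = "real (Suc n)"
    have f: "(\<Sum>k\<in>modes ?N. (hat s ?N k)\<^sup>2 * (a t k \<bullet> S k)) \<le> sqrt \<Gamma> * sqrt P"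
    proof -
      have "(\<Sum>k\<in>modes ?N. (hat s ?N k)\<^sup>2 * (a t k \<bullet> S k))
          \<le> (\<Sum>k\<in>modes ?N. \<bar>(hat s ?N k * norm (a t k)) * (hat s ?N k * norm (S k))\<bar>)"
      proof (rule sum_mono)
        fix k :: "int ^ 'n"
        have "(hat s ?N k)\<^sup>2 * (a t k \<bullet> S k) \<le> (hat s ?N k)\<^sup>2 * (norm (a t k) * norm (S k))"
          by (intro mult_left_mono norm_cauchy_schwarz) simp
        then show "(hat s ?N k)\<^sup>2 * (a t k \<bullet> S k) \<le> \<bar>(hat s ?N k * norm (a t k)) * (hat s ?N k * norm (S k))\<bar>"
          by (simp add: power2_eq_square abs_mult algebra_simps)
      qed
      also have "\<dots> \<le> sqrt \<Gamma> * sqrt P"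
        by (intro cauchy_schwarz_sum hat_energy_square hs S) auto
      finally show ?thesis .
    qed
    have g: "\<bar>\<Sum>k\<in>modes ?N. (hat s ?N k)\<^sup>2 * (a t k \<bullet> transport (U t) (a t) k)\<bar> \<le> 2 * \<kappa> * c * A * \<Gamma>"
      unfolding \<kappa>_def using w1[OF tT]
      by (intro transport_energy_sobolev s c divfree real[OF tT] speed hs) auto
    have "?E' n t = 2 * (\<Sum>k\<in>modes ?N. (hat s ?N k)\<^sup>2 * (a t k \<bullet> S k))
        - 2 * (\<Sum>k\<in>modes ?N. (hat s ?N k)\<^sup>2 * (a t k \<bullet> transport (U t) (a t) k))"
      by (simp add: inner_diff_right right_diff_distrib sum_subtractf)
    also have "\<dots> \<le> 2 * (sqrt \<Gamma> * sqrt P) + 2 * (2 * \<kappa> * c * A * \<Gamma>)"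
      using f g by linarith
    also have "\<dots> \<le> (\<Gamma> + P) + 2 * (2 * \<kappa> * c * A * \<Gamma>)"
      using two_mult_sqrt_le[OF \<Gamma> P] by simp
    also have "\<dots> = P + \<Lambda> * \<Gamma>" by (simp add: \<Lambda>_def algebra_simps)
    finally show "?E' n t \<le> P + \<Lambda> * \<Gamma>" .
  qed
  then show ?thesis unfolding \<Lambda>_def \<kappa>_def by (rule hs_le_energyI)
qed

lemma infsum_difference:
  fixes f g :: "'a \<Rightarrow> 'b::{topological_ab_group_add, t2_space}"
  assumes "f summable_on A" "g summable_on A"
  shows "infsum (\<lambda>x. f x - g x) A = infsum f A - infsum g A"
  using infsum_add[of f A "\<lambda>x. - g x"] assms by (simp add: summable_on_uminus infsum_uminus)

lemma transport_diff:
  fixes a b :: "int ^ 'n::finite \<Rightarrow> complex"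
  assumes a: "w1 a summable_on UNIV" and b: "w1 b summable_on UNIV"
    and U: "\<And>m. speed U m \<le> B" and V: "\<And>m. speed V m \<le> B'"
  shows "transport U b k - transport V a k
       = transport U (\<lambda>k. b k - a k) k + transport (\<lambda>j m. U j m - V j m) a k"
proof -
  have sm: "transport_term W x k summable_on UNIV"
    if "w1 x summable_on UNIV" "\<And>m. speed W m \<le> C" for W x C
    by (rule abs_summable_summable, rule transport_term_summable[OF that])
  have Ub: "transport_term U b k summable_on UNIV" and Ua: "transport_term U a k summable_on UNIV"
    and Va: "transport_term V a k summable_on UNIV"
    using sm[OF b U] sm[OF a U] sm[OF a V] .
  have 1: "transport_term U (\<lambda>k. b k - a k) k = (\<lambda>l. transport_term U b k l - transport_term U a k l)"
    by (simp add: fun_eq_iff transport_term_def algebra_simps)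
  have 2: "transport_term (\<lambda>j m. U j m - V j m) a k
      = (\<lambda>l. transport_term U a k l - transport_term V a k l)"
    by (simp add: fun_eq_iff transport_term_def sum_subtractf left_diff_distrib)
  show ?thesis
    unfolding transport_def 1 2 using Ub Ua Va by (simp add: infsum_difference)
qed

text \<open>
  Stability in \<open>L\<^sup>2\<close>: the two velocities \<open>U\<close> and \<open>V\<close> differ by an operator of order zero applied to
  the difference of the scalars, plus a consistency error \<open>q\<close>. The former is multiplied by the
  gradient of the regular solution \<open>a\<close> and absorbed by Gronwall, so the conclusion is linear in the
  size \<open>\<epsilon>\<close> of the latter.
\<close>

lemma L2_stability:
  fixes a b :: "real \<Rightarrow> int ^ 'n::finite \<Rightarrow> complex"
  assumes c: "0 \<le> c" and A: "0 \<le> A" and \<epsilon>: "0 \<le> \<epsilon>"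
    and ode_a: "\<And>t k. t \<in> {0..T} \<Longrightarrow>
      ((\<lambda>t. a t k) has_vector_derivative (S k - transport (V t) (a t) k)) (at t within {0..T})"
    and ode_b: "\<And>t k. t \<in> {0..T} \<Longrightarrow>
      ((\<lambda>t. b t k) has_vector_derivative (S k - transport (U t) (b t) k)) (at t within {0..T})"
    and real_a: "\<And>t k. t \<in> {0..T} \<Longrightarrow> a t (- k) = cnj (a t k)"
    and real_b: "\<And>t k. t \<in> {0..T} \<Longrightarrow> b t (- k) = cnj (b t k)"
    and divfree: "\<And>t m. (\<Sum>j\<in>UNIV. of_int (m $ j) * U t j m) = 0"
    and speed_a: "\<And>t m. speed (V t) m \<le> c * norm (a t m)"
    and speed_b: "\<And>t m. speed (U t) m \<le> c * norm (b t m)"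
    and speed_diff: "\<And>t m. t \<in> {0..T} \<Longrightarrow>
      speed (\<lambda>j m. U t j m - V t j m) m \<le> c * norm (b t m - a t m) + q t m"
    and q: "\<And>t. t \<in> {0..T} \<Longrightarrow> l2_le (q t) \<epsilon>"
    and w1_a: "\<And>t. t \<in> {0..T} \<Longrightarrow> w1 (a t) summable_on UNIV \<and> infsum (w1 (a t)) UNIV \<le> A"
    and w1_b: "\<And>t. t \<in> {0..T} \<Longrightarrow> w1 (b t) summable_on UNIV \<and> infsum (w1 (b t)) UNIV \<le> A"
    and bdd: "\<And>t. t \<in> {0..T} \<Longrightarrow> hs_le 0 M (\<lambda>k. b t k - a t k)"
    and init: "\<And>k. b 0 k = a 0 k" and t: "t \<in> {0..T}"
  shows "hs_le 0 (4 * A * T * exp (2 * (1 + 2 * c * A + A * (1 + 2 * c\<^sup>2)) * T) * \<epsilon>) (\<lambda>k. b t k - a t k)"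
proof -
  define \<Lambda> where "\<Lambda> = 1 + 2 * c * A + A * (1 + 2 * c\<^sup>2)"
  have \<Lambda>: "0 < \<Lambda>" unfolding \<Lambda>_def using c A by (intro add_pos_nonneg) auto
  define P where "P = 2 * A * \<epsilon>"
  have P: "0 \<le> P" using A \<epsilon> by (simp add: P_def)
  define \<phi> where "\<phi> = (\<lambda>t k. b t k - a t k)"
  have summ: "norm (a m) \<le> B" if "w1 a summable_on UNIV" "infsum (w1 a) UNIV \<le> B" for a :: "int ^ 'n \<Rightarrow> complex" and B m
  proof -
    have "norm (a m) \<le> w1 a m" by (rule norm_le_w1)
    also have "\<dots> = sum (w1 a) {m}" by simp
    also have "\<dots> \<le> infsum (w1 a) UNIV" by (rule finite_sum_le_infsum[OF that(1)]) auto
    finally show ?thesis using that(2) by simp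
  qed
  have U_bd: "speed (U t) m \<le> c * A" if "t \<in> {0..T}" for t m
    by (rule order_trans[OF speed_b mult_left_mono[OF summ]]) (use w1_b[OF that] c in auto)
  have V_bd: "speed (V t) m \<le> c * A" if "t \<in> {0..T}" for t m
    by (rule order_trans[OF speed_a mult_left_mono[OF summ]]) (use w1_a[OF that] c in auto)
  have w1_\<phi>: "w1 (\<phi> t) summable_on UNIV" if "t \<in> {0..T}" for t
  proof (rule summable_on_comparison_test)
    show "(\<lambda>k. w1 (b t) k + w1 (a t) k) summable_on UNIV"
      by (intro summable_on_add) (use w1_a[OF that] w1_b[OF that] in auto)
    show "w1 (\<phi> t) k \<le> w1 (b t) k + w1 (a t) k" for k
      unfolding w1_def \<phi>_def distrib_left[symmetric] by (intro mult_left_mono norm_triangle_ineq4) simp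
  qed simp
  let ?W = "\<lambda>t j m. U t j m - V t j m"
  let ?E' = "\<lambda>n t. 2 * (\<Sum>k\<in>modes (real (Suc n)). (hat 0 (real (Suc n)) k)\<^sup>2
      * (\<phi> t k \<bullet> (- transport (U t) (\<phi> t) k - transport (?W t) (a t) k)))"
  have "energy 0 (real (Suc n)) (\<phi> t) \<le> 2 * (0 + P * T) * exp (2 * \<Lambda> * T)" for n
  proof (rule gronwall_sup[where E = "\<lambda>n t. energy 0 (real (Suc n)) (\<phi> t)" and E' = ?E' and B = M
        and T = T, OF \<Lambda> P _ _ energy_nonneg _ _ t])
    show "((\<lambda>t. energy 0 (real (Suc n)) (\<phi> t)) has_real_derivative ?E' n t) (at t within {0..T})"
      if "t \<in> {0..T}" for n t
    proof (rule energy_has_derivative)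
      fix k
      have "((\<lambda>t. \<phi> t k) has_vector_derivative
          (S k - transport (U t) (b t) k) - (S k - transport (V t) (a t) k)) (at t within {0..T})"
        unfolding \<phi>_def by (intro has_vector_derivative_diff ode_a ode_b that)
      moreover have "(S k - transport (U t) (b t) k) - (S k - transport (V t) (a t) k)
          = - transport (U t) (\<phi> t) k - transport (?W t) (a t) k"
      proof -
        have "transport (U t) (b t) k - transport (V t) (a t) k
            = transport (U t) (\<phi> t) k + transport (?W t) (a t) k"
          unfolding \<phi>_def using w1_a[OF that] w1_b[OF that] U_bd[OF that] V_bd[OF that]
          by (intro transport_diff) auto
        then show ?thesis by (simp add: algebra_simps)
      qed
      ultimately show "((\<lambda>t. \<phi> t k) has_vector_derivative
          - transport (U t) (\<phi> t) k - transport (?W t) (a t) k) (at t within {0..T})" by simp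
    qed
    show "energy 0 (real (Suc n)) (\<phi> t) \<le> M" if "t \<in> {0..T}" for n t
      by (rule energy_le) (use bdd[OF that] in \<open>simp_all add: \<phi>_def\<close>)
    show "energy 0 (real (Suc n)) (\<phi> 0) \<le> 0" for n
      by (simp add: energy_def \<phi>_def init)
    fix t \<Gamma> n assume tT: "t \<in> {0..T}" and le: "\<And>n. energy 0 (real (Suc n)) (\<phi> t) \<le> \<Gamma>"
    have hs: "hs_le 0 \<Gamma> (\<phi> t)" by (rule hs_le_energyI[OF le])
    have \<Gamma>: "0 \<le> \<Gamma>" by (rule hs_le_nonneg[OF hs])
    have l2: "l2_le (\<lambda>k. norm (\<phi> t k)) \<Gamma>" using hs by (simp add: hs_le_l2)
    let ?N = "real (Suc n)" and ?Q = "2 * c\<^sup>2 * \<Gamma> + 2 * \<epsilon>"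
    have Q: "l2_le (speed (?W t)) ?Q"
      unfolding l2_le_def
    proof (intro allI impI)
      fix F :: "(int ^ 'n) set" assume F: "finite F"
      have "(\<Sum>k\<in>F. (speed (?W t) k)\<^sup>2) \<le> (\<Sum>k\<in>F. 2 * c\<^sup>2 * (norm (\<phi> t k))\<^sup>2 + 2 * (q t k)\<^sup>2)"
      proof (rule sum_mono)
        fix k
        have "(speed (?W t) k)\<^sup>2 \<le> (c * norm (\<phi> t k) + q t k)\<^sup>2"
          using speed_diff[OF tT, of k] by (intro power_mono) (auto simp: \<phi>_def)
        also have "\<dots> \<le> 2 * c\<^sup>2 * (norm (\<phi> t k))\<^sup>2 + 2 * (q t k)\<^sup>2"
          using zero_le_power2[of "c * norm (\<phi> t k) - q t k"]
          by (simp add: power2_sum power2_diff power_mult_distrib)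
        finally show "(speed (?W t) k)\<^sup>2 \<le> 2 * c\<^sup>2 * (norm (\<phi> t k))\<^sup>2 + 2 * (q t k)\<^sup>2" .
      qed
      also have "\<dots> = 2 * c\<^sup>2 * (\<Sum>k\<in>F. (norm (\<phi> t k))\<^sup>2) + 2 * (\<Sum>k\<in>F. (q t k)\<^sup>2)"
        by (simp add: sum.distrib sum_distrib_left)
      also have "\<dots> \<le> ?Q"
        using l2_leD[OF l2 F] l2_leD[OF q[OF tT] F] by (intro add_mono mult_left_mono) auto
      finally show "(\<Sum>k\<in>F. (speed (?W t) k)\<^sup>2) \<le> ?Q" .
    qed
    have real_\<phi>: "\<phi> t (- k) = cnj (\<phi> t k)" for k
      by (simp add: \<phi>_def real_a[OF tT] real_b[OF tT])
    have g: "\<bar>\<Sum>k\<in>modes ?N. (hat 0 ?N k)\<^sup>2 * (\<phi> t k \<bullet> transport (U t) (\<phi> t) k)\<bar> \<le> c * A * \<Gamma>"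
      by (rule transport_energy_L2[where b = "b t"])
         (use w1_b[OF tT] transport_term_summable[OF w1_\<phi>[OF tT] U_bd[OF tT]] c divfree speed_b hs real_\<phi>
          in auto)
    have f: "\<bar>\<Sum>k\<in>modes ?N. (hat 0 ?N k)\<^sup>2 * (\<phi> t k \<bullet> transport (?W t) (a t) k)\<bar>
        \<le> A * (sqrt \<Gamma> * sqrt ?Q)"
      using w1_a[OF tT] by (intro transport_forcing_L2 Q hs) auto
    have "?E' n t = - 2 * (\<Sum>k\<in>modes ?N. (hat 0 ?N k)\<^sup>2 * (\<phi> t k \<bullet> transport (U t) (\<phi> t) k))
        - 2 * (\<Sum>k\<in>modes ?N. (hat 0 ?N k)\<^sup>2 * (\<phi> t k \<bullet> transport (?W t) (a t) k))"
      by (simp add: inner_diff_right right_diff_distrib sum_subtractf sum_negf)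
    also have "\<dots> \<le> 2 * (c * A * \<Gamma>) + 2 * (A * (sqrt \<Gamma> * sqrt ?Q))"
      using f g by linarith
    also have "2 * (A * (sqrt \<Gamma> * sqrt ?Q)) \<le> A * (\<Gamma> + ?Q)"
      using two_mult_sqrt_le[OF \<Gamma>, of ?Q] A \<Gamma> \<epsilon> mult_left_mono[of "2 * (sqrt \<Gamma> * sqrt ?Q)" "\<Gamma> + ?Q" A]
      by simp
    also have "2 * (c * A * \<Gamma>) + A * (\<Gamma> + ?Q) \<le> P + \<Lambda> * \<Gamma>"
      using \<Gamma> by (simp add: P_def \<Lambda>_def algebra_simps)
    finally show "?E' n t \<le> P + \<Lambda> * \<Gamma>" by simp
  qed
  then have "hs_le 0 (2 * (0 + P * T) * exp (2 * \<Lambda> * T)) (\<phi> t)" by (rule hs_le_energyI)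
  then show ?thesis by (simp add: \<phi>_def P_def \<Lambda>_def algebra_simps)
qed

section \<open>Fourier series on the torus\<close>

abbreviation wave :: "int ^ 'n \<Rightarrow> real ^ 'n \<Rightarrow> complex" where
  "wave k \<equiv> (\<lambda>x. cis (freq k \<bullet> x))"

abbreviation cell_integrable :: "(real ^ 'n::finite \<Rightarrow> 'b::{banach, second_countable_topology}) \<Rightarrow> bool" where
  "cell_integrable f \<equiv> set_integrable lebesgue cell f"

lemma compact_cell [simp]: "compact (cell :: (real ^ 'n::finite) set)"
  by (simp add: cell_def)

lemma cell_sets [measurable, simp]: "(cell :: (real ^ 'n::finite) set) \<in> sets lebesgue"
  by (simp add: cell_def)

lemma mem_cell: "x \<in> cell \<longleftrightarrow> (\<forall>i. 0 \<le> x $ i \<and> x $ i \<le> 2 * pi)"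
  by (simp add: cell_def mem_box_cart)

lemma measure_cell [simp]: "measure lebesgue (cell :: (real ^ 'n::finite) set) = (2 * pi) ^ CARD('n)"
proof -
  have "(0 :: real ^ 'n) \<in> cell" by (simp add: mem_cell)
  then have "cell \<noteq> ({} :: (real ^ 'n) set)" by blast
  then show ?thesis
    using content_cbox_cart[of 0 "(\<chi> i. 2 * pi) :: real ^ 'n"]
    by (simp add: cell_def measure_completion)
qed

lemma emeasure_cell [simp]: "emeasure lebesgue (cell :: (real ^ 'n::finite) set) \<noteq> \<infinity>"
  using fmeasurableD2[OF lmeasurable_cbox] by (simp add: cell_def)

lemma integral_cell_const:
  "(LINT x:(cell :: (real ^ 'n::finite) set)|lebesgue. c) = (2 * pi) ^ CARD('n) *\<^sub>R (c :: 'b::{banach, second_countable_topology})"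
  unfolding set_integral_const[OF cell_sets emeasure_cell] by simp

lemma cell_integrable_continuous:
  fixes f :: "real ^ 'n::finite \<Rightarrow> 'b::euclidean_space"
  assumes "continuous_on cell f"
  shows "cell_integrable f"
  using absolutely_integrable_continuous[of 0 "\<chi> i. 2 * pi" f] assms by (simp add: cell_def)

lemma wave_add: "wave (k + l) x = wave k x * wave l x"
  by (simp add: freq_add inner_add_left cis_mult)

lemma wave_0 [simp]: "wave 0 x = 1"
  by simp

lemma continuous_on_cis [continuous_intros]:
  "continuous_on S f \<Longrightarrow> continuous_on S (\<lambda>x. cis (f x))"
  by (simp add: cis_conv_exp continuous_intros)

lemma borel_measurable_wave [measurable]: "wave k \<in> borel_measurable lebesgue"
proof -
  have "wave k \<in> borel_measurable borel"
    by (intro borel_measurable_continuous_onI continuous_intros)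
  then show ?thesis by (intro measurable_completion) simp
qed

lemma cell_integrable_mult_wave:
  fixes f :: "real ^ 'n::finite \<Rightarrow> complex"
  assumes "cell_integrable f"
  shows "cell_integrable (\<lambda>x. f x * wave k x)"
proof (rule set_integrable_bound[OF assms])
  have "(\<lambda>x. (indicator cell x *\<^sub>R f x) * wave k x) \<in> borel_measurable lebesgue"
    by (intro borel_measurable_times borel_measurable_wave)
       (use assms in \<open>auto simp: set_integrable_def\<close>)
  then show "set_borel_measurable lebesgue cell (\<lambda>x. f x * wave k x)"
    by (simp add: set_borel_measurable_def)
qed (simp add: norm_mult)

lemma fourier_coeff_alt:
  "fourier_coeff f k = (LINT x:cell|lebesgue. f x * wave (- k) x) / of_real ((2 * pi) ^ CARD('n))"
  for f :: "real ^ 'n::finite \<Rightarrow> complex"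
  by (simp add: fourier_coeff_def freq_minus)

lemma fourier_coeff_mult_wave: "fourier_coeff (\<lambda>x. f x * wave l x) k = fourier_coeff f (k - l)"
  for f :: "real ^ 'n::finite \<Rightarrow> complex"
proof -
  have *: "wave (- (k - l)) x = wave l x * wave (- k) x" for x
    using wave_add[of l "- k" x] by simp
  show ?thesis unfolding fourier_coeff_alt * by (simp only: mult.assoc)
qed

lemma fourier_coeff_cmult: "fourier_coeff (\<lambda>x. c * f x) k = c * fourier_coeff f k"
  for f :: "real ^ 'n::finite \<Rightarrow> complex"
  unfolding fourier_coeff_alt mult.assoc set_integral_mult_right by simp

lemma fourier_coeff_add:
  fixes f g :: "real ^ 'n::finite \<Rightarrow> complex"
  assumes "cell_integrable f" "cell_integrable g"
  shows "fourier_coeff (\<lambda>x. f x + g x) k = fourier_coeff f k + fourier_coeff g k"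
  unfolding fourier_coeff_alt distrib_right
  by (subst set_integral_add) (auto intro: cell_integrable_mult_wave assms simp: add_divide_distrib simp del: of_real_power)

lemma fourier_coeff_diff:
  fixes f g :: "real ^ 'n::finite \<Rightarrow> complex"
  assumes "cell_integrable f" "cell_integrable g"
  shows "fourier_coeff (\<lambda>x. f x - g x) k = fourier_coeff f k - fourier_coeff g k"
  unfolding fourier_coeff_alt left_diff_distrib
  by (subst set_integral_diff(2)) (auto intro: cell_integrable_mult_wave assms simp: diff_divide_distrib simp del: of_real_power)

lemma fourier_coeff_sum:
  fixes f :: "'i \<Rightarrow> real ^ 'n::finite \<Rightarrow> complex"
  assumes "finite I" "\<And>i. i \<in> I \<Longrightarrow> cell_integrable (f i)"
  shows "cell_integrable (\<lambda>x. \<Sum>i\<in>I. f i x) \<and>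
    fourier_coeff (\<lambda>x. \<Sum>i\<in>I. f i x) k = (\<Sum>i\<in>I. fourier_coeff (f i) k)"
  using assms
proof (induction I rule: finite_induct)
  case empty
  then show ?case by (simp add: fourier_coeff_def set_integrable_def set_lebesgue_integral_def)
next
  case (insert x F)
  then have "cell_integrable (f x)" "cell_integrable (\<lambda>x. \<Sum>i\<in>F. f i x)"
    "fourier_coeff (\<lambda>x. \<Sum>i\<in>F. f i x) k = (\<Sum>i\<in>F. fourier_coeff (f i) k)" by auto
  then show ?case using insert.hyps by (simp add: fourier_coeff_add)
qed

lemma norm_fourier_coeff_le:
  fixes f :: "real ^ 'n::finite \<Rightarrow> complex"
  assumes f: "cell_integrable f" and B: "\<And>x. x \<in> cell \<Longrightarrow> norm (f x) \<le> B"
  shows "norm (fourier_coeff f k) \<le> B"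
proof -
  have i: "cell_integrable (\<lambda>x. f x * wave (- k) x)" by (rule cell_integrable_mult_wave[OF f])
  have c: "cell_integrable (\<lambda>x::real^'n. B)" by (intro cell_integrable_continuous continuous_intros)
  have "norm (LINT x:cell|lebesgue. f x * wave (- k) x) \<le> (LINT x:cell|lebesgue. norm (f x * wave (- k) x))"
    by (rule set_integral_norm_bound[OF i])
  also have "\<dots> \<le> (LINT x:(cell::(real^'n) set)|lebesgue. B)"
    by (intro set_integral_mono set_integrable_norm i c) (simp add: norm_mult B)
  also have "\<dots> = (2 * pi) ^ CARD('n) * B" by (simp add: integral_cell_const)
  finally have "norm (LINT x:cell|lebesgue. f x * wave (- k) x) \<le> B * (2 * pi) ^ CARD('n)"
    by (simp only: mult.commute)
  then show ?thesis
    unfolding fourier_coeff_alt norm_divide norm_of_real by (simp add: pos_divide_le_eq)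
qed

text \<open>Orthogonality, by writing the integral over the cell as a product of one-dimensional integrals.\<close>

lemma integral_lborel_prod:
  fixes f :: "'a::euclidean_space \<Rightarrow> real \<Rightarrow> complex"
  assumes f: "\<And>b. b \<in> Basis \<Longrightarrow> integrable lborel (f b)"
  shows "(LINT x|lborel. (\<Prod>b\<in>Basis. f b (x \<bullet> b))) = (\<Prod>b\<in>(Basis::'a set). LINT y|lborel. f b y)"
proof -
  interpret product_sigma_finite "\<lambda>_::'a. lborel :: real measure"
    by standard
  have [measurable]: "f b \<in> borel_measurable borel" if "b \<in> Basis" for b
    using f[OF that] by auto
  have "(LINT x|lborel. (\<Prod>b\<in>Basis. f b (x \<bullet> b)))
      = (LINT x|distr (\<Pi>\<^sub>M b\<in>(Basis::'a set). lborel) borel (\<lambda>f. \<Sum>b\<in>Basis. f b *\<^sub>R b). (\<Prod>b\<in>Basis. f b (x \<bullet> b)))"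
    by (subst lborel_eq) simp
  also have "\<dots> = (LINT x|(\<Pi>\<^sub>M b\<in>(Basis::'a set). lborel). (\<Prod>b\<in>Basis. f b ((\<Sum>b\<in>Basis. x b *\<^sub>R b) \<bullet> b)))"
    by (rule integral_distr) measurable
  also have "\<dots> = (LINT x|(\<Pi>\<^sub>M b\<in>(Basis::'a set). lborel). (\<Prod>b\<in>Basis. f b (x b)))"
    by (intro Bochner_Integration.integral_cong refl prod.cong) (simp add: inner_sum_left_Basis)
  also have "\<dots> = (\<Prod>b\<in>(Basis::'a set). LINT y|lborel. f b y)"
    by (rule product_integral_prod[OF finite_Basis f])
  finally show ?thesis .
qed

lemma integral_circle_cis:
  assumes "n \<noteq> (0::int)"
  shows "(LINT y|lborel. indicator {0..2*pi} y *\<^sub>R cis (of_int n * y)) = 0"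
proof -
  define F where "F = (\<lambda>y::real. cis (of_int n * y) / (\<i> * of_int n))"
  have "(LINT y|lborel. indicator {0..2*pi} y *\<^sub>R cis (of_int n * y)) = F (2 * pi) - F 0"
  proof (rule integral_FTC_Icc)
    show "(F has_vector_derivative cis (of_int n * y)) (at y within {0..2*pi})" for y
    proof -
      have "((\<lambda>z. exp (\<i> * (of_int n * z)) / (\<i> * of_int n)) has_field_derivative
          exp (\<i> * (of_int n * of_real y))) (at (of_real y))"
      proof -
        have "((\<lambda>z. exp (\<i> * (of_int n * z))) has_field_derivative
            exp (\<i> * (of_int n * of_real y)) * (\<i> * of_int n)) (at (of_real y))"
          by (auto intro!: derivative_eq_intros)
        from DERIV_cdivide[OF this, of "\<i> * of_int n"] assms show ?thesis by simp
      qed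
      from has_vector_derivative_real_field[OF this] show ?thesis
        by (simp add: F_def cis_conv_exp)
    qed
  qed (auto intro!: continuous_intros)
  also have "cis (of_int n * (2 * pi)) = 1"
    using cis_multiple_2pi[of "of_int n"] by (simp add: mult_ac)
  then have "F (2 * pi) - F 0 = 0" by (simp add: F_def)
  finally show ?thesis .
qed

lemma integral_cell_wave:
  "(LINT x:(cell :: (real ^ 'n::finite) set)|lebesgue. wave k x) = (if k = 0 then of_real ((2 * pi) ^ CARD('n)) else 0)"
proof (cases "k = 0")
  case True
  then show ?thesis using integral_cell_const[where 'n = 'n, of "1::complex"] by (simp add: scaleR_conv_of_real)
next
  case False
  then obtain i where i: "k $ i \<noteq> 0" by (auto simp: vec_eq_iff)
  let ?f = "\<lambda>(b::real^'n) y. indicator {0..2*pi} y *\<^sub>R cis ((freq k \<bullet> b) * y)"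
  have int: "integrable lborel (?f b)" for b
    by (rule borel_integrable_compact) (auto intro!: continuous_intros)
  have "(LINT x:cell|lebesgue. wave k x) = (LINT x|lborel. indicator (cell::(real^'n) set) x *\<^sub>R wave k x)"
    unfolding set_lebesgue_integral_def
  proof (rule integral_completion)
    have "wave k \<in> borel_measurable borel" by (intro borel_measurable_continuous_onI continuous_intros)
    then show "(\<lambda>x. indicator (cell::(real^'n) set) x *\<^sub>R wave k x) \<in> borel_measurable lborel"
      by (simp add: cell_def)
  qed
  also have "(\<lambda>x. indicator (cell::(real^'n) set) x *\<^sub>R wave k x) = (\<lambda>x. \<Prod>b\<in>Basis. ?f b (x \<bullet> b))"
  proof
    fix x :: "real ^ 'n"
    have ind: "indicator (cell::(real^'n) set) x = (\<Prod>b\<in>Basis. indicator {0..2*pi} (x \<bullet> b) :: real)"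
    proof -
      have "x \<in> cell \<longleftrightarrow> (\<forall>b\<in>Basis. x \<bullet> b \<in> {0..2*pi})"
        by (auto simp: mem_cell Basis_vec_def inner_axis)
      then show ?thesis
        by (auto simp: indicator_def)
    qed
    have cp: "(\<Prod>b\<in>B. cis (g b)) = cis (\<Sum>b\<in>B. g b)" if "finite B" for B :: "(real ^ 'n) set" and g
      using that by (induction B rule: finite_induct) (auto simp: cis_mult)
    have "wave k x = (\<Prod>b\<in>Basis. cis ((freq k \<bullet> b) * (x \<bullet> b)))"
      by (subst cp) (auto simp: euclidean_inner[of "freq k" x])
    then show "indicator (cell::(real^'n) set) x *\<^sub>R wave k x = (\<Prod>b\<in>Basis. ?f b (x \<bullet> b))"
      by (simp add: ind scaleR_conv_of_real prod.distrib)
  qed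
  also have "(LINT x|lborel. (\<Prod>b\<in>Basis. ?f b (x \<bullet> b))) = (\<Prod>b\<in>(Basis::(real^'n) set). LINT y|lborel. ?f b y)"
    by (rule integral_lborel_prod[OF int])
  also have "\<dots> = 0"
  proof (rule prod_zero)
    show "\<exists>b\<in>(Basis::(real^'n) set). (LINT y|lborel. ?f b y) = 0"
      using integral_circle_cis[OF i] by (intro bexI[of _ "axis i 1"]) (auto simp: inner_axis)
  qed simp
  finally show ?thesis using False by simp
qed

lemma fourier_coeff_wave: "fourier_coeff (wave l) k = (if k = l then 1 else 0)"
  for k l :: "int ^ 'n::finite"
proof -
  have "wave l x * wave (- k) x = wave (l - k) x" for x
    using wave_add[of l "- k" x] by simp
  then show ?thesis unfolding fourier_coeff_alt by (simp add: integral_cell_wave)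
qed

text \<open>Fourier coefficients are bounded by the supremum norm, so they pass to uniform limits of finite sums.\<close>

lemma fourier_coeff_infsum:
  fixes h :: "'l \<Rightarrow> real ^ 'n::finite \<Rightarrow> complex"
  assumes h: "\<And>l. cell_integrable (h l)" and f: "cell_integrable f"
    and b: "\<And>l x. norm (h l x) \<le> b l" "b summable_on UNIV"
    and sum: "\<And>x. f x = (\<Sum>\<^sub>\<infinity>l. h l x)"
  shows "fourier_coeff f k = (\<Sum>\<^sub>\<infinity>l. fourier_coeff (h l) k)"
proof -
  have u: "uniform_limit UNIV (\<lambda>X y. \<Sum>l\<in>X. h l y) (\<lambda>y. \<Sum>\<^sub>\<infinity>l. h l y) (finite_subsets_at_top UNIV)"
    by (rule Weierstrass_m_test_general[OF b])
  have "((\<lambda>X. \<Sum>l\<in>X. fourier_coeff (h l) k) \<longlongrightarrow> fourier_coeff f k) (finite_subsets_at_top UNIV)"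
  proof (rule tendstoI)
    fix e :: real assume e: "e > 0"
    have "eventually (\<lambda>X. finite X) (finite_subsets_at_top (UNIV::'l set))"
      by (auto simp: eventually_finite_subsets_at_top)
    moreover have "eventually (\<lambda>X. \<forall>y\<in>UNIV. dist (\<Sum>l\<in>X. h l y) (\<Sum>\<^sub>\<infinity>l. h l y) < e / 2) (finite_subsets_at_top UNIV)"
      using u e by (intro uniform_limitD) auto
    ultimately show "eventually (\<lambda>X. dist (\<Sum>l\<in>X. fourier_coeff (h l) k) (fourier_coeff f k) < e) (finite_subsets_at_top UNIV)"
    proof eventually_elim
      case (elim X)
      have s: "cell_integrable (\<lambda>x. \<Sum>l\<in>X. h l x)"
        "fourier_coeff (\<lambda>x. \<Sum>l\<in>X. h l x) k = (\<Sum>l\<in>X. fourier_coeff (h l) k)"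
        using fourier_coeff_sum[OF elim(1) h] by auto
      have "norm (fourier_coeff (\<lambda>x. (\<Sum>l\<in>X. h l x) - f x) k) \<le> e / 2"
      proof (rule norm_fourier_coeff_le[OF set_integral_diff(1)[OF s(1) f]])
        show "norm ((\<Sum>l\<in>X. h l x) - f x) \<le> e / 2" for x
          using elim(2) by (auto simp: dist_norm sum intro!: less_imp_le)
      qed
      then show ?case using e by (simp add: fourier_coeff_diff s f dist_norm)
    qed
  qed
  then show ?thesis by (simp add: has_sum_def infsumI)
qed

lemma fourier_series_summable:
  assumes "(\<lambda>k. norm (c k)) summable_on UNIV"
  shows "(\<lambda>k. c k * wave k x) summable_on UNIV"
  by (rule abs_summable_summable) (use assms in \<open>simp add: norm_mult\<close>)

lemma continuous_fourier_series:
  fixes c :: "int ^ 'n \<Rightarrow> complex"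
  assumes "(\<lambda>k. norm (c k)) summable_on UNIV"
  shows "continuous_on S (\<lambda>x. \<Sum>\<^sub>\<infinity>k. c k * wave k x)"
proof (rule uniform_limit_theorem)
  show "uniform_limit S (\<lambda>X y. \<Sum>k\<in>X. c k * wave k y) (\<lambda>y. \<Sum>\<^sub>\<infinity>k. c k * wave k y) (finite_subsets_at_top UNIV)"
    by (rule Weierstrass_m_test_general[OF _ assms]) (simp add: norm_mult)
qed (auto intro!: always_eventually continuous_intros)

lemma fourier_coeff_series:
  fixes c :: "int ^ 'n::finite \<Rightarrow> complex"
  assumes "(\<lambda>k. norm (c k)) summable_on UNIV"
  shows "fourier_coeff (\<lambda>x. \<Sum>\<^sub>\<infinity>k. c k * wave k x) k = c k"
proof -
  have "fourier_coeff (\<lambda>x. \<Sum>\<^sub>\<infinity>l. c l * wave l x) k = (\<Sum>\<^sub>\<infinity>l. fourier_coeff (\<lambda>x. c l * wave l x) k)"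
    by (rule fourier_coeff_infsum[OF _ _ _ assms])
       (auto intro!: cell_integrable_continuous continuous_intros continuous_fourier_series assms simp: norm_mult)
  also have "\<dots> = (\<Sum>\<^sub>\<infinity>l\<in>{k}. c l)"
    by (rule infsum_cong_neutral) (auto simp: fourier_coeff_cmult fourier_coeff_wave)
  finally show ?thesis by simp
qed

text \<open>
  One factor is expanded into its absolutely convergent series, and multiplication of the other by
  a character shifts its coefficients.
\<close>

lemma fourier_coeff_product:
  fixes c :: "int ^ 'n::finite \<Rightarrow> complex"
  assumes c: "(\<lambda>k. norm (c k)) summable_on UNIV"
    and f: "continuous_on cell f" "\<And>x. norm (f x) \<le> B"
  shows "fourier_coeff (\<lambda>x. f x * (\<Sum>\<^sub>\<infinity>k. c k * wave k x)) k
    = (\<Sum>\<^sub>\<infinity>l. fourier_coeff f (k - l) * c l)"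
proof -
  have "fourier_coeff (\<lambda>x. f x * (\<Sum>\<^sub>\<infinity>k. c k * wave k x)) k
      = (\<Sum>\<^sub>\<infinity>l. fourier_coeff (\<lambda>x. f x * (c l * wave l x)) k)"
  proof (rule fourier_coeff_infsum)
    show "(\<lambda>l. B * norm (c l)) summable_on UNIV" by (intro summable_on_cmult_right c)
    show "norm (f x * (c l * wave l x)) \<le> B * norm (c l)" for l x
      using f(2)[of x] by (simp add: norm_mult mult_right_mono)
    show "f x * (\<Sum>\<^sub>\<infinity>k. c k * wave k x) = (\<Sum>\<^sub>\<infinity>l. f x * (c l * wave l x))" for x
      by (rule infsum_cmult_right[symmetric]) (rule fourier_series_summable[OF c])
  qed (auto intro!: cell_integrable_continuous continuous_intros continuous_fourier_series c f)
  also have "\<dots> = (\<Sum>\<^sub>\<infinity>l. fourier_coeff f (k - l) * c l)"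
  proof (rule infsum_cong)
    fix l
    have "(\<lambda>x. f x * (c l * wave l x)) = (\<lambda>x. c l * (f x * wave l x))" by (simp add: algebra_simps)
    then show "fourier_coeff (\<lambda>x. f x * (c l * wave l x)) k = fourier_coeff f (k - l) * c l"
      by (simp only: fourier_coeff_cmult fourier_coeff_mult_wave mult.commute)
  qed
  finally show ?thesis .
qed

lemma fourier_coeff_cnj:
  fixes f :: "real ^ 'n::finite \<Rightarrow> real"
  shows "fourier_coeff (cx f) (- k) = cnj (fourier_coeff (cx f) k)"
proof -
  have "cnj (LINT x:cell|lebesgue. cx f x * wave (- k) x) = (LINT x:cell|lebesgue. cx f x * wave k x)"
    unfolding set_lebesgue_integral_def Bochner_Integration.integral_cnj[symmetric]
    by (intro Bochner_Integration.integral_cong refl) (simp add: freq_minus cis_cnj)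
  then show ?thesis by (simp add: fourier_coeff_alt)
qed

subsection \<open>Derivatives and uniqueness\<close>

lemma cis_has_derivative:
  "((\<lambda>x. c * wave k x) has_derivative (\<lambda>h. c * (\<i> * of_real (freq k \<bullet> h)) * wave k x)) (at x within S)"
proof -
  have "((\<lambda>x. \<i> * of_real (freq k \<bullet> x)) has_derivative (\<lambda>h. \<i> * of_real (freq k \<bullet> h))) (at x within S)"
    by (auto intro!: derivative_eq_intros)
  from has_derivative_compose[OF this DERIV_exp[unfolded has_field_derivative_def]]
  have "((\<lambda>x. c * exp (\<i> * of_real (freq k \<bullet> x))) has_derivative
      (\<lambda>h. c * (exp (\<i> * of_real (freq k \<bullet> x)) * (\<i> * of_real (freq k \<bullet> h))))) (at x within S)"
    by (rule has_derivative_mult_right)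
  then show ?thesis by (simp add: cis_conv_exp mult_ac)
qed

text \<open>
  Termwise differentiation. The frequencies are enumerated so that the theorem on series of
  differentiable functions applies; the tails of the differentiated series are dominated by those
  of the \<open>w1\<close> sum, uniformly in the point.
\<close>

lemma fourier_series_has_derivative:
  fixes c :: "int ^ 'n::finite \<Rightarrow> complex"
  assumes c: "w1 c summable_on UNIV"
  shows "((\<lambda>x. \<Sum>\<^sub>\<infinity>k. c k * wave k x) has_derivative
          (\<lambda>h. \<Sum>\<^sub>\<infinity>k. c k * (\<i> * of_real (freq k \<bullet> h)) * wave k x)) (at x)"
proof -
  let ?f = "\<lambda>k x. c k * wave k x" and ?f' = "\<lambda>k x h. c k * (\<i> * of_real (freq k \<bullet> h)) * wave k x"
  define g' where "g' = (\<lambda>x h. \<Sum>\<^sub>\<infinity>k. ?f' k x h)"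
  have "infinite (UNIV :: (int ^ 'n) set)"
  proof
    assume "finite (UNIV :: (int ^ 'n) set)"
    then have "finite (range (\<lambda>m::int. \<chi> i::'n. m))" by (rule finite_subset[rotated]) simp
    moreover have "inj (\<lambda>m::int. \<chi> i::'n. m)" by (auto simp: inj_on_def vec_eq_iff)
    ultimately show False using finite_imageD infinite_UNIV_int by blast
  qed
  then have "bij_betw (from_nat_into (UNIV :: (int ^ 'n) set)) UNIV UNIV"
    by (intro bij_betw_from_nat_into countableI_type)
  then obtain \<sigma> :: "nat \<Rightarrow> int ^ 'n" where \<sigma>: "bij_betw \<sigma> UNIV UNIV" by blast
  have n1: "norm (?f k x) \<le> w1 c k" for k x
    using norm_le_w1[of c k] by (simp add: norm_mult)
  have n2: "norm (?f' k x h) \<le> w1 c k * norm h" for k x h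
  proof -
    have "\<bar>freq k \<bullet> h\<bar> \<le> bracket k * norm h"
      using Cauchy_Schwarz_ineq2[of "freq k" h] mult_right_mono[OF norm_freq_le_bracket[of k], of "norm h"] by simp
    then have "norm (c k) * \<bar>freq k \<bullet> h\<bar> \<le> norm (c k) * (bracket k * norm h)" by (intro mult_left_mono) auto
    then show ?thesis by (simp add: norm_mult w1_def mult_ac)
  qed
  have sums: "(\<lambda>n. F (\<sigma> n)) sums infsum F UNIV"
    if "\<And>k. norm (F k) \<le> w1 c k * B" for F :: "int ^ 'n \<Rightarrow> complex" and B
  proof -
    have "F summable_on UNIV"
      by (rule abs_summable_summable, rule Infinite_Sum.abs_summable_on_comparison_test',
          rule summable_on_cmult_left[OF c], rule that)
    then have "(F has_sum infsum F UNIV) UNIV" by simp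
    then have "((\<lambda>n. F (\<sigma> n)) has_sum infsum F UNIV) UNIV"
      by (simp add: has_sum_reindex_bij_betw[OF \<sigma>])
    then show ?thesis by (rule has_sum_imp_sums)
  qed
  have w1s: "summable (\<lambda>n. w1 c (\<sigma> n))"
    using c summable_on_reindex_bij_betw[OF \<sigma>, of "w1 c"] by (intro summable_on_imp_summable) simp
  have "\<exists>g. \<forall>x\<in>UNIV. (\<lambda>n. ?f (\<sigma> n) x) sums g x \<and> (g has_derivative g' x) (at x within UNIV)"
  proof (rule has_derivative_series)
    show "((\<lambda>x. ?f (\<sigma> n) x) has_derivative ?f' (\<sigma> n) x) (at x within UNIV)" for n x
      by (rule cis_has_derivative)
    show "(\<lambda>n. ?f (\<sigma> n) 0) sums (\<Sum>\<^sub>\<infinity>k. ?f k 0)"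
      by (rule sums[of _ 1]) (simp only: mult_1_right n1)
    fix e :: real assume e: "e > 0"
    have "(\<lambda>n. \<Sum>i. w1 c (\<sigma> (i + n))) \<longlonglongrightarrow> 0"
      by (rule suminf_exist_split2[OF w1s])
    then have "eventually (\<lambda>n. (\<Sum>i. w1 c (\<sigma> (i + n))) < e) sequentially"
      using e by (rule order_tendstoD)
    then show "\<forall>\<^sub>F n in sequentially. \<forall>x\<in>UNIV. \<forall>h. norm ((\<Sum>i<n. ?f' (\<sigma> i) x h) - g' x h) \<le> e * norm h"
    proof eventually_elim
      case (elim n)
      show ?case
      proof (intro ballI allI)
        fix x h
        have s: "(\<lambda>n. ?f' (\<sigma> n) x h) sums g' x h" unfolding g'_def by (rule sums[OF n2])
        have s1: "summable (\<lambda>i. w1 c (\<sigma> (i + n)))" by (rule summable_ignore_initial_segment[OF w1s])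
        have sn: "summable (\<lambda>i. norm (?f' (\<sigma> (i + n)) x h))"
          by (rule summable_comparison_test'[where N = 0, OF summable_mult2[OF s1]]) (use n2 in simp)
        have "g' x h = (\<Sum>i. ?f' (\<sigma> (i + n)) x h) + (\<Sum>i<n. ?f' (\<sigma> i) x h)"
          using suminf_split_initial_segment[OF sums_summable[OF s], of n] sums_unique[OF s] by simp
        then have "norm ((\<Sum>i<n. ?f' (\<sigma> i) x h) - g' x h) = norm (\<Sum>i. ?f' (\<sigma> (i + n)) x h)"
          by simp
        also have "\<dots> \<le> (\<Sum>i. norm (?f' (\<sigma> (i + n)) x h))" by (rule summable_norm[OF sn])
        also have "\<dots> \<le> (\<Sum>i. w1 c (\<sigma> (i + n)) * norm h)"
          by (intro suminf_le sn summable_mult2 s1 n2)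
        also have "\<dots> = (\<Sum>i. w1 c (\<sigma> (i + n))) * norm h" by (rule suminf_mult2[OF s1, symmetric])
        also have "\<dots> \<le> e * norm h" using elim by (intro mult_right_mono) auto
        finally show "norm ((\<Sum>i<n. ?f' (\<sigma> i) x h) - g' x h) \<le> e * norm h" .
      qed
    qed
  qed auto
  then obtain g where g: "\<And>x. (\<lambda>n. ?f (\<sigma> n) x) sums g x" "\<And>x. (g has_derivative g' x) (at x)" by auto
  have "g = (\<lambda>x. \<Sum>\<^sub>\<infinity>k. ?f k x)"
  proof
    fix x
    have "(\<lambda>n. ?f (\<sigma> n) x) sums (\<Sum>\<^sub>\<infinity>k. ?f k x)" by (rule sums[of _ 1]) (simp only: mult_1_right n1)
    then show "g x = (\<Sum>\<^sub>\<infinity>k. ?f k x)" using g(1)[of x] by (rule sums_unique2[symmetric])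
  qed
  then show ?thesis using g(2)[of x] unfolding g'_def by simp
qed

lemma partial_fourier_series:
  fixes c :: "int ^ 'n::finite \<Rightarrow> complex"
  assumes c: "w1 c summable_on UNIV"
  shows "partial j (\<lambda>x. \<Sum>\<^sub>\<infinity>k. c k * wave k x) x = (\<Sum>\<^sub>\<infinity>k. (\<i> * of_int (k $ j) * c k) * wave k x)"
  unfolding partial_def frechet_derivative_at[OF fourier_series_has_derivative[OF c], symmetric]
  by (simp add: inner_axis algebra_simps)

lemma w1_derivative_summable:
  fixes c :: "int ^ 'n::finite \<Rightarrow> complex"
  assumes c: "w1 c summable_on UNIV"
  shows "(\<lambda>k. norm (\<i> * of_int (k $ j) * c k)) summable_on UNIV"
proof (rule Infinite_Sum.abs_summable_on_comparison_test'[OF c])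
  show "norm (\<i> * of_int (k $ j) * c k) \<le> w1 c k" for k
    using mult_right_mono[OF abs_component_le_bracket[of k j], of "norm (c k)"] by (simp add: norm_mult w1_def)
qed

lemma w1_norm_summable:
  fixes c :: "int ^ 'n::finite \<Rightarrow> complex"
  assumes c: "w1 c summable_on UNIV"
  shows "(\<lambda>k. norm (c k)) summable_on UNIV"
  by (rule Infinite_Sum.abs_summable_on_comparison_test'[OF c]) (rule norm_le_w1)

definition orthogonal_to_waves :: "(real ^ 'n::finite \<Rightarrow> complex) \<Rightarrow> bool" where
  "orthogonal_to_waves f \<longleftrightarrow> continuous_on cell f \<and> (\<forall>k. fourier_coeff f k = 0)"

lemma orthogonal_to_waves_cmult: "orthogonal_to_waves f \<Longrightarrow> orthogonal_to_waves (\<lambda>x. c * f x)"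
  by (auto simp: orthogonal_to_waves_def fourier_coeff_cmult intro!: continuous_intros)

lemma orthogonal_to_waves_wave: "orthogonal_to_waves f \<Longrightarrow> orthogonal_to_waves (\<lambda>x. f x * wave l x)"
  by (auto simp: orthogonal_to_waves_def fourier_coeff_mult_wave intro!: continuous_intros)

lemma orthogonal_to_waves_sum:
  "finite I \<Longrightarrow> (\<And>i. i \<in> I \<Longrightarrow> orthogonal_to_waves (f i)) \<Longrightarrow> orthogonal_to_waves (\<lambda>x. \<Sum>i\<in>I. f i x)"
  by (auto simp: orthogonal_to_waves_def fourier_coeff_sum[THEN conjunct2] cell_integrable_continuous
           intro!: continuous_intros)

lemma orthogonal_to_waves_add:
  "orthogonal_to_waves f \<Longrightarrow> orthogonal_to_waves g \<Longrightarrow> orthogonal_to_waves (\<lambda>x. f x + g x)"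
  by (auto simp: orthogonal_to_waves_def fourier_coeff_add cell_integrable_continuous intro!: continuous_intros)

text \<open>
  The powers of the trigonometric polynomial \<open>q\<close> below, which attains its maximum over the cell only
  at \<open>x0\<close>, concentrate there, while their integrals against \<open>h\<close> vanish. Since \<open>x0\<close> is in the
  interior of the cell, small balls around it stay inside.
\<close>

lemma orthogonal_to_waves_zero_inside:
  fixes h :: "real ^ 'n::finite \<Rightarrow> complex"
  assumes h: "orthogonal_to_waves h" and x0: "x0 \<in> box 0 (\<chi> i. 2 * pi)"
  shows "h x0 = 0"
proof (rule ccontr)
  assume nz: "h x0 \<noteq> 0"
  define n where "n = real CARD('n)"
  have n: "n > 0" by (simp add: n_def)
  define q where "q = (\<lambda>x::real^'n. \<Sum>i\<in>UNIV. 1 + cos (x $ i - x0 $ i))"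
  have q_nonneg: "0 \<le> q x" for x
    unfolding q_def by (intro sum_nonneg) (use cos_ge_minus_one in \<open>smt (verit)\<close>)
  have q_cont: "continuous_on S q" for S
    unfolding q_def by (intro continuous_intros)
  have h_cont: "continuous_on cell h" using h by (simp add: orthogonal_to_waves_def)
  have pow: "orthogonal_to_waves (\<lambda>x. h x * of_real (q x ^ N))" for N
  proof (induction N)
    case (Suc N)
    let ?f = "\<lambda>x. h x * of_real (q x ^ N)"
    have w: "wave (axis i 1) x = cis (x $ i)" "wave (- axis i 1) x = cis (- (x $ i))" for i and x :: "real ^ 'n"
    proof -
      have "freq (axis i 1) = (axis i 1 :: real ^ 'n)" by (simp add: vec_eq_iff axis_def)
      then show "wave (axis i 1) x = cis (x $ i)" "wave (- axis i 1) x = cis (- (x $ i))"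
        by (simp_all add: freq_minus inner_axis' )
    qed
    have c: "of_real (1 + cos (x $ i - x0 $ i))
        = 1 + (cis (- (x0 $ i)) / 2) * wave (axis i 1) x + (cis (x0 $ i) / 2) * wave (- axis i 1) x" for i x
      unfolding w by (simp add: complex_eq_iff cos_diff field_simps)
    have "(\<lambda>x. h x * of_real (q x ^ Suc N)) = (\<lambda>x. \<Sum>i\<in>UNIV. ?f x
        + (cis (- (x0 $ i)) / 2) * (?f x * wave (axis i 1) x) + (cis (x0 $ i) / 2) * (?f x * wave (- axis i 1) x))"
    proof
      fix x
      have "h x * of_real (q x ^ Suc N) = (\<Sum>i\<in>UNIV. ?f x * of_real (1 + cos (x $ i - x0 $ i)))"
      proof -
        have "(\<Sum>i\<in>UNIV. ?f x * of_real (1 + cos (x $ i - x0 $ i))) = ?f x * of_real (q x)"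
          by (simp only: q_def of_real_sum sum_distrib_left)
        then show ?thesis by (simp add: mult_ac)
      qed
      then show "h x * of_real (q x ^ Suc N) = (\<Sum>i\<in>UNIV. ?f x
        + (cis (- (x0 $ i)) / 2) * (?f x * wave (axis i 1) x) + (cis (x0 $ i) / 2) * (?f x * wave (- axis i 1) x))"
        unfolding c by (simp only: distrib_left mult_1_right mult.assoc mult.left_commute)
    qed
    moreover have "orthogonal_to_waves (\<lambda>x. \<Sum>i\<in>UNIV. ?f x
        + (cis (- (x0 $ i)) / 2) * (?f x * wave (axis i 1) x) + (cis (x0 $ i) / 2) * (?f x * wave (- axis i 1) x))"
      by (intro orthogonal_to_waves_sum orthogonal_to_waves_add orthogonal_to_waves_cmult
            orthogonal_to_waves_wave Suc finite)
    ultimately show ?case by simp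
  qed (simp add: h)
  define g where "g = (\<lambda>x. Re (cnj (h x0) * h x))"
  have g_cont: "continuous_on cell g" unfolding g_def by (intro continuous_intros h_cont)
  have int0: "(LINT x:cell|lebesgue. g x * q x ^ N) = 0" for N
  proof -
    let ?F = "\<lambda>x. cnj (h x0) * (h x * of_real (q x ^ N))"
    have o: "orthogonal_to_waves ?F" by (rule orthogonal_to_waves_cmult[OF pow])
    then have "fourier_coeff ?F 0 = 0" by (simp add: orthogonal_to_waves_def)
    then have A: "(LINT x:cell|lebesgue. ?F x) = 0"
      by (simp add: fourier_coeff_def)
    have "cell_integrable ?F"
      by (rule cell_integrable_continuous) (use o in \<open>simp add: orthogonal_to_waves_def\<close>)
    then have B: "(LINT x|lebesgue. Re (indicator cell x *\<^sub>R ?F x)) = Re (LINT x:cell|lebesgue. ?F x)"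
      unfolding set_lebesgue_integral_def set_integrable_def by (rule Bochner_Integration.integral_Re)
    have C: "(\<lambda>x. Re (indicator cell x *\<^sub>R ?F x)) = (\<lambda>x. indicator cell x *\<^sub>R (g x * q x ^ N))"
      by (simp add: g_def fun_eq_iff mult.assoc[symmetric] del: of_real_power)
    have "(LINT x:cell|lebesgue. g x * q x ^ N) = Re (LINT x:cell|lebesgue. ?F x)"
      unfolding B[symmetric] C by (simp only: set_lebesgue_integral_def)
    then show ?thesis by (simp only: A zero_complex.sel)
  qed
  define \<delta> where "\<delta> = g x0 / 2"
  have "g x0 = (norm (h x0))\<^sup>2"
    unfolding cmod_power2 by (simp add: g_def power2_eq_square)
  then have \<delta>: "\<delta> > 0" using nz by (simp add: \<delta>_def)
  have inside: "box 0 (\<chi> i. 2 * pi) \<subseteq> (cell :: (real ^ 'n) set)"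
    unfolding cell_def by (rule box_subset_cbox)
  have "continuous_on (box 0 (\<chi> i. 2 * pi)) g" by (rule continuous_on_subset[OF g_cont inside])
  then have "isCont g x0" using x0 continuous_on_eq_continuous_at[OF open_box] by blast
  then have "eventually (\<lambda>x. \<delta> < g x) (at x0)"
    using \<delta> by (intro order_tendstoD(1)[of g "g x0"]) (auto simp: \<delta>_def isCont_def)
  then obtain r1 where r1: "r1 > 0" "\<And>x. dist x x0 < r1 \<Longrightarrow> x \<noteq> x0 \<Longrightarrow> \<delta> < g x"
    unfolding eventually_at by auto
  obtain r2 where r2: "r2 > 0" "ball x0 r2 \<subseteq> box 0 (\<chi> i. 2 * pi)"
    using open_contains_ball[of "box 0 (\<chi> i. 2 * pi)"] x0 by (auto simp: open_box)
  define r where "r = min r1 r2"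
  have r: "r > 0" using r1 r2 by (simp add: r_def)
  have g_big: "\<delta> \<le> g x" if "x \<in> ball x0 r" for x
    using r1(2)[of x] \<delta> that by (cases "x = x0") (auto simp: \<delta>_def r_def dist_commute)
  have ball_cell: "ball x0 r \<subseteq> cell" using r2 inside by (auto simp: r_def)
  define K where "K = (cell :: (real ^ 'n) set) - ball x0 r"
  have K: "compact K" unfolding K_def by (intro compact_diff) auto
  have q_K: "q x < 2 * n" if "x \<in> K" for x
  proof (rule ccontr)
    assume "\<not> q x < 2 * n"
    then have ge: "(\<Sum>i\<in>(UNIV::'n set). 2) \<le> (\<Sum>i\<in>UNIV. 1 + cos (x $ i - x0 $ i))"
      by (simp add: q_def n_def)
    have "x $ i = x0 $ i" for i
    proof -
      have "cos (x $ i - x0 $ i) = 1"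
      proof (rule ccontr)
        assume "cos (x $ i - x0 $ i) \<noteq> 1"
        then have "1 + cos (x $ i - x0 $ i) < 2" using cos_le_one[of "x $ i - x0 $ i"] by linarith
        then have "(\<Sum>i\<in>UNIV. 1 + cos (x $ i - x0 $ i)) < (\<Sum>i\<in>(UNIV::'n set). 2)"
          by (intro sum_strict_mono_ex1) (auto intro: exI[of _ i])
        with ge show False by simp
      qed
      then obtain m where m: "x $ i - x0 $ i = of_int m * (2 * pi)"
        by (auto simp: cos_one_2pi_int mult_ac)
      have "0 \<le> x $ i" "x $ i \<le> 2 * pi" using that by (auto simp: K_def mem_cell)
      moreover have "0 < x0 $ i" "x0 $ i < 2 * pi" using x0 by (auto simp: mem_box_cart)
      ultimately have "\<bar>of_int m * (2 * pi)\<bar> < 1 * (2 * pi)" unfolding m[symmetric] by linarith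
      then have "\<bar>real_of_int m\<bar> < 1" unfolding abs_mult by (simp add: abs_of_pos)
      then have "m = 0" by linarith
      then show ?thesis using m by simp
    qed
    then have "x = x0" by (simp add: vec_eq_iff)
    then show False using that r by (simp add: K_def)
  qed
  obtain \<rho> where \<rho>: "0 \<le> \<rho>" "\<rho> < 2 * n" "\<And>x. x \<in> K \<Longrightarrow> q x \<le> \<rho>"
  proof (cases "K = {}")
    case True then show ?thesis using that[of 0] n by auto
  next
    case False
    then obtain y where y: "y \<in> K" "\<And>x. x \<in> K \<Longrightarrow> q x \<le> q y"
      using continuous_attains_sup[OF K _ q_cont] by blast
    then show ?thesis using that[of "q y"] q_nonneg q_K by auto
  qed
  define \<rho>' where "\<rho>' = (\<rho> + 2 * n) / 2"
  have \<rho>': "\<rho> < \<rho>'" "0 < \<rho>'" "\<rho>' < 2 * n" using \<rho> n by (auto simp: \<rho>'_def)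
  have "q x0 = 2 * n" by (simp add: q_def n_def)
  moreover have "isCont q x0" using q_cont[of UNIV] by (simp add: continuous_on_eq_continuous_at)
  ultimately have "eventually (\<lambda>x. \<rho>' < q x) (at x0)"
    using \<rho>' by (intro order_tendstoD(1)[of q "q x0"]) (auto simp: isCont_def)
  then obtain r3 where r3: "r3 > 0" "\<And>x. dist x x0 < r3 \<Longrightarrow> x \<noteq> x0 \<Longrightarrow> \<rho>' < q x"
    unfolding eventually_at by auto
  define r' where "r' = min r r3"
  have r': "r' > 0" "ball x0 r' \<subseteq> ball x0 r" using r r3 by (auto simp: r'_def)
  have q_big: "\<rho>' \<le> q x" if "x \<in> ball x0 r'" for x
    using r3(2)[of x] \<rho>' \<open>q x0 = 2 * n\<close> that by (cases "x = x0") (auto simp: r'_def dist_commute)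
  obtain M where M: "0 < M" "\<And>x. x \<in> cell \<Longrightarrow> \<bar>g x\<bar> \<le> M"
    using compact_imp_bounded[OF compact_continuous_image[OF g_cont compact_cell]]
    by (auto simp: bounded_pos)
  define V where "V = measure lebesgue (ball x0 r')"
  have V: "V > 0" unfolding V_def using r' by (simp add: content_ball_pos measure_completion)
  define L where "L = (2 * pi) ^ CARD('n)"
  have key: "\<delta> * \<rho>' ^ N * V \<le> M * \<rho> ^ N * L" for N
  proof -
    let ?l = "\<lambda>x. indicator (ball x0 r') x *\<^sub>R (\<delta> * \<rho>' ^ N) - M * \<rho> ^ N"
    have ib: "integrable lebesgue (\<lambda>x. indicator (ball x0 r') x *\<^sub>R (\<delta> * \<rho>' ^ N))"
      by (intro integrable_scaleR_left integrable_real_indicator)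
         (use lmeasurable_ball[of x0 r'] in \<open>auto simp: fmeasurable_def\<close>)
    have i1: "cell_integrable (\<lambda>x. indicator (ball x0 r') x *\<^sub>R (\<delta> * \<rho>' ^ N))"
      unfolding set_integrable_def by (intro integrable_mult_indicator cell_sets ib)
    have i2: "cell_integrable (\<lambda>x::real^'n. M * \<rho> ^ N)"
      by (intro cell_integrable_continuous continuous_intros)
    have "(LINT x:cell|lebesgue. ?l x) \<le> (LINT x:cell|lebesgue. g x * q x ^ N)"
    proof (rule set_integral_mono)
      show "cell_integrable ?l" by (rule set_integral_diff(1)[OF i1 i2])
      show "cell_integrable (\<lambda>x. g x * q x ^ N)"
        by (intro cell_integrable_continuous continuous_intros g_cont q_cont)
      fix x assume x: "x \<in> (cell :: (real ^ 'n) set)"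
      show "?l x \<le> g x * q x ^ N"
      proof (cases "x \<in> ball x0 r")
        case True
        have "(if x \<in> ball x0 r' then \<delta> * \<rho>' ^ N else 0) \<le> g x * q x ^ N"
        proof (cases "x \<in> ball x0 r'")
          case T: True
          then show ?thesis using g_big[OF True] q_big[OF T] \<delta> \<rho>'
            by (simp add: mult_mono power_mono)
        next
          case False
          then show ?thesis using g_big[OF True] \<delta> q_nonneg[of x] by simp
        qed
        moreover have "0 \<le> M * \<rho> ^ N" using M \<rho> by simp
        ultimately show ?thesis by (auto simp: indicator_def)
      next
        case False
        then have "x \<in> K" using x by (simp add: K_def)
        then have "\<bar>g x\<bar> * q x ^ N \<le> M * \<rho> ^ N"
          using M x \<rho> q_nonneg by (intro mult_mono power_mono) auto
        moreover have "- (\<bar>g x\<bar> * q x ^ N) \<le> g x * q x ^ N"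
          using mult_right_mono[of "- \<bar>g x\<bar>" "g x" "q x ^ N"] q_nonneg[of x] by simp
        moreover have "x \<notin> ball x0 r'" using False r' by auto
        ultimately show ?thesis by (simp add: indicator_def)
      qed
    qed
    also have "\<dots> = 0" by (rule int0)
    also have "(LINT x:cell|lebesgue. ?l x)
        = (LINT x:cell|lebesgue. indicator (ball x0 r') x *\<^sub>R (\<delta> * \<rho>' ^ N)) - (LINT x:(cell::(real^'n) set)|lebesgue. M * \<rho> ^ N)"
      by (rule set_integral_diff(2)[OF i1 i2])
    also have "(LINT x:cell|lebesgue. indicator (ball x0 r') x *\<^sub>R (\<delta> * \<rho>' ^ N))
        = (LINT x|lebesgue. indicator (ball x0 r') x *\<^sub>R (\<delta> * \<rho>' ^ N))"
      unfolding set_lebesgue_integral_def using r'(2) ball_cell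
      by (intro Bochner_Integration.integral_cong refl) (auto simp: indicator_def)
    also have "\<dots> = V * (\<delta> * \<rho>' ^ N)"
      by (simp add: V_def)
    finally show ?thesis
      by (simp add: integral_cell_const L_def algebra_simps)
  qed
  have "(\<lambda>N. M * L * (\<rho> / \<rho>') ^ N) \<longlonglongrightarrow> M * L * 0"
    using \<rho> \<rho>' by (intro tendsto_intros LIMSEQ_realpow_zero) auto
  moreover have "\<delta> * V \<le> M * L * (\<rho> / \<rho>') ^ N" for N
    using key[of N] \<rho>' by (simp add: power_divide field_simps)
  ultimately have "\<delta> * V \<le> M * L * 0"
    by (intro LIMSEQ_le_const) auto
  then show False using \<delta> V by (simp add: mult_le_0_iff)
qed

lemma periodic_int_shift_axis:
  assumes "periodic f"
  shows "f (x + (2 * pi * of_int m) *\<^sub>R axis i 1) = f x"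
proof -
  have nat: "f (x + (2 * pi * real n) *\<^sub>R axis i 1) = f x" for n x
  proof (induction n)
    case (Suc n)
    have "x + (2 * pi * real (Suc n)) *\<^sub>R axis i 1 = (x + (2 * pi * real n) *\<^sub>R axis i 1) + (2 * pi) *\<^sub>R axis i 1"
      by (simp add: algebra_simps)
    then show ?case using assms Suc by (metis periodic_def)
  qed simp
  show ?thesis
  proof (cases "m \<ge> 0")
    case True then show ?thesis using nat[of x "nat m"] by simp
  next
    case False
    then show ?thesis
      using nat[of "x + (2 * pi * of_int m) *\<^sub>R axis i 1" "nat (- m)"]
      by (simp add: scaleR_add_left[symmetric])
  qed
qed

lemma periodic_shift_into_cell:
  fixes f :: "real ^ 'n::finite \<Rightarrow> 'b"
  assumes "periodic f"
  obtains y where "y \<in> cell" "f y = f x"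
proof -
  define m where "m = (\<lambda>i. - \<lfloor>x $ i / (2 * pi)\<rfloor>)"
  have I: "f (x + (\<Sum>i\<in>I. (2 * pi * of_int (m i)) *\<^sub>R axis i 1)) = f x" if "finite I" for I
    using that
  proof (induction I rule: finite_induct)
    case (insert i I)
    have eq: "x + (\<Sum>i\<in>insert i I. (2 * pi * of_int (m i)) *\<^sub>R axis i 1)
        = (x + (\<Sum>i\<in>I. (2 * pi * of_int (m i)) *\<^sub>R axis i 1)) + (2 * pi * of_int (m i)) *\<^sub>R axis i 1"
      using insert.hyps by (simp add: algebra_simps)
    show ?case unfolding eq periodic_int_shift_axis[OF assms] by (rule insert.IH)
  qed simp
  define y where "y = x + (\<Sum>i\<in>UNIV. (2 * pi * of_int (m i)) *\<^sub>R axis i 1)"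
  have y: "y $ i = x $ i + 2 * pi * of_int (m i)" for i
  proof -
    have "(\<Sum>j\<in>UNIV. (2 * pi * of_int (m j)) * (axis j (1::real) $ i)) = (\<Sum>j\<in>{i}. (2 * pi * of_int (m j)) * (axis j 1 $ i))"
      by (rule sum.mono_neutral_right) (auto simp: axis_def)
    then show ?thesis by (simp add: y_def axis_def)
  qed
  have "y \<in> cell"
    unfolding mem_cell
  proof
    fix i
    have "of_int \<lfloor>x $ i / (2 * pi)\<rfloor> * (2 * pi) \<le> x $ i" by (rule floor_divide_lower) simp
    moreover have "x $ i < (of_int \<lfloor>x $ i / (2 * pi)\<rfloor> + 1) * (2 * pi)" by (rule floor_divide_upper) simp
    ultimately show "0 \<le> y $ i \<and> y $ i \<le> 2 * pi"
      by (simp add: y m_def algebra_simps)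
  qed
  then show thesis using that I[of UNIV] by (simp add: y_def)
qed

lemma fourier_coeff_zero_imp_zero:
  fixes h :: "real ^ 'n::finite \<Rightarrow> complex"
  assumes h: "continuous_on UNIV h" "periodic h" "\<And>k. fourier_coeff h k = 0"
  shows "h x = 0"
proof -
  have o: "orthogonal_to_waves h"
    using h continuous_on_subset[OF h(1)] by (auto simp: orthogonal_to_waves_def)
  have "h y = 0" if "y \<in> cell" for y
  proof -
    have "pi *\<^sub>R 1 \<in> box (0::real^'n) (\<chi> i. 2 * pi)" by (simp add: mem_box_cart)
    then have "cell = closure (box (0::real^'n) (\<chi> i. 2 * pi))"
      by (subst closure_box) (auto simp: cell_def)
    moreover have "closure (box 0 (\<chi> i. 2 * pi)) \<subseteq> {x. h x = 0}"
      by (rule closure_minimal)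
         (use orthogonal_to_waves_zero_inside[OF o] h(1) in \<open>auto intro!: closed_Collect_eq\<close>)
    ultimately show ?thesis using that by auto
  qed
  then show ?thesis using periodic_shift_into_cell[OF h(2), of x] by metis
qed

lemma periodic_wave: "periodic (wave k)"
  unfolding periodic_def
proof (intro allI)
  fix x i
  have "freq k \<bullet> (x + (2 * pi) *\<^sub>R axis i 1) = freq k \<bullet> x + 2 * pi * of_int (k $ i)"
    by (simp add: inner_add_right inner_axis)
  then show "wave k (x + (2 * pi) *\<^sub>R axis i 1) = wave k x"
    by (simp add: cis_mult[symmetric] cis_multiple_2pi)
qed

lemma periodic_fourier_series: "periodic (\<lambda>x. \<Sum>\<^sub>\<infinity>k. c k * wave k x)"
  unfolding periodic_def by (intro allI) (simp only: periodic_wave[unfolded periodic_def, rule_format])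

lemma fourier_inversion:
  fixes f :: "real ^ 'n::finite \<Rightarrow> complex"
  assumes f: "continuous_on UNIV f" "periodic f" and s: "(\<lambda>k. norm (fourier_coeff f k)) summable_on UNIV"
  shows "f x = (\<Sum>\<^sub>\<infinity>k. fourier_coeff f k * wave k x)"
proof -
  let ?g = "\<lambda>x. \<Sum>\<^sub>\<infinity>k. fourier_coeff f k * wave k x"
  have g: "continuous_on UNIV ?g" by (rule continuous_fourier_series[OF s])
  have "f x - ?g x = 0"
  proof (rule fourier_coeff_zero_imp_zero)
    show "continuous_on UNIV (\<lambda>x. f x - ?g x)" by (intro continuous_on_diff f g)
    show "periodic (\<lambda>x. f x - ?g x)"
      unfolding periodic_def
    proof (intro allI)
      fix x i
      show "f (x + (2 * pi) *\<^sub>R axis i 1) - ?g (x + (2 * pi) *\<^sub>R axis i 1) = f x - ?g x"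
        using f(2) periodic_fourier_series[of "fourier_coeff f"] unfolding periodic_def by presburger
    qed
    show "fourier_coeff (\<lambda>x. f x - ?g x) k = 0" for k
      by (subst fourier_coeff_diff)
         (auto intro!: cell_integrable_continuous continuous_on_subset[OF f(1)] continuous_on_subset[OF g]
           simp: fourier_coeff_series[OF s])
  qed
  then show ?thesis by simp
qed

section \<open>Norms and symbols in terms of Fourier coefficients\<close>

lemma ennreal_infsum_le_iff:
  assumes g: "\<And>k. k \<in> A \<Longrightarrow> 0 \<le> g k" and B: "0 \<le> B"
  shows "(\<Sum>\<^sub>\<infinity>k\<in>A. ennreal (g k)) \<le> ennreal B \<longleftrightarrow> (\<forall>F. finite F \<longrightarrow> F \<subseteq> A \<longrightarrow> sum g F \<le> B)"
proof -
  have *: "(\<Sum>k\<in>F. ennreal (g k)) \<le> ennreal B \<longleftrightarrow> sum g F \<le> B" if "F \<subseteq> A" for F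
    using that g B by (subst sum_ennreal) (auto simp: ennreal_le_iff)
  have "(\<Sum>\<^sub>\<infinity>k\<in>A. ennreal (g k)) = (SUP F\<in>{F. finite F \<and> F \<subseteq> A}. \<Sum>k\<in>F. ennreal (g k))"
    by (rule nonneg_infsum_complete) simp
  then show ?thesis using * by (auto simp: SUP_le_iff)
qed

lemma sqrt_enn2real_le:
  "0 \<le> B \<Longrightarrow> X \<le> ennreal (B\<^sup>2) \<Longrightarrow> sqrt (enn2real X) \<le> B"
  by (rule real_le_lsqrt) (auto intro!: enn2real_leI)

lemma le_ennreal_of_sqrt_enn2real_le:
  assumes "X < \<infinity>" "sqrt (enn2real X) \<le> B"
  shows "X \<le> ennreal (B\<^sup>2)"
proof -
  have "0 \<le> B" by (rule order_trans[OF _ assms(2)]) simp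
  then have "enn2real X \<le> B\<^sup>2" using assms(2) real_sqrt_le_iff[of "enn2real X" "B\<^sup>2"] by simp
  then have "ennreal (enn2real X) \<le> ennreal (B\<^sup>2)" by (rule ennreal_leI)
  moreover have "ennreal (enn2real X) = X" using assms(1) by simp
  ultimately show ?thesis by (simp only:)
qed

lemma hs_le_of_sobolev:
  assumes "sobolev_space s f" "sobolev_norm s f \<le> M"
  shows "hs_le s (M\<^sup>2) (fourier_coeff f)"
proof -
  have "sobolev_sum s f \<le> ennreal (M\<^sup>2)"
    using assms by (intro le_ennreal_of_sqrt_enn2real_le) (auto simp: sobolev_space_def sobolev_norm_def)
  then show ?thesis
    unfolding sobolev_sum_def by (subst (asm) ennreal_infsum_le_iff) (auto simp: hs_le_def bracket_powr_double)
qed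

lemma sobolev_norm_le:
  assumes "hs_le s (B\<^sup>2) (fourier_coeff f)" "0 \<le> B"
  shows "sobolev_norm s f \<le> B"
  unfolding sobolev_norm_def sobolev_sum_def
  using assms by (intro sqrt_enn2real_le) (auto simp: ennreal_infsum_le_iff hs_le_def bracket_powr_double)

definition gevrey_weight :: "real \<Rightarrow> real \<Rightarrow> real \<Rightarrow> int ^ 'n \<Rightarrow> real" where
  "gevrey_weight s r \<tau> k = norm (freq k) powr (2 * r) * exp (2 * \<tau> * norm (freq k) powr (1 / s))"

lemma gevrey_weight_nonneg [simp]: "0 \<le> gevrey_weight s r \<tau> k"
  by (simp add: gevrey_weight_def)

lemma gevrey_sum_le_iff:
  assumes "0 \<le> B"
  shows "gevrey_sum s r \<tau> f \<le> ennreal B \<longleftrightarrow>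
    (\<forall>F. finite F \<longrightarrow> 0 \<notin> F \<longrightarrow> (\<Sum>k\<in>F. gevrey_weight s r \<tau> k * (norm (fourier_coeff f k))\<^sup>2) \<le> B)"
  unfolding gevrey_sum_def using assms
  by (subst ennreal_infsum_le_iff) (auto simp: gevrey_weight_def subset_Diff_insert)

lemma gevrey_norm_le:
  assumes "\<And>F. finite F \<Longrightarrow> 0 \<notin> F \<Longrightarrow> (\<Sum>k\<in>F. gevrey_weight s r \<tau> k * (norm (fourier_coeff f k))\<^sup>2) \<le> B\<^sup>2" "0 \<le> B"
  shows "gevrey_norm s r \<tau> f \<le> B"
  unfolding gevrey_norm_def using assms by (intro sqrt_enn2real_le) (auto simp: gevrey_sum_le_iff)

lemma gevrey_boundD:
  assumes "gevrey_dom s r \<tau> f" "gevrey_norm s r \<tau> f \<le> C" "finite F" "0 \<notin> F"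
  shows "(\<Sum>k\<in>F. gevrey_weight s r \<tau> k * (norm (fourier_coeff f k))\<^sup>2) \<le> C\<^sup>2"
proof -
  have "gevrey_sum s r \<tau> f \<le> ennreal (C\<^sup>2)"
    using assms by (intro le_ennreal_of_sqrt_enn2real_le) (auto simp: gevrey_dom_def gevrey_norm_def)
  then show ?thesis using assms by (simp add: gevrey_sum_le_iff)
qed

lemma norm_freq_ge_1: "k \<noteq> 0 \<Longrightarrow> 1 \<le> norm (freq k)"
proof -
  assume "k \<noteq> 0"
  then obtain i where "k $ i \<noteq> 0" by (auto simp: vec_eq_iff)
  then have "1 \<le> \<bar>freq k $ i\<bar>" by simp
  also have "\<dots> \<le> norm (freq k)" by (rule component_le_norm_cart)
  finally show ?thesis .
qed

text \<open>
  The Gevrey norm is homogeneous, so only scalars of mean zero inherit an inhomogeneous Sobolev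
  bound from it.
\<close>

lemma hs_le_of_gevrey:
  fixes f :: "real ^ 'n::finite \<Rightarrow> complex"
  assumes r: "0 \<le> r" and \<tau>: "0 \<le> \<tau>" and f0: "fourier_coeff f 0 = 0"
    and f: "gevrey_dom s r \<tau> f" "gevrey_norm s r \<tau> f \<le> C"
  shows "hs_le r (2 powr r * C\<^sup>2) (fourier_coeff f)"
  unfolding hs_le_def
proof (intro allI impI)
  fix F :: "(int ^ 'n) set" assume F: "finite F"
  have w: "bracket k powr (2 * r) \<le> 2 powr r * gevrey_weight s r \<tau> k" if "k \<noteq> 0" for k :: "int ^ 'n"
  proof -
    let ?x = "norm (freq k)"
    have x: "1 \<le> ?x" by (rule norm_freq_ge_1[OF that])
    then have "1 \<le> ?x\<^sup>2" by simp
    then have "(1 + ?x\<^sup>2) powr r \<le> (2 * ?x\<^sup>2) powr r" using r by (intro powr_mono2) auto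
    also have "\<dots> = 2 powr r * ?x powr (2 * r)"
      using x by (simp add: powr_mult powr_powr[symmetric])
    also have "?x powr (2 * r) \<le> gevrey_weight s r \<tau> k"
      unfolding gevrey_weight_def using \<tau> mult_left_mono[of 1 "exp (2 * \<tau> * ?x powr (1 / s))" "?x powr (2 * r)"]
      by simp
    finally show ?thesis by (simp add: bracket_powr_double)
  qed
  have "(\<Sum>k\<in>F. bracket k powr (2 * r) * (norm (fourier_coeff f k))\<^sup>2)
      = (\<Sum>k\<in>F - {0}. bracket k powr (2 * r) * (norm (fourier_coeff f k))\<^sup>2)"
    using F f0 by (intro sum.mono_neutral_right) auto
  also have "\<dots> \<le> (\<Sum>k\<in>F - {0}. 2 powr r * gevrey_weight s r \<tau> k * (norm (fourier_coeff f k))\<^sup>2)"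
    by (intro sum_mono mult_right_mono w) auto
  also have "\<dots> = 2 powr r * (\<Sum>k\<in>F - {0}. gevrey_weight s r \<tau> k * (norm (fourier_coeff f k))\<^sup>2)"
    by (simp add: sum_distrib_left mult.assoc)
  also have "\<dots> \<le> 2 powr r * C\<^sup>2"
    by (intro mult_left_mono gevrey_boundD[OF f]) (use F in auto)
  finally show "(\<Sum>k\<in>F. bracket k powr (2 * r) * (norm (fourier_coeff f k))\<^sup>2) \<le> 2 powr r * C\<^sup>2" .
qed

lemma fourier_coeff_0_zero_mean:
  fixes f :: "real ^ 'n::finite \<Rightarrow> real"
  shows "zero_mean f \<longleftrightarrow> cell_integrable f \<and> fourier_coeff (cx f) 0 = 0"
  by (simp add: zero_mean_def fourier_coeff_def set_integral_complex_of_real)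

lemma L2_torus_continuous:
  fixes f :: "real ^ 'n::finite \<Rightarrow> complex"
  assumes "continuous_on UNIV f" "periodic f"
  shows "L2_torus f"
  unfolding L2_torus_def
proof (intro conjI assms)
  have "f \<in> borel_measurable borel" using assms(1) by (rule borel_measurable_continuous_onI)
  then show "f \<in> borel_measurable lebesgue" by (intro measurable_completion) simp
  show "cell_integrable (\<lambda>x. (norm (f x))\<^sup>2)"
    by (intro cell_integrable_continuous continuous_intros continuous_on_subset[OF assms(1)]) auto
qed

lemma L2_torus_integrable:
  fixes f :: "real ^ 'n::finite \<Rightarrow> complex"
  assumes "L2_torus f"
  shows "cell_integrable f"
proof (rule set_integrable_bound)
  have "cell_integrable (\<lambda>x. (norm (f x))\<^sup>2)" using assms by (simp add: L2_torus_def)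
  moreover have "cell_integrable (\<lambda>x::real^'n. 1::real)"
    by (intro cell_integrable_continuous continuous_intros)
  ultimately show "cell_integrable (\<lambda>x. (norm (f x))\<^sup>2 + 1)" by (rule set_integral_add(1))
  have "f \<in> borel_measurable lebesgue" using assms by (simp add: L2_torus_def)
  then show "set_borel_measurable lebesgue cell f" unfolding set_borel_measurable_def by measurable
  have "norm (f x) \<le> norm ((norm (f x))\<^sup>2 + 1)" for x
  proof -
    have "2 * norm (f x) \<le> (norm (f x))\<^sup>2 + 1"
      using zero_le_power2[of "norm (f x) - 1"] by (simp add: power2_diff)
    then have "norm (f x) \<le> (norm (f x))\<^sup>2 + 1" using norm_ge_zero[of "f x"] by linarith
    then show ?thesis by simp
  qed
  then show "AE x in lebesgue. x \<in> cell \<longrightarrow> norm (f x) \<le> norm ((norm (f x))\<^sup>2 + 1)" by simp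
qed

subsection \<open>Consequences of the assumptions on the symbols\<close>

text \<open>
  Boundedness from \<open>L\<^sup>\<infinity>\<close> to \<open>BMO\<close>, tested on one character over the full cell, bounds the symbol:
  a nonzero Fourier coefficient does not see the subtracted mean.
\<close>

lemma bounded_Linf_BMO_symbol:
  fixes m :: "int ^ 'n::finite \<Rightarrow> complex"
  assumes "bounded_Linf_BMO m"
  obtains B where "\<And>k. k \<noteq> 0 \<Longrightarrow> norm (m k) \<le> B"
proof -
  obtain B where B: "\<And>f M. Linf_with_bound f M \<Longrightarrow>
      \<exists>g. bmo_with_bound g (B * M) \<and> (\<forall>k. fourier_coeff g k = m k * fourier_coeff f k)"
    using assms unfolding bounded_Linf_BMO_def by blast
  have "norm (m k) \<le> B" if k: "k \<noteq> 0" for k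
  proof -
    have "Linf_with_bound (wave k) 1"
      by (simp add: Linf_with_bound_def periodic_wave)
    then obtain g where g: "bmo_with_bound g B" "\<And>l. fourier_coeff g l = m l * fourier_coeff (wave k) l"
      using B[of "wave k" 1] by auto
    define c where "c = mean_on cell g"
    have gi: "cell_integrable g" using g(1) by (simp add: bmo_with_bound_def)
    have ci: "cell_integrable (\<lambda>x::real^'n. c)" by (intro cell_integrable_continuous continuous_intros)
    have "cbox (0::real^'n) (0 + (\<chi> i. 2 * pi)) = cell" by (simp add: cell_def)
    then have mean: "mean_on cell (\<lambda>x. norm (g x - c)) \<le> B"
      using g(1) pi_gt_zero unfolding bmo_with_bound_def c_def Let_def by (metis mult_pos_pos order_refl zero_less_numeral)
    have "fourier_coeff (\<lambda>x::real^'n. c) k = 0"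
      using fourier_coeff_cmult[of c "wave 0" k] fourier_coeff_wave[of 0 k] k by simp
    then have "fourier_coeff (\<lambda>x. g x - c) k = m k"
      using g(2)[of k] by (simp add: fourier_coeff_diff[OF gi ci] fourier_coeff_wave)
    moreover have "norm (fourier_coeff (\<lambda>x. g x - c) k) \<le> mean_on cell (\<lambda>x. norm (g x - c))"
    proof -
      have i: "cell_integrable (\<lambda>x. (g x - c) * wave (- k) x)"
        by (intro cell_integrable_mult_wave set_integral_diff gi ci)
      have "norm (LINT x:cell|lebesgue. (g x - c) * wave (- k) x)
          \<le> (LINT x:cell|lebesgue. norm ((g x - c) * wave (- k) x))"
        by (rule set_integral_norm_bound[OF i])
      then have "norm (LINT x:cell|lebesgue. (g x - c) * wave (- k) x) \<le> (LINT x:cell|lebesgue. norm (g x - c))"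
        by (simp add: norm_mult)
      then show ?thesis
        unfolding fourier_coeff_alt mean_on_def norm_divide norm_of_real measure_cell
        by (simp add: divide_right_mono divide_inverse[symmetric] field_simps)
    qed
    ultimately show ?thesis using mean by simp
  qed
  then show thesis using that by blast
qed

lemma A2_symbol_bounded:
  assumes "A2 m" "0 \<le> \<nu>"
  obtains B where "0 \<le> B" "\<And>i j k. norm (m \<nu> i j k) \<le> B"
proof -
  have "\<exists>B. \<forall>k. norm (m \<nu> i j k) \<le> B" for i j
  proof -
    have "bounded_Linf_BMO (m \<nu> i j)" using assms by (simp add: A2_def)
    then obtain B where "\<And>k. k \<noteq> 0 \<Longrightarrow> norm (m \<nu> i j k) \<le> B"
      using bounded_Linf_BMO_symbol by blast
    then show ?thesis by (intro exI[of _ "max B (norm (m \<nu> i j 0))"]) (metis max.coboundedI1 max.cobounded2)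
  qed
  then obtain b where b: "\<And>i j k. norm (m \<nu> i j k) \<le> b i j" by metis
  have b0: "0 \<le> b i j" for i j by (rule order_trans[OF norm_ge_zero b[of i j 0]])
  show thesis
  proof (rule that)
    show "0 \<le> (\<Sum>i\<in>UNIV. \<Sum>j\<in>UNIV. b i j)" by (intro sum_nonneg b0)
    fix i j k
    have "b i j \<le> (\<Sum>j\<in>UNIV. b i j)" by (rule member_le_sum) (auto simp: b0)
    also have "\<dots> \<le> (\<Sum>i\<in>UNIV. \<Sum>j\<in>UNIV. b i j)"
      by (rule member_le_sum[where f = "\<lambda>i. \<Sum>j\<in>UNIV. b i j"]) (auto simp: b0 intro!: sum_nonneg)
    finally show "norm (m \<nu> i j k) \<le> (\<Sum>i\<in>UNIV. \<Sum>j\<in>UNIV. b i j)" using b[of i j k] by linarith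
  qed
qed

lemma partial_cmult_wave: "partial i (\<lambda>x. c * wave k x) = (\<lambda>x. (c * (\<i> * of_int (k $ i))) * wave k x)"
  for k :: "int ^ 'n::finite"
  unfolding partial_def frechet_derivative_at[OF cis_has_derivative, symmetric]
  by (simp add: inner_axis)

lemma smooth_torus_wave: "smooth_torus (wave k)" for k :: "int ^ 'n::finite"
  unfolding smooth_torus_def
proof (intro conjI allI periodic_wave)
  fix "is" :: "'n list" and x
  have "\<exists>c. foldr partial is (wave k) = (\<lambda>x. c * wave k x)"
  proof (induction "is")
    case Nil show ?case by (auto intro: exI[of _ 1])
  next
    case (Cons i "is") then show ?case by (auto simp: partial_cmult_wave)
  qed
  then obtain c where "foldr partial is (wave k) = (\<lambda>x. c * wave k x)" ..
  then show "foldr partial is (wave k) differentiable at x"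
    using cis_has_derivative[of c k x UNIV] by (auto simp: differentiable_def)
qed

lemma mult_op_wave: "mult_op m (wave k) = (\<lambda>x. m k * wave k x)" for k :: "int ^ 'n::finite"
proof
  fix x
  have "mult_op m (wave k) x = (\<Sum>\<^sub>\<infinity>l\<in>{k}. m l * wave l x)"
    unfolding mult_op_def by (rule infsum_cong_neutral) (auto simp: fourier_coeff_wave)
  then show "mult_op m (wave k) x = m k * wave k x" by simp
qed

text \<open>The symbol of the operator that maps the scalar to the \<open>j\<close>-th velocity component.\<close>

definition vsym :: "'n::finite symbols \<Rightarrow> 'n \<Rightarrow> int ^ 'n \<Rightarrow> complex" where
  "vsym m j k = (\<Sum>i\<in>UNIV. \<i> * of_int (k $ i) * m i j k)"

text \<open>Testing the divergence-free condition on a single character turns it into an identity for the symbols.\<close>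

lemma A1_divergence_free:
  assumes "A1 m" "0 \<le> \<nu>"
  shows "(\<Sum>j\<in>UNIV. of_int (k $ j) * vsym (m \<nu>) j k) = 0"
proof -
  have "(\<Sum>i\<in>UNIV. \<Sum>j\<in>UNIV. partial i (partial j (mult_op (m \<nu> i j) (wave k))) 0) = 0"
    using assms smooth_torus_wave[of k] unfolding A1_def by blast
  then have "(\<Sum>i\<in>UNIV. \<Sum>j\<in>UNIV. m \<nu> i j k * (\<i> * of_int (k $ j)) * (\<i> * of_int (k $ i))) = 0"
    unfolding mult_op_wave partial_cmult_wave by simp
  also have "(\<Sum>i\<in>UNIV. \<Sum>j\<in>UNIV. m \<nu> i j k * (\<i> * of_int (k $ j)) * (\<i> * of_int (k $ i)))
      = (\<Sum>j\<in>UNIV. \<Sum>i\<in>UNIV. m \<nu> i j k * (\<i> * of_int (k $ j)) * (\<i> * of_int (k $ i)))"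
    by (rule sum.swap)
  also have "\<dots> = \<i> * (\<Sum>j\<in>UNIV. of_int (k $ j) * vsym (m \<nu>) j k)"
    by (simp add: vsym_def sum_distrib_left algebra_simps)
  finally show ?thesis by simp
qed

text \<open>Convergence of the operators on \<open>L\<^sup>2\<close>, tested on a character, is pointwise convergence of the symbols.\<close>

lemma A4_symbol_tendsto:
  assumes "A4 m"
  shows "((\<lambda>\<nu>. m \<nu> i j k) \<longlongrightarrow> m 0 i j k) (at_right 0)"
proof -
  have "L2_torus (wave k)"
    by (intro L2_torus_continuous periodic_wave continuous_intros)
  then have "((\<lambda>\<nu>. \<Sum>\<^sub>\<infinity>l. ennreal ((norm (m \<nu> i j l - m 0 i j l))\<^sup>2 * (norm (fourier_coeff (wave k) l))\<^sup>2)) \<longlongrightarrow> 0)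
      (at_right 0)"
    using assms unfolding A4_def by blast
  also have "(\<lambda>\<nu>. \<Sum>\<^sub>\<infinity>l. ennreal ((norm (m \<nu> i j l - m 0 i j l))\<^sup>2 * (norm (fourier_coeff (wave k) l))\<^sup>2))
      = (\<lambda>\<nu>. ennreal ((norm (m \<nu> i j k - m 0 i j k))\<^sup>2))"
  proof
    fix \<nu>
    have "(\<Sum>\<^sub>\<infinity>l. ennreal ((norm (m \<nu> i j l - m 0 i j l))\<^sup>2 * (norm (fourier_coeff (wave k) l))\<^sup>2))
        = (\<Sum>\<^sub>\<infinity>l\<in>{k}. ennreal ((norm (m \<nu> i j l - m 0 i j l))\<^sup>2))"
      by (rule infsum_cong_neutral) (auto simp: fourier_coeff_wave)
    then show "(\<Sum>\<^sub>\<infinity>l. ennreal ((norm (m \<nu> i j l - m 0 i j l))\<^sup>2 * (norm (fourier_coeff (wave k) l))\<^sup>2))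
      = ennreal ((norm (m \<nu> i j k - m 0 i j k))\<^sup>2)" by simp
  qed
  finally have "((\<lambda>\<nu>. (norm (m \<nu> i j k - m 0 i j k))\<^sup>2) \<longlongrightarrow> 0) (at_right 0)"
    by (simp add: ennreal_0[symmetric] del: ennreal_0)
  from tendsto_real_sqrt[OF this] have "((\<lambda>\<nu>. m \<nu> i j k - m 0 i j k) \<longlongrightarrow> 0) (at_right 0)"
    by (simp add: tendsto_norm_zero_iff)
  then show ?thesis by (rule LIM_zero_cancel)
qed

lemma vsym_tendsto:
  assumes "A4 m"
  shows "((\<lambda>\<nu>. vsym (m \<nu>) j k) \<longlongrightarrow> vsym (m 0) j k) (at_right 0)"
  unfolding vsym_def by (intro tendsto_intros A4_symbol_tendsto assms)

lemma norm_vsym_le_bracket: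
  fixes m :: "'n::finite symbols" and B :: real
  assumes "\<And>i j k. norm (m i j k) \<le> B"
  shows "norm (vsym m j k) \<le> CARD('n) * B * bracket k"
proof -
  have "norm (vsym m j k) \<le> (\<Sum>i\<in>(UNIV::'n set). B * bracket k)"
    unfolding vsym_def
  proof (rule sum_norm_le)
    fix i
    have "norm (m i j k) * \<bar>real_of_int (k $ i)\<bar> \<le> B * bracket k"
      using assms[of i j k] abs_component_le_bracket[of k i] order_trans[OF norm_ge_zero assms[of i j k]]
      by (intro mult_mono) auto
    then show "norm (\<i> * of_int (k $ i) * m i j k) \<le> B * bracket k" by (simp add: norm_mult mult.commute)
  qed
  then show ?thesis by simp
qed

lemma norm_vsym_le:
  fixes m :: "'n::finite symbols" and C :: real
  assumes "\<And>i j k. norm (of_int (k $ i) * m i j k) \<le> C"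
  shows "norm (vsym m j k) \<le> CARD('n) * C"
proof -
  have "norm (vsym m j k) \<le> (\<Sum>i\<in>(UNIV::'n set). C)"
    unfolding vsym_def by (rule sum_norm_le) (use assms in \<open>simp add: norm_mult\<close>)
  then show ?thesis by simp
qed

section \<open>Velocity and advection of a regular scalar\<close>

text \<open>
  The class in which scalar, gradient and velocity are all given pointwise by their Fourier series.
  It contains the Sobolev and the Gevrey solutions at every time.
\<close>

definition regular :: "(real ^ 'n::finite \<Rightarrow> real) \<Rightarrow> bool" where
  "regular f \<longleftrightarrow> periodic f \<and> (\<forall>x. f differentiable (at x)) \<and> w1 (fourier_coeff (cx f)) summable_on UNIV"

lemma regular_continuous:
  assumes "regular f"
  shows "continuous_on S f"
proof -
  have "f differentiable_on S"
    using assms by (auto simp: regular_def differentiable_on_def intro: differentiable_at_withinI)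
  then show ?thesis by (rule differentiable_imp_continuous_on)
qed

lemma regular_series:
  assumes "regular f"
  shows "cx f x = (\<Sum>\<^sub>\<infinity>k. fourier_coeff (cx f) k * wave k x)"
  using assms regular_continuous[OF assms]
  by (intro fourier_inversion w1_norm_summable continuous_intros) (auto simp: regular_def periodic_def)

lemma regular_partial:
  assumes "regular f"
  shows "cx (partial j f) x = (\<Sum>\<^sub>\<infinity>k. (\<i> * of_int (k $ j) * fourier_coeff (cx f) k) * wave k x)"
proof -
  have d: "(f has_derivative frechet_derivative f (at x)) (at x)"
    using assms by (simp add: regular_def frechet_derivative_works[symmetric])
  have "(cx f has_derivative (\<lambda>h. of_real (frechet_derivative f (at x) h))) (at x)"
    by (rule bounded_linear.has_derivative[OF bounded_linear_of_real d])
  then have "frechet_derivative (cx f) (at x) = (\<lambda>h. of_real (frechet_derivative f (at x) h))"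
    by (rule frechet_derivative_at[symmetric])
  then have "cx (partial j f) x = partial j (cx f) x" by (simp add: partial_def)
  also have "cx f = (\<lambda>x. \<Sum>\<^sub>\<infinity>k. fourier_coeff (cx f) k * wave k x)"
    by (rule ext) (rule regular_series[OF assms])
  also have "partial j \<dots> x = (\<Sum>\<^sub>\<infinity>k. (\<i> * of_int (k $ j) * fourier_coeff (cx f) k) * wave k x)"
    using assms by (intro partial_fourier_series) (simp add: regular_def)
  finally show ?thesis .
qed

lemma vsym_summable:
  fixes m :: "'n::finite symbols" and B :: real
  assumes a: "w1 a summable_on UNIV" and B: "\<And>i j k. norm (m i j k) \<le> B"
  shows "(\<lambda>k. norm (vsym m j k * a k)) summable_on UNIV"
    and "(\<Sum>\<^sub>\<infinity>k. norm (vsym m j k * a k)) \<le> CARD('n) * B * infsum (w1 a) UNIV"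
proof -
  have le: "norm (vsym m j k * a k) \<le> CARD('n) * B * w1 a k" for k
  proof -
    have "norm (vsym m j k) \<le> CARD('n) * B * bracket k" by (rule norm_vsym_le_bracket[OF B])
    from mult_right_mono[OF this, of "norm (a k)"] show ?thesis by (simp add: norm_mult w1_def mult.assoc)
  qed
  have sm: "(\<lambda>k. CARD('n) * B * w1 a k) summable_on UNIV" by (intro summable_on_cmult_right a)
  show s: "(\<lambda>k. norm (vsym m j k * a k)) summable_on UNIV"
    by (rule Infinite_Sum.abs_summable_on_comparison_test'[OF sm]) (rule le)
  have "(\<Sum>\<^sub>\<infinity>k. norm (vsym m j k * a k)) \<le> (\<Sum>\<^sub>\<infinity>k. CARD('n) * B * w1 a k)"
    by (rule infsum_mono[OF s sm]) (rule le)
  also have "\<dots> = CARD('n) * B * infsum (w1 a) UNIV" by (rule infsum_cmult_right) (rule a)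
  finally show "(\<Sum>\<^sub>\<infinity>k. norm (vsym m j k * a k)) \<le> CARD('n) * B * infsum (w1 a) UNIV" .
qed

lemma velocity_series:
  fixes m :: "'n::finite symbols" and B :: real
  assumes a: "w1 (fourier_coeff (cx f)) summable_on UNIV" and B: "\<And>i j k. norm (m i j k) \<le> B"
  shows "velocity m f j x = (\<Sum>\<^sub>\<infinity>k. (vsym m j k * fourier_coeff (cx f) k) * wave k x)"
proof -
  let ?a = "fourier_coeff (cx f)"
  have ma: "w1 (\<lambda>k. m i j k * ?a k) summable_on UNIV" for i
  proof (rule summable_on_comparison_test)
    show "(\<lambda>k. B * w1 ?a k) summable_on UNIV" by (intro summable_on_cmult_right a)
    show "w1 (\<lambda>k. m i j k * ?a k) k \<le> B * w1 ?a k" for k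
      using mult_right_mono[OF B[of i j k], of "bracket k * norm (?a k)"] by (simp add: w1_def norm_mult mult_ac)
  qed simp
  have p: "partial i (mult_op (m i j) (cx f)) x = (\<Sum>\<^sub>\<infinity>k. (\<i> * of_int (k $ i) * (m i j k * ?a k)) * wave k x)" for i
    unfolding mult_op_def by (rule partial_fourier_series[OF ma])
  have "velocity m f j x = (\<Sum>\<^sub>\<infinity>k. \<Sum>i\<in>UNIV. (\<i> * of_int (k $ i) * (m i j k * ?a k)) * wave k x)"
    unfolding velocity_def p
    by (intro infsum_finite_sum[symmetric] fourier_series_summable w1_derivative_summable ma finite)
  then show ?thesis by (simp add: vsym_def sum_distrib_right mult.assoc)
qed

definition advection :: "'n::finite symbols \<Rightarrow> (real ^ 'n \<Rightarrow> real) \<Rightarrow> real ^ 'n \<Rightarrow> complex" where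
  "advection m f x = (\<Sum>j\<in>UNIV. velocity m f j x * of_real (partial j f x))"

lemma norm_series_le:
  assumes "(\<lambda>k. norm (c k)) summable_on UNIV" "(\<Sum>\<^sub>\<infinity>k. norm (c k)) \<le> B"
  shows "norm (\<Sum>\<^sub>\<infinity>k. c k * wave k x) \<le> B"
proof -
  have "norm (\<Sum>\<^sub>\<infinity>k. c k * wave k x) \<le> (\<Sum>\<^sub>\<infinity>k. norm (c k * wave k x))"
    by (rule norm_infsum_bound) (use assms(1) in \<open>simp add: norm_mult\<close>)
  then show ?thesis using assms(2) by (simp add: norm_mult)
qed

lemma norm_gradient_sum_le:
  assumes "w1 a summable_on UNIV"
  shows "(\<Sum>\<^sub>\<infinity>k. norm (\<i> * of_int (k $ j) * a k)) \<le> infsum (w1 a) UNIV"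
proof (rule infsum_mono[OF w1_derivative_summable[OF assms] assms])
  show "norm (\<i> * of_int (k $ j) * a k) \<le> w1 a k" for k
    using mult_right_mono[OF abs_component_le_bracket[of k j], of "norm (a k)"] by (simp add: norm_mult w1_def)
qed

lemma regular_bounds:
  fixes m :: "'n::finite symbols" and B :: real
  assumes f: "regular f" and A: "infsum (w1 (fourier_coeff (cx f))) UNIV \<le> A"
    and B: "\<And>i j k. norm (m i j k) \<le> B"
  shows "\<bar>f x\<bar> \<le> A" "\<bar>partial j f x\<bar> \<le> A" "norm (velocity m f j x) \<le> CARD('n) * B * A"
    "norm (advection m f x) \<le> (real CARD('n))\<^sup>2 * B * A\<^sup>2"
proof -
  let ?a = "fourier_coeff (cx f)"
  have a: "w1 ?a summable_on UNIV" using f by (simp add: regular_def)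
  have B0: "0 \<le> B" by (rule order_trans[OF norm_ge_zero B[of undefined undefined 0]])
  have "norm (cx f x) \<le> A"
    unfolding regular_series[OF f, of x]
  proof (rule norm_series_le[OF w1_norm_summable[OF a]])
    have "(\<Sum>\<^sub>\<infinity>k. norm (?a k)) \<le> infsum (w1 ?a) UNIV"
      by (rule infsum_mono[OF w1_norm_summable[OF a] a]) (rule norm_le_w1)
    then show "(\<Sum>\<^sub>\<infinity>k. norm (?a k)) \<le> A" using A by linarith
  qed
  then show "\<bar>f x\<bar> \<le> A" by simp
  have A0: "0 \<le> A" using \<open>\<bar>f x\<bar> \<le> A\<close> by linarith
  have "norm (cx (partial j f) x) \<le> A" for j
    unfolding regular_partial[OF f]
    by (rule norm_series_le[OF w1_derivative_summable[OF a] order_trans[OF norm_gradient_sum_le[OF a] A]])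
  then have p: "\<bar>partial j f x\<bar> \<le> A" for j by simp
  then show "\<bar>partial j f x\<bar> \<le> A" .
  have v: "norm (velocity m f j x) \<le> CARD('n) * B * A" for j
    unfolding velocity_series[OF a B]
    by (rule norm_series_le[OF vsym_summable(1)[OF a B] order_trans[OF vsym_summable(2)[OF a B]]])
       (use A B0 in \<open>auto intro!: mult_left_mono\<close>)
  then show "norm (velocity m f j x) \<le> CARD('n) * B * A" .
  have "norm (advection m f x) \<le> (\<Sum>j\<in>(UNIV::'n set). CARD('n) * B * A * A)"
    unfolding advection_def
  proof (rule sum_norm_le)
    fix j
    show "norm (velocity m f j x * of_real (partial j f x)) \<le> CARD('n) * B * A * A"
      unfolding norm_mult using v[of j] p[of j] A0 B0 by (intro mult_mono) auto
  qed
  then show "norm (advection m f x) \<le> (real CARD('n))\<^sup>2 * B * A\<^sup>2"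
    by (simp add: power2_eq_square algebra_simps)
qed

lemma advection_continuous:
  fixes m :: "'n::finite symbols" and B :: real
  assumes f: "regular f" and B: "\<And>i j k. norm (m i j k) \<le> B"
  shows "continuous_on S (advection m f)"
proof -
  have a: "w1 (fourier_coeff (cx f)) summable_on UNIV" using f by (simp add: regular_def)
  have v: "continuous_on S (velocity m f j)" for j
    unfolding velocity_series[OF a B, abs_def] by (rule continuous_fourier_series[OF vsym_summable(1)[OF a B]])
  have p: "continuous_on S (cx (partial j f))" for j
    unfolding regular_partial[OF f, abs_def] by (rule continuous_fourier_series[OF w1_derivative_summable[OF a]])
  show ?thesis unfolding advection_def[abs_def] by (intro continuous_on_sum continuous_on_mult v p)
qed

text \<open>
  The bridge between the equation in physical space and \<open>transport\<close>: the velocity components and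
  the partial derivatives are absolutely convergent series, so their products become convolutions.
\<close>

lemma fourier_coeff_advection:
  fixes m :: "'n::finite symbols" and B :: real
  assumes f: "regular f" and B: "\<And>i j k. norm (m i j k) \<le> B"
  defines "a \<equiv> fourier_coeff (cx f)"
  shows "fourier_coeff (advection m f) k = transport (\<lambda>j k. vsym m j k * a k) a k"
proof -
  have a: "w1 a summable_on UNIV" using f unfolding a_def regular_def by blast
  have v: "velocity m f j x = (\<Sum>\<^sub>\<infinity>k. (vsym m j k * a k) * wave k x)" for j x
    unfolding a_def by (rule velocity_series[OF a[unfolded a_def] B])
  have p: "cx (partial j f) x = (\<Sum>\<^sub>\<infinity>k. (\<i> * of_int (k $ j) * a k) * wave k x)" for j x
    unfolding a_def by (rule regular_partial[OF f])
  have vc: "continuous_on S (velocity m f j)" for j S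
    unfolding v[abs_def] by (rule continuous_fourier_series[OF vsym_summable(1)[OF a B]])
  have pc: "continuous_on S (cx (partial j f))" for j S
    unfolding p[abs_def] by (rule continuous_fourier_series[OF w1_derivative_summable[OF a]])
  have vk: "fourier_coeff (velocity m f j) l = vsym m j l * a l" for j l
    unfolding v[abs_def] by (rule fourier_coeff_series[OF vsym_summable(1)[OF a B]])
  have summand: "fourier_coeff (\<lambda>x. velocity m f j x * of_real (partial j f x)) k
      = (\<Sum>\<^sub>\<infinity>l. (vsym m j (k - l) * a (k - l)) * (\<i> * of_int (l $ j) * a l))" for j
    unfolding p vk[symmetric]
    by (rule fourier_coeff_product[OF w1_derivative_summable[OF a] vc])
       (rule regular_bounds(3)[OF f order_refl B])
  have sm: "(\<lambda>l. (vsym m j (k - l) * a (k - l)) * (\<i> * of_int (l $ j) * a l)) summable_on UNIV" for j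
  proof (rule abs_summable_summable, rule Infinite_Sum.abs_summable_on_comparison_test')
    let ?C = "CARD('n) * B * infsum (w1 a) UNIV"
    show "(\<lambda>l. ?C * norm (\<i> * of_int (l $ j) * a l)) summable_on UNIV"
      by (intro summable_on_cmult_right w1_derivative_summable a)
    fix l
    have "norm (vsym m j (k - l) * a (k - l)) = sum (\<lambda>k. norm (vsym m j k * a k)) {k - l}" by simp
    also have "\<dots> \<le> (\<Sum>\<^sub>\<infinity>k. norm (vsym m j k * a k))"
      by (rule finite_sum_le_infsum[OF vsym_summable(1)[OF a B]]) auto
    also have "\<dots> \<le> ?C" by (rule vsym_summable(2)[OF a B])
    finally show "norm ((vsym m j (k - l) * a (k - l)) * (\<i> * of_int (l $ j) * a l)) \<le> ?C * norm (\<i> * of_int (l $ j) * a l)"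
      unfolding norm_mult[of "vsym m j (k - l) * a (k - l)"] by (rule mult_right_mono) simp
  qed
  have "fourier_coeff (advection m f) k
      = (\<Sum>j\<in>UNIV. fourier_coeff (\<lambda>x. velocity m f j x * of_real (partial j f x)) k)"
    unfolding advection_def[abs_def]
    by (rule fourier_coeff_sum[THEN conjunct2]) (auto intro!: cell_integrable_continuous continuous_on_mult vc pc)
  also have "\<dots> = (\<Sum>\<^sub>\<infinity>l. \<Sum>j\<in>UNIV. (vsym m j (k - l) * a (k - l)) * (\<i> * of_int (l $ j) * a l))"
    unfolding summand by (intro infsum_finite_sum[symmetric] sm finite)
  also have "\<dots> = transport (\<lambda>j k. vsym m j k * a k) a k"
    unfolding transport_def transport_term_def by (simp add: sum_distrib_right mult.assoc)
  finally show ?thesis .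
qed

section \<open>The evolution of the Fourier coefficients\<close>

lemma AS_solution_derivative:
  assumes sol: "AS_solution m \<theta>0 S T \<theta>" and t: "t \<in> {0..T}"
  shows "((\<lambda>t. \<theta> t x) has_real_derivative S x - Re (advection m (\<theta> t) x)) (at t within {0..T})"
    and "cx S x - advection m (\<theta> t) x = of_real (S x - Re (advection m (\<theta> t) x))"
proof -
  obtain D where D: "((\<lambda>t. \<theta> t x) has_real_derivative D) (at t within {0..T})"
    "complex_of_real D + advection m (\<theta> t) x = complex_of_real (S x)"
    using sol t unfolding AS_solution_def advection_def by blast
  have "Re (complex_of_real D + advection m (\<theta> t) x) = S x" unfolding D(2) by simp
  then have DS: "D = S x - Re (advection m (\<theta> t) x)" by simp
  show "((\<lambda>t. \<theta> t x) has_real_derivative S x - Re (advection m (\<theta> t) x)) (at t within {0..T})"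
    using D(1) by (simp only: DS)
  have "cx S x - advection m (\<theta> t) x = of_real D" using D(2) by (simp add: algebra_simps)
  then show "cx S x - advection m (\<theta> t) x = of_real (S x - Re (advection m (\<theta> t) x))" by (simp only: DS)
qed

text \<open>
  The forcing is bounded by virtue of the equation: at some time between \<open>0\<close> and \<open>T\<close> the time
  derivative of the solution equals its difference quotient over \<open>[0, T]\<close>.
\<close>

lemma AS_solution_bounds:
  fixes m :: "'n::finite symbols" and B :: real
  assumes sol: "AS_solution m \<theta>0 S T \<theta>" and T: "0 < T"
    and reg: "\<And>t. t \<in> {0..T} \<Longrightarrow> regular (\<theta> t) \<and> infsum (w1 (fourier_coeff (cx (\<theta> t)))) UNIV \<le> A"
    and B: "\<And>i j k. norm (m i j k) \<le> B"
  defines "L \<equiv> (real CARD('n))\<^sup>2 * B * A\<^sup>2"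
  shows "\<bar>S x\<bar> \<le> L + 2 * A / T"
    and "t \<in> {0..T} \<Longrightarrow> t' \<in> {0..T} \<Longrightarrow> \<bar>\<theta> t x - \<theta> t' x\<bar> \<le> (2 * L + 2 * A / T) * \<bar>t - t'\<bar>"
proof -
  have adv: "\<bar>Re (advection m (\<theta> t) x)\<bar> \<le> L" if "t \<in> {0..T}" for t x
  proof -
    have "norm (advection m (\<theta> t) x) \<le> L"
      unfolding L_def by (rule regular_bounds(4)[OF _ _ B]) (use reg[OF that] in auto)
    then show ?thesis using abs_Re_le_cmod[of "advection m (\<theta> t) x"] by linarith
  qed
  have th: "\<bar>\<theta> t x\<bar> \<le> A" if "t \<in> {0..T}" for t x
    by (rule regular_bounds(1)[OF _ _ B]) (use reg[OF that] in auto)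
  have S: "\<bar>S x\<bar> \<le> L + 2 * A / T" for x
  proof -
    have "\<exists>\<xi>\<in>{0..T}. \<theta> T x - \<theta> 0 x = (\<lambda>h. (S x - Re (advection m (\<theta> \<xi>) x)) * h) (T - 0)"
      by (rule mvt_very_simple)
         (use T AS_solution_derivative(1)[OF sol] in \<open>auto simp: has_field_derivative_def\<close>)
    then obtain \<xi> where \<xi>: "\<xi> \<in> {0..T}" "\<theta> T x - \<theta> 0 x = (S x - Re (advection m (\<theta> \<xi>) x)) * T" by auto
    then have "S x = Re (advection m (\<theta> \<xi>) x) + (\<theta> T x - \<theta> 0 x) / T" using T by (simp add: field_simps)
    also have "\<bar>\<dots>\<bar> \<le> \<bar>Re (advection m (\<theta> \<xi>) x)\<bar> + \<bar>(\<theta> T x - \<theta> 0 x) / T\<bar>" by (rule abs_triangle_ineq)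
    also have "\<bar>(\<theta> T x - \<theta> 0 x) / T\<bar> = \<bar>\<theta> T x - \<theta> 0 x\<bar> / T" using T by simp
    also have "\<dots> \<le> (2 * A) / T" using th[of T x] th[of 0 x] T by (intro divide_right_mono) auto
    finally show ?thesis using adv[OF \<xi>(1), of x] by simp
  qed
  then show "\<bar>S x\<bar> \<le> L + 2 * A / T" .
  assume t: "t \<in> {0..T}" "t' \<in> {0..T}"
  have "norm (\<theta> t x - \<theta> t' x) \<le> (2 * L + 2 * A / T) * norm (t - t')"
  proof (rule field_differentiable_bound[where S = "{0..T}" and f = "\<lambda>t. \<theta> t x"])
    show "((\<lambda>t. \<theta> t x) has_field_derivative S x - Re (advection m (\<theta> z) x)) (at z within {0..T})"
      if "z \<in> {0..T}" for z by (rule AS_solution_derivative(1)[OF sol that])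
    show "norm (S x - Re (advection m (\<theta> z) x)) \<le> 2 * L + 2 * A / T" if "z \<in> {0..T}" for z
      using S[of x] adv[OF that, of x] by simp
  qed (use t in auto)
  then show "\<bar>\<theta> t x - \<theta> t' x\<bar> \<le> (2 * L + 2 * A / T) * \<bar>t - t'\<bar>" by simp
qed

lemma has_vector_derivative_of_quotient:
  fixes f :: "real \<Rightarrow> complex"
  assumes "((\<lambda>y. (f y - f t) / of_real (y - t)) \<longlongrightarrow> D) (at t within X)"
  shows "(f has_vector_derivative D) (at t within X)"
  unfolding has_vector_derivative_def has_derivative_within
proof (intro conjI bounded_linear_scaleR_left)
  have "((\<lambda>y. norm ((f y - f t) / of_real (y - t) - D)) \<longlongrightarrow> 0) (at t within X)"
    using assms by (intro tendsto_norm_zero LIM_zero)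
  moreover have "eventually (\<lambda>y. norm ((f y - f t) / of_real (y - t) - D)
      = norm ((1 / norm (y - t)) *\<^sub>R (f y - (f t + (y - t) *\<^sub>R D)))) (at t within X)"
    unfolding eventually_at_filter
  proof (intro always_eventually allI impI)
    fix y assume "y \<noteq> t"
    then have "(f y - f t) / of_real (y - t) - D = (f y - (f t + (y - t) *\<^sub>R D)) / of_real (y - t)"
      by (simp add: field_simps scaleR_conv_of_real)
    then show "norm ((f y - f t) / of_real (y - t) - D) = norm ((1 / norm (y - t)) *\<^sub>R (f y - (f t + (y - t) *\<^sub>R D)))"
      by (simp add: norm_divide del: of_real_diff)
  qed
  ultimately have "((\<lambda>y. norm ((1 / norm (y - t)) *\<^sub>R (f y - (f t + (y - t) *\<^sub>R D)))) \<longlongrightarrow> 0) (at t within X)"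
    by (rule Lim_transform_eventually)
  then show "((\<lambda>y. (1 / norm (y - t)) *\<^sub>R (f y - (f t + (y - t) *\<^sub>R D))) \<longlongrightarrow> 0) (at t within X)"
    by (rule tendsto_norm_zero_cancel)
qed

text \<open>
  Differentiation under the integral sign: the difference quotients in time are bounded uniformly
  in space, so dominated convergence applies along every sequence of times.
\<close>

lemma fourier_coeff_ode:
  fixes m :: "'n::finite symbols" and B :: real
  assumes sol: "AS_solution m \<theta>0 S T \<theta>" and T: "0 < T"
    and reg: "\<And>t. t \<in> {0..T} \<Longrightarrow> regular (\<theta> t) \<and> infsum (w1 (fourier_coeff (cx (\<theta> t)))) UNIV \<le> A"
    and B: "\<And>i j k. norm (m i j k) \<le> B" and S: "cell_integrable (cx S)"
  defines "a \<equiv> \<lambda>t. fourier_coeff (cx (\<theta> t))"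
  assumes t: "t \<in> {0..T}"
  shows "((\<lambda>t. a t k) has_vector_derivative
      (fourier_coeff (cx S) k - transport (\<lambda>j k. vsym m j k * a t k) (a t) k)) (at t within {0..T})"
proof (rule has_vector_derivative_of_quotient)
  define D where "D = (\<lambda>x. S x - Re (advection m (\<theta> t) x))"
  have D: "cx D x = cx S x - advection m (\<theta> t) x" for x
    unfolding D_def by (rule AS_solution_derivative(2)[OF sol t, symmetric])
  have regt: "regular (\<theta> t)" using reg[OF t] by simp
  have ai: "cell_integrable (advection m (\<theta> t))"
    by (intro cell_integrable_continuous advection_continuous[OF regt B])
  have Di: "cell_integrable (cx D)" unfolding D by (intro set_integral_diff S ai)
  have Dk: "fourier_coeff (cx D) k = fourier_coeff (cx S) k - transport (\<lambda>j k. vsym m j k * a t k) (a t) k"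
    unfolding D fourier_coeff_diff[OF S ai] a_def by (simp only: fourier_coeff_advection[OF regt B])
  have thi: "cell_integrable (cx (\<theta> t))" if "t \<in> {0..T}" for t
    by (intro cell_integrable_continuous continuous_intros regular_continuous) (use reg[OF that] in blast)
  define L where "L = 2 * ((real CARD('n))\<^sup>2 * B * A\<^sup>2) + 2 * A / T"
  show "((\<lambda>y. (a y k - a t k) / of_real (y - t)) \<longlongrightarrow>
      fourier_coeff (cx S) k - transport (\<lambda>j k. vsym m j k * a t k) (a t) k) (at t within {0..T})"
    unfolding Dk[symmetric] tendsto_at_iff_sequentially
  proof (intro allI impI)
    fix X :: "nat \<Rightarrow> real" assume X: "\<forall>i. X i \<in> {0..T} - {t}" "X \<longlonglongrightarrow> t"
    define q where "q = (\<lambda>i x. (\<theta> (X i) x - \<theta> t x) / (X i - t))"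
    have qc: "cx (q i) = (\<lambda>x. (1 / of_real (X i - t)) * (cx (\<theta> (X i)) x - cx (\<theta> t) x))" for i
      by (simp add: q_def fun_eq_iff)
    have qi: "cell_integrable (cx (q i))" for i
      unfolding qc using X(1) by (intro set_integrable_mult_right set_integral_diff thi t impI) blast+
    have qk: "fourier_coeff (cx (q i)) k = (a (X i) k - a t k) / of_real (X i - t)" for i
      unfolding qc fourier_coeff_cmult a_def
      by (subst fourier_coeff_diff) (use X(1) t thi in auto)
    have bound: "\<bar>q i x\<bar> \<le> L" for i x
    proof -
      have "\<bar>\<theta> (X i) x - \<theta> t x\<bar> \<le> L * \<bar>X i - t\<bar>"
        unfolding L_def using X(1) t by (intro AS_solution_bounds(2)[OF sol T reg B]) auto
      moreover have "\<bar>X i - t\<bar> > 0" using X(1) by auto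
      ultimately show ?thesis by (simp add: q_def pos_divide_le_eq)
    qed
    have lim: "(\<lambda>i. q i x) \<longlonglongrightarrow> D x" for x
    proof -
      have "((\<lambda>y. (\<theta> y x - \<theta> t x) / (y - t)) \<longlongrightarrow> D x) (at t within {0..T})"
        using AS_solution_derivative(1)[OF sol t] unfolding has_field_derivative_iff D_def .
      then show ?thesis using X unfolding tendsto_at_iff_sequentially by (auto simp: o_def q_def)
    qed
    have "(\<lambda>i. LINT x|lebesgue. indicator cell x *\<^sub>R (cx (q i) x * wave (- k) x))
        \<longlonglongrightarrow> (LINT x|lebesgue. indicator cell x *\<^sub>R (cx D x * wave (- k) x))"
    proof (rule integral_dominated_convergence[where w = "\<lambda>x. indicator cell x *\<^sub>R L"])
      show "(\<lambda>x. indicator cell x *\<^sub>R (cx D x * wave (- k) x)) \<in> borel_measurable lebesgue"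
        using cell_integrable_mult_wave[OF Di, of "- k"] unfolding set_integrable_def by (rule borel_measurable_integrable)
      show "(\<lambda>x. indicator cell x *\<^sub>R (cx (q i) x * wave (- k) x)) \<in> borel_measurable lebesgue" for i
        using cell_integrable_mult_wave[OF qi, of i "- k"] unfolding set_integrable_def by (rule borel_measurable_integrable)
      have "cell_integrable (\<lambda>x::real^'n. L)" by (intro cell_integrable_continuous continuous_intros)
      then show "integrable lebesgue (\<lambda>x::real^'n. indicator cell x *\<^sub>R L)" by (simp add: set_integrable_def)
      show "AE x in lebesgue. (\<lambda>i. indicator cell x *\<^sub>R (cx (q i) x * wave (- k) x))
          \<longlonglongrightarrow> indicator cell x *\<^sub>R (cx D x * wave (- k) x)"
        by (intro AE_I2 tendsto_intros lim)
      show "AE x in lebesgue. norm (indicator cell x *\<^sub>R (cx (q i) x * wave (- k) x)) \<le> indicator cell x *\<^sub>R L" for i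
        by (intro AE_I2) (use bound in \<open>auto simp: norm_mult indicator_def\<close>)
    qed
    then have "(\<lambda>i. fourier_coeff (cx (q i)) k) \<longlonglongrightarrow> fourier_coeff (cx D) k"
      unfolding fourier_coeff_alt set_lebesgue_integral_def by (intro tendsto_divide tendsto_const) auto
    then show "((\<lambda>y. (a y k - a t k) / of_real (y - t)) \<circ> X) \<longlonglongrightarrow> fourier_coeff (cx D) k"
      by (simp only: qk o_def)
  qed
qed

section \<open>Convergence in Sobolev spaces\<close>

lemma bracket_powr_dominates:
  fixes p e :: real
  assumes "0 < p" "0 < e"
  shows "\<exists>F. finite F \<and> (\<forall>k::int ^ 'n::finite. k \<notin> F \<longrightarrow> 1 \<le> e * bracket k powr p)"
proof (intro exI conjI allI impI)
  let ?N = "(1 / e) powr (1 / p)"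
  show "finite (modes ?N :: (int ^ 'n) set)" by simp
  fix k :: "int ^ 'n" assume "k \<notin> modes ?N"
  then have "?N \<le> bracket k" by (simp add: modes_def)
  then have "?N powr p \<le> bracket k powr p" using assms by (intro powr_mono2) auto
  then have "1 / e \<le> bracket k powr p" using assms by (simp add: powr_powr)
  then show "1 \<le> e * bracket k powr p" using assms by (simp add: field_simps)
qed

text \<open>
  At the first time at which \<open>f\<close> equals 1, the hypothesis \<open>step\<close> would give \<open>f < 1\<close>.
\<close>

lemma continuous_bootstrap:
  fixes f :: "real \<Rightarrow> real"
  assumes f: "continuous_on {0..T} f" and step: "\<And>t. t \<in> {0..T} \<Longrightarrow> (\<And>u. u \<in> {0..t} \<Longrightarrow> f u \<le> 1) \<Longrightarrow> f t < 1"
    and init: "f 0 \<le> 1" and t: "t \<in> {0..T}"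
  shows "f t \<le> 1"
proof (rule ccontr)
  assume "\<not> f t \<le> 1"
  then have gt: "1 < f t" by simp
  have ivt: "\<exists>u\<in>{0..v}. f u = 1" if "v \<in> {0..T}" "1 \<le> f v" for v
    using IVT'[of f 0 1 v] that init continuous_on_subset[OF f, of "{0..v}"] by auto
  define X where "X = {u \<in> {0..T}. f u = 1}"
  have "X \<noteq> {}" using ivt[OF t] gt t by (fastforce simp: X_def)
  moreover have "compact X"
  proof -
    have "closed X" unfolding X_def
      by (rule continuous_closed_preimage_constant[OF f closed_atLeastAtMost])
    moreover have "bounded X" by (rule bounded_subset[of "{0..T}"]) (auto simp: X_def)
    ultimately show ?thesis by (simp add: compact_eq_bounded_closed)
  qed
  ultimately have "\<exists>v\<in>X. \<forall>u\<in>X. v \<le> u" by (intro compact_attains_inf)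
  then obtain v where v: "v \<in> X" "\<And>u. u \<in> X \<Longrightarrow> v \<le> u" by auto
  have "f v < 1"
  proof (rule step)
    show "v \<in> {0..T}" using v(1) by (simp add: X_def)
    fix u assume u: "u \<in> {0..v}"
    show "f u \<le> 1"
    proof (rule ccontr)
      assume n: "\<not> f u \<le> 1"
      then obtain u' where u': "u' \<in> {0..u}" "f u' = 1" using ivt[of u] u v(1) by (auto simp: X_def)
      then have "u' \<in> X" using u v(1) by (auto simp: X_def)
      then have "v \<le> u'" by (rule v(2))
      then have "u' = u" using u u' by auto
      then show False using n u' by simp
    qed
  qed
  then show False using v(1) by (simp add: X_def)
qed

text \<open>The \<open>w1\<close> norm is a uniform limit of finite sums on sets that are bounded in \<open>H\<^sup>s\<close>.\<close>

lemma w1_sum_continuous: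
  fixes \<phi> :: "real \<Rightarrow> int ^ 'n::finite \<Rightarrow> complex"
  assumes s: "s > CARD('n) / 2 + 1"
    and hs: "\<And>t. t \<in> X \<Longrightarrow> hs_le s M (\<phi> t)" and cont: "\<And>k. continuous_on X (\<lambda>t. \<phi> t k)"
  shows "continuous_on X (\<lambda>t. infsum (w1 (\<phi> t)) UNIV)"
proof (rule uniform_limit_theorem)
  show "uniform_limit X (\<lambda>G t. \<Sum>k\<in>G. w1 (\<phi> t) k) (\<lambda>t. infsum (w1 (\<phi> t)) UNIV) (finite_subsets_at_top UNIV)"
  proof (rule uniform_limitI)
    fix e :: real assume e: "e > 0"
    obtain F :: "(int ^ 'n) set" where F: "finite F"
      "\<And>a G. hs_le s M a \<Longrightarrow> finite G \<Longrightarrow> G \<inter> F = {} \<Longrightarrow> (\<Sum>k\<in>G. w1 a k) \<le> e / 2"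
      using w1_uniform_tail[OF s, of "e / 2" M] e by auto
    have "eventually (\<lambda>G. finite G \<and> F \<subseteq> G) (finite_subsets_at_top UNIV)"
      unfolding eventually_finite_subsets_at_top using F(1) by (intro exI[of _ F]) auto
    then show "\<forall>\<^sub>F G in finite_subsets_at_top UNIV. \<forall>t\<in>X. dist (\<Sum>k\<in>G. w1 (\<phi> t) k) (infsum (w1 (\<phi> t)) UNIV) < e"
    proof eventually_elim
      case (elim G)
      show ?case
      proof
        fix t assume t: "t \<in> X"
        have sm: "w1 (\<phi> t) summable_on UNIV" using w1_bounded[OF s, of M] hs[OF t] by blast
        have "infsum (w1 (\<phi> t)) UNIV \<le> sum (w1 (\<phi> t)) G + e / 2"
        proof (rule nonneg_infsum_leI)
          fix H :: "(int ^ 'n) set" assume H: "finite H"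
          have "sum (w1 (\<phi> t)) H \<le> sum (w1 (\<phi> t)) (G \<union> (H - G))" using H elim by (intro sum_mono2) auto
          also have "\<dots> = sum (w1 (\<phi> t)) G + sum (w1 (\<phi> t)) (H - G)"
            using H elim by (intro sum.union_disjoint) auto
          also have "sum (w1 (\<phi> t)) (H - G) \<le> e / 2" using H elim t by (intro F(2) hs) auto
          finally show "sum (w1 (\<phi> t)) H \<le> sum (w1 (\<phi> t)) G + e / 2" by simp
        qed simp
        moreover have "sum (w1 (\<phi> t)) G \<le> infsum (w1 (\<phi> t)) UNIV"
          using elim by (intro finite_sum_le_infsum sm) auto
        ultimately show "dist (sum (w1 (\<phi> t)) G) (infsum (w1 (\<phi> t)) UNIV) < e"
          using e by (simp add: dist_real_def)
      qed
    qed
  qed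
qed (auto simp: w1_def intro!: always_eventually continuous_intros cont)

text \<open>
  The bounds on \<open>\<theta> \<nu>\<close> in \<open>H\<^sup>s\<close> that are given may depend on \<open>\<nu>\<close>, so a bootstrap is run on the
  condition that the \<open>w1\<close> norm of the difference is at most 1. As long as it holds,
  \<open>sobolev_growth\<close> bounds the \<open>H\<^sup>s\<close> norm of \<open>\<theta> \<nu>\<close> uniformly and \<open>L2_stability\<close> makes the
  difference small in \<open>L\<^sup>2\<close>; interpolation between the two then improves the bound 1 to 1/2.
\<close>

lemma sobolev_differences_vanish:
  fixes m :: "real \<Rightarrow> 'n::finite symbols"
  assumes A1: "A1 m" and A2: "A2 m" and A4: "A4 m" and A5: "A5_2 m"
    and s: "s > CARD('n) / 2 + 1" and T: "0 < T"
    and th0: "sobolev_space s (cx \<theta>0)" and S: "sobolev_space s (cx S)"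
    and sol: "\<And>\<nu>. 0 \<le> \<nu> \<Longrightarrow> sobolev_solution (m \<nu>) \<theta>0 S s T (\<theta> \<nu>)"
  shows "\<exists>M. \<forall>\<epsilon>>0. eventually (\<lambda>\<nu>. \<forall>t\<in>{0..T}.
      hs_le s M (\<lambda>k. fourier_coeff (cx (\<theta> \<nu> t)) k - fourier_coeff (cx (\<theta> 0 t)) k) \<and>
      hs_le 0 \<epsilon> (\<lambda>k. fourier_coeff (cx (\<theta> \<nu> t)) k - fourier_coeff (cx (\<theta> 0 t)) k)) (at_right 0)"
proof -
  define n where "n = real CARD('n)"
  have n: "1 \<le> n" by (simp add: n_def Suc_leI)
  have s1: "1 \<le> s" using s by (simp add: le_less_trans less_imp_le)
  define a where "a = (\<lambda>\<nu> t. fourier_coeff (cx (\<theta> \<nu> t)))"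
  define U where "U = (\<lambda>\<nu> t j k. vsym (m \<nu>) j k * a \<nu> t k)"
  obtain C0 where C0: "C0 > 0" "\<And>\<nu> i j k. 0 \<le> \<nu> \<Longrightarrow> \<nu> \<le> 1 \<Longrightarrow> norm (of_int (k $ i) * m \<nu> i j k) \<le> C0"
  proof -
    from A5 obtain C0 where "C0 > 0" and C: "\<And>i j. (\<forall>\<nu>\<in>{0<..1}. \<forall>k. norm (of_int (k $ i) * m \<nu> i j k) \<le> C0) \<and>
       (\<forall>k. norm (of_int (k $ i) * m 0 i j k) \<le> C0)"
      unfolding A5_2_def by blast
    then show thesis using that[of C0] by (metis greaterThanAtMost_iff order_le_less)
  qed
  define c where "c = n * (n * C0)"
  have c: "0 \<le> c" using n C0 by (simp add: c_def)
  have vs: "norm (vsym (m \<nu>) j k) \<le> n * C0" if "0 \<le> \<nu>" "\<nu> \<le> 1" for \<nu> j k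
    unfolding n_def by (rule norm_vsym_le) (rule C0(2)[OF that])
  have speed: "speed (U \<nu> t) k \<le> c * norm (a \<nu> t k)" if "0 \<le> \<nu>" "\<nu> \<le> 1" for \<nu> t k
  proof -
    have "speed (U \<nu> t) k \<le> (\<Sum>j\<in>(UNIV::'n set). (n * C0) * norm (a \<nu> t k))"
      unfolding speed_def U_def norm_mult by (intro sum_mono mult_right_mono vs that) auto
    then show ?thesis by (simp add: c_def n_def mult.assoc)
  qed
  have divfree: "(\<Sum>j\<in>UNIV. of_int (k $ j) * U \<nu> t j k) = 0" if "0 \<le> \<nu>" for \<nu> t k
    using A1_divergence_free[OF A1 that, of k]
    by (simp add: U_def mult.assoc[symmetric] sum_distrib_right[symmetric])
  have real: "a \<nu> t (- k) = cnj (a \<nu> t k)" for \<nu> t k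
    unfolding a_def by (rule fourier_coeff_cnj)
  have AS: "AS_solution (m \<nu>) \<theta>0 S T (\<theta> \<nu>)" if "0 \<le> \<nu>" for \<nu>
    using sol[OF that] by (simp add: sobolev_solution_def)
  have hs_ex: "\<exists>M. \<forall>t\<in>{0..T}. hs_le s M (a \<nu> t)" if "0 \<le> \<nu>" for \<nu>
    using sol[OF that] hs_le_of_sobolev unfolding sobolev_solution_def a_def by blast
  then obtain M where M: "\<And>\<nu> t. 0 \<le> \<nu> \<Longrightarrow> t \<in> {0..T} \<Longrightarrow> hs_le s (M \<nu>) (a \<nu> t)" by metis
  have "\<exists>A>0. \<forall>t\<in>{0..T}. w1 (a \<nu> t) summable_on UNIV \<and> infsum (w1 (a \<nu> t)) UNIV \<le> A" if "0 \<le> \<nu>" for \<nu>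
    using w1_bounded[OF s, of "M \<nu>"] M[OF that] by metis
  then obtain A where A: "\<And>\<nu>. 0 \<le> \<nu> \<Longrightarrow> A \<nu> > 0"
    "\<And>\<nu> t. 0 \<le> \<nu> \<Longrightarrow> t \<in> {0..T} \<Longrightarrow> w1 (a \<nu> t) summable_on UNIV \<and> infsum (w1 (a \<nu> t)) UNIV \<le> A \<nu>"
    by metis
  have reg: "regular (\<theta> \<nu> t) \<and> infsum (w1 (fourier_coeff (cx (\<theta> \<nu> t)))) UNIV \<le> A \<nu>" if "0 \<le> \<nu>" "t \<in> {0..T}" for \<nu> t
    using A(2)[OF that] AS[OF that(1)] that(2) by (auto simp: regular_def AS_solution_def a_def)
  have Si: "cell_integrable (cx S)" using S by (intro L2_torus_integrable) (simp add: sobolev_space_def)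
  have ode: "((\<lambda>t. a \<nu> t k) has_vector_derivative
      (fourier_coeff (cx S) k - transport (U \<nu> t) (a \<nu> t) k)) (at t within {0..T})"
    if \<nu>: "0 \<le> \<nu>" and t: "t \<in> {0..T}" for \<nu> t k
  proof -
    obtain B where B: "\<And>i j k. norm (m \<nu> i j k) \<le> B" using A2_symbol_bounded[OF A2 \<nu>] by metis
    show ?thesis
      unfolding a_def U_def by (rule fourier_coeff_ode[OF AS[OF \<nu>] T reg[OF \<nu>] B Si t])
  qed
  have init: "a \<nu> 0 = fourier_coeff (cx \<theta>0)" if "0 \<le> \<nu>" for \<nu>
    using AS[OF that] by (simp add: a_def AS_solution_def)
  define G0 where "G0 = (sobolev_norm s (cx \<theta>0))\<^sup>2"
  define P where "P = (sobolev_norm s (cx S))\<^sup>2"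
  have G0: "hs_le s G0 (fourier_coeff (cx \<theta>0))" unfolding G0_def by (rule hs_le_of_sobolev[OF th0 order_refl])
  have P: "hs_le s P (fourier_coeff (cx S))" unfolding P_def by (rule hs_le_of_sobolev[OF S order_refl])
  have G0P: "0 \<le> G0" "0 \<le> P" by (simp_all add: G0_def P_def)
  define Amax where "Amax = A 0 + 1"
  have Amax: "0 < Amax" using A(1)[of 0] by (simp add: Amax_def)
  define \<Lambda> where "\<Lambda> = 1 + 4 * ((s + 1) * 2 powr (s - 1)) * c * Amax"
  define \<Lambda>' where "\<Lambda>' = 1 + 2 * c * Amax + Amax * (1 + 2 * c\<^sup>2)"
  have \<Lambda>: "0 \<le> \<Lambda>" "0 \<le> \<Lambda>'" unfolding \<Lambda>_def \<Lambda>'_def using s1 c Amax by (auto intro!: add_nonneg_nonneg mult_nonneg_nonneg)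
  define M1 where "M1 = 2 * (G0 + P * T) * exp (2 * \<Lambda> * T)"
  define K where "K = 4 * Amax * T * exp (2 * \<Lambda>' * T)"
  have K: "0 \<le> K" using Amax T by (simp add: K_def)
  define M2 where "M2 = 2 * (M1 + M 0)"
  define \<phi> where "\<phi> = (\<lambda>\<nu> t k. a \<nu> t k - a 0 t k)"
  define Q where "Q = (\<lambda>\<nu> k. \<Sum>j\<in>UNIV. norm (vsym (m \<nu>) j k - vsym (m 0) j k))"
  define q where "q = (\<lambda>\<nu> t k. Q \<nu> k * norm (a 0 t k))"

  \<comment> \<open>The velocity operators converge on the bounded trajectory of \<open>\<theta> 0\<close>, uniformly in time.\<close>
  have consistency: "eventually (\<lambda>\<nu>. \<forall>t\<in>{0..T}. l2_le (q \<nu> t) \<epsilon>) (at_right 0)" if \<epsilon>: "\<epsilon> > 0" for \<epsilon>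
  proof -
    have M0: "0 \<le> M 0" using hs_le_nonneg[OF M[of 0 0]] T by simp
    define e where "e = \<epsilon> / (M 0 + 1)"
    have e: "e > 0" using \<epsilon> M0 by (simp add: e_def)
    have "0 < 2 * s" "0 < e / (4 * c\<^sup>2 + 1)" using s1 e by (auto intro!: divide_pos_pos add_nonneg_pos)
    from bracket_powr_dominates[OF this] obtain H :: "(int ^ 'n) set" where H: "finite H"
      "\<And>k. k \<notin> H \<Longrightarrow> 1 \<le> e / (4 * c\<^sup>2 + 1) * bracket k powr (2 * s)" by blast
    have "eventually (\<lambda>\<nu>. \<forall>k\<in>H. (Q \<nu> k)\<^sup>2 < e) (at_right 0)"
    proof (rule eventually_ball_finite[OF H(1)], intro ballI)
      fix k
      have "((\<lambda>\<nu>. (Q \<nu> k)\<^sup>2) \<longlongrightarrow> (\<Sum>j\<in>(UNIV::'n set). norm (vsym (m 0) j k - vsym (m 0) j k))\<^sup>2) (at_right 0)"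
        unfolding Q_def by (intro tendsto_intros vsym_tendsto[OF A4])
      then show "eventually (\<lambda>\<nu>. (Q \<nu> k)\<^sup>2 < e) (at_right 0)"
        using e by (intro order_tendstoD(2)) auto
    qed
    moreover have "eventually (\<lambda>\<nu>::real. \<nu> \<in> {0<..<1}) (at_right 0)" by (rule eventually_at_right_real) simp
    ultimately show ?thesis
    proof eventually_elim
      case (elim \<nu>)
      have Qc: "(Q \<nu> k)\<^sup>2 \<le> e * bracket k powr (2 * s)" for k
      proof (cases "k \<in> H")
        case True
        then have "(Q \<nu> k)\<^sup>2 \<le> e * 1" using elim(1) by (simp add: less_imp_le)
        also have "\<dots> \<le> e * bracket k powr (2 * s)"
          using e s1 by (intro mult_left_mono bracket_powr_ge_1) auto
        finally show ?thesis .
      next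
        case False
        have "Q \<nu> k \<le> (\<Sum>j\<in>(UNIV::'n set). n * C0 + n * C0)"
          unfolding Q_def using elim(2)
          by (intro sum_mono order_trans[OF norm_triangle_ineq4 add_mono] vs) auto
        then have "Q \<nu> k \<le> 2 * c" by (simp add: c_def n_def mult_ac)
        then have "(Q \<nu> k)\<^sup>2 \<le> (2 * c)\<^sup>2" by (intro power_mono) (auto simp: Q_def sum_nonneg)
        also have "\<dots> \<le> (4 * c\<^sup>2 + 1) * 1" by (simp add: power_mult_distrib)
        also have "\<dots> \<le> (4 * c\<^sup>2 + 1) * (e / (4 * c\<^sup>2 + 1) * bracket k powr (2 * s))"
          by (intro mult_left_mono H(2)[OF False]) (auto intro!: add_nonneg_nonneg)
        also have "\<dots> = e * bracket k powr (2 * s)"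
        proof -
          have "4 * c\<^sup>2 + 1 \<noteq> 0" by (metis add_nonneg_pos less_irrefl mult_nonneg_nonneg zero_le_numeral zero_le_power2 zero_less_one)
          then show ?thesis by simp
        qed
        finally show ?thesis .
      qed
      show ?case
        unfolding l2_le_def
      proof (intro ballI allI impI)
        fix t and F :: "(int ^ 'n) set" assume t: "t \<in> {0..T}" and F: "finite F"
        have "(\<Sum>k\<in>F. (q \<nu> t k)\<^sup>2) \<le> (\<Sum>k\<in>F. e * (bracket k powr (2 * s) * (norm (a 0 t k))\<^sup>2))"
          unfolding q_def power_mult_distrib mult.assoc[symmetric] by (intro sum_mono mult_right_mono Qc) auto
        also have "\<dots> = e * (\<Sum>k\<in>F. bracket k powr (2 * s) * (norm (a 0 t k))\<^sup>2)" by (simp add: sum_distrib_left)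
        also have "\<dots> \<le> e * M 0" using e t F by (intro mult_left_mono hs_leD[OF M]) auto
        also have "\<dots> \<le> e * (M 0 + 1)" using e by simp
        also have "\<dots> = \<epsilon>" using M0 by (simp add: e_def)
        finally show "(\<Sum>k\<in>F. (q \<nu> t k)\<^sup>2) \<le> \<epsilon>" .
      qed
    qed
  qed

  \<comment> \<open>The bootstrap condition on \<open>{0..t1}\<close> bounds the \<open>w1\<close> norm of \<open>\<theta> \<nu>\<close> by \<open>Amax\<close>; this feeds both energy estimates.\<close>
  have estimates: "hs_le s M2 (\<phi> \<nu> t1) \<and> hs_le 0 (K * \<epsilon>) (\<phi> \<nu> t1)"
    if \<nu>: "0 \<le> \<nu>" "\<nu> \<le> 1" and \<epsilon>: "0 \<le> \<epsilon>" and q: "\<And>t. t \<in> {0..T} \<Longrightarrow> l2_le (q \<nu> t) \<epsilon>"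
      and t1: "t1 \<in> {0..T}" and small: "\<And>t. t \<in> {0..t1} \<Longrightarrow> infsum (w1 (\<phi> \<nu> t)) UNIV \<le> 1"
    for \<nu> \<epsilon> t1
  proof -
    have sub: "{0..t1} \<subseteq> {0..T}" using t1 by auto
    then have sub': "t \<in> {0..t1} \<Longrightarrow> t \<in> {0..T}" for t by blast
    have ode': "((\<lambda>t. a \<mu> t k) has_vector_derivative
        (fourier_coeff (cx S) k - transport (U \<mu> t) (a \<mu> t) k)) (at t within {0..t1})"
      if "0 \<le> \<mu>" "t \<in> {0..t1}" for \<mu> t k
      by (rule has_vector_derivative_within_subset[OF ode[OF that(1) sub'[OF that(2)]] sub])
    have w1\<nu>: "w1 (a \<nu> t) summable_on UNIV \<and> infsum (w1 (a \<nu> t)) UNIV \<le> Amax" if "t \<in> {0..t1}" for t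
    proof
      show sm: "w1 (a \<nu> t) summable_on UNIV" using A(2)[OF \<nu>(1) sub'[OF that]] by simp
      have sm0: "w1 (a 0 t) summable_on UNIV" using A(2)[of 0, OF _ sub'[OF that]] by simp
      have sm\<phi>: "w1 (\<phi> \<nu> t) summable_on UNIV"
      proof (rule summable_on_comparison_test[OF summable_on_add[OF sm sm0]])
        show "w1 (\<phi> \<nu> t) k \<le> w1 (a \<nu> t) k + w1 (a 0 t) k" for k
          unfolding w1_def \<phi>_def distrib_left[symmetric] by (intro mult_left_mono norm_triangle_ineq4) simp
      qed simp
      have "infsum (w1 (a \<nu> t)) UNIV \<le> (\<Sum>\<^sub>\<infinity>k. w1 (\<phi> \<nu> t) k + w1 (a 0 t) k)"
      proof (rule infsum_mono[OF sm summable_on_add[OF sm\<phi> sm0]])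
        fix k
        have "norm (a \<nu> t k) \<le> norm (\<phi> \<nu> t k) + norm (a 0 t k)"
          using norm_triangle_ineq[of "\<phi> \<nu> t k" "a 0 t k"] by (simp add: \<phi>_def)
        then show "w1 (a \<nu> t) k \<le> w1 (\<phi> \<nu> t) k + w1 (a 0 t) k"
          unfolding w1_def distrib_left[symmetric] by (intro mult_left_mono) auto
      qed
      also have "\<dots> = infsum (w1 (\<phi> \<nu> t)) UNIV + infsum (w1 (a 0 t)) UNIV"
        by (rule infsum_add[OF sm\<phi> sm0])
      also have "\<dots> \<le> 1 + A 0" using small[OF that] A(2)[of 0, OF _ sub'[OF that]] by simp
      finally show "infsum (w1 (a \<nu> t)) UNIV \<le> Amax" by (simp add: Amax_def)
    qed
    have w10: "w1 (a 0 t) summable_on UNIV \<and> infsum (w1 (a 0 t)) UNIV \<le> Amax" if "t \<in> {0..t1}" for t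
      using A(2)[of 0, OF _ sub'[OF that]] by (simp add: Amax_def)
    have "hs_le s (2 * (G0 + P * t1) * exp (2 * \<Lambda> * t1)) (a \<nu> t1)"
      unfolding \<Lambda>_def
    proof (rule sobolev_growth[OF s1 c less_imp_le[OF Amax] ode'[OF \<nu>(1)] real divfree[OF \<nu>(1)] speed[OF \<nu>]
          w1\<nu> M[OF \<nu>(1) sub'] P])
      show "hs_le s G0 (a \<nu> 0)" using G0 by (simp add: init[OF \<nu>(1)])
      show "t1 \<in> {0..t1}" using t1 by simp
    qed
    moreover have "2 * (G0 + P * t1) * exp (2 * \<Lambda> * t1) \<le> M1"
      unfolding M1_def using G0P \<Lambda> t1 by (intro mult_mono add_mono mult_left_mono) (auto intro: mult_left_mono)
    ultimately have "hs_le s M1 (a \<nu> t1)" by (rule hs_le_mono)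
    then have 1: "hs_le s M2 (\<phi> \<nu> t1)"
      unfolding M2_def \<phi>_def by (rule hs_le_diff) (use M[of 0 t1] t1 in simp)
    have "hs_le 0 (4 * Amax * t1 * exp (2 * \<Lambda>' * t1) * \<epsilon>) (\<lambda>k. a \<nu> t1 k - a 0 t1 k)"
      unfolding \<Lambda>'_def
    proof (rule L2_stability[where q = "q \<nu>" and V = "U 0" and U = "U \<nu>" and M = "2 * (M \<nu> + M 0)",
          OF c less_imp_le[OF Amax] \<epsilon> ode'[of 0] ode'[OF \<nu>(1)] real real divfree[OF \<nu>(1)] speed[of 0] speed[OF \<nu>] _ _ w10 w1\<nu>])
      show "speed (\<lambda>j k. U \<nu> t j k - U 0 t j k) k \<le> c * norm (a \<nu> t k - a 0 t k) + q \<nu> t k" for t k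
      proof -
        have "speed (\<lambda>j k. U \<nu> t j k - U 0 t j k) k
            \<le> (\<Sum>j\<in>(UNIV::'n set). (n * C0) * norm (a \<nu> t k - a 0 t k) + norm (vsym (m \<nu>) j k - vsym (m 0) j k) * norm (a 0 t k))"
          unfolding speed_def
        proof (rule sum_mono)
          fix j
          have "U \<nu> t j k - U 0 t j k
              = vsym (m \<nu>) j k * (a \<nu> t k - a 0 t k) + (vsym (m \<nu>) j k - vsym (m 0) j k) * a 0 t k"
            by (simp add: U_def algebra_simps)
          also have "norm \<dots> \<le> norm (vsym (m \<nu>) j k) * norm (a \<nu> t k - a 0 t k)
              + norm (vsym (m \<nu>) j k - vsym (m 0) j k) * norm (a 0 t k)"
            unfolding norm_mult[symmetric] by (rule norm_triangle_ineq)
          also have "\<dots> \<le> (n * C0) * norm (a \<nu> t k - a 0 t k)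
              + norm (vsym (m \<nu>) j k - vsym (m 0) j k) * norm (a 0 t k)"
            by (intro add_right_mono mult_right_mono vs \<nu>) simp
          finally show "norm (U \<nu> t j k - U 0 t j k) \<le> (n * C0) * norm (a \<nu> t k - a 0 t k)
              + norm (vsym (m \<nu>) j k - vsym (m 0) j k) * norm (a 0 t k)" .
        qed
        also have "\<dots> = c * norm (a \<nu> t k - a 0 t k) + q \<nu> t k"
          by (simp add: sum.distrib q_def Q_def sum_distrib_right c_def n_def mult.assoc)
        finally show ?thesis .
      qed
      show "l2_le (q \<nu> t) \<epsilon>" if "t \<in> {0..t1}" for t by (rule q[OF sub'[OF that]])
      show "hs_le 0 (2 * (M \<nu> + M 0)) (\<lambda>k. a \<nu> t k - a 0 t k)" if "t \<in> {0..t1}" for t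
        by (rule hs_le_exponent[OF hs_le_diff[OF M[OF \<nu>(1)] M[OF order_refl]]])
           (use s1 sub'[OF that] in auto)
      show "a \<nu> 0 k = a 0 0 k" for k by (simp add: init[OF \<nu>(1)] init[of 0])
      show "t1 \<in> {0..t1}" using t1 by simp
    qed auto
    moreover have "4 * Amax * t1 * exp (2 * \<Lambda>' * t1) * \<epsilon> \<le> K * \<epsilon>"
      unfolding K_def using Amax \<Lambda> t1 \<epsilon> by (intro mult_right_mono mult_mono) (auto intro: mult_left_mono)
    ultimately have "hs_le 0 (K * \<epsilon>) (\<phi> \<nu> t1)" unfolding \<phi>_def by (rule hs_le_mono)
    with 1 show ?thesis ..
  qed

  \<comment> \<open>High modes of the difference contribute at most 1/4 by the \<open>H\<^sup>s\<close> bound, low ones by smallness in \<open>L\<^sup>2\<close>.\<close>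
  obtain F :: "(int ^ 'n) set" where F: "finite F"
    "\<And>a G. hs_le s M2 a \<Longrightarrow> finite G \<Longrightarrow> G \<inter> F = {} \<Longrightarrow> (\<Sum>k\<in>G. w1 a k) \<le> 1 / 4"
    using w1_uniform_tail[OF s, of "1 / 4" M2] by auto
  define R where "R = (\<Sum>k\<in>F. bracket k)"
  have R: "0 \<le> R" by (simp add: R_def sum_nonneg)
  define \<delta> where "\<delta> = (1 / (4 * (R + 1)))\<^sup>2"
  have \<delta>: "0 < \<delta>" using R unfolding \<delta>_def by (intro zero_less_power divide_pos_pos) auto

  have conclusion: "\<forall>t\<in>{0..T}. hs_le s M2 (\<phi> \<nu> t) \<and> hs_le 0 (K * \<epsilon>) (\<phi> \<nu> t)"
    if \<nu>: "0 \<le> \<nu>" "\<nu> \<le> 1" and \<epsilon>: "0 \<le> \<epsilon>" "K * \<epsilon> \<le> \<delta>" and q: "\<And>t. t \<in> {0..T} \<Longrightarrow> l2_le (q \<nu> t) \<epsilon>" for \<nu> \<epsilon>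
  proof -
    let ?f = "\<lambda>t. infsum (w1 (\<phi> \<nu> t)) UNIV"
    have le1: "?f t \<le> 1" if t: "t \<in> {0..T}" for t
    proof (rule continuous_bootstrap[OF _ _ _ t])
      show "continuous_on {0..T} ?f"
      proof (rule w1_sum_continuous[OF s, where M = "2 * (M \<nu> + M 0)"])
        show "hs_le s (2 * (M \<nu> + M 0)) (\<phi> \<nu> t)" if "t \<in> {0..T}" for t
          unfolding \<phi>_def using that by (intro hs_le_diff M \<nu>) auto
        have "continuous_on {0..T} (\<lambda>t. a \<mu> t k)" if "0 \<le> \<mu>" for \<mu> k
          unfolding continuous_on_eq_continuous_within
          by (intro ballI) (rule has_vector_derivative_continuous, rule ode[OF that])
        then show "continuous_on {0..T} (\<lambda>t. \<phi> \<nu> t k)" for k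
          unfolding \<phi>_def using \<nu> by (intro continuous_on_diff) auto
      qed
      have "\<phi> \<nu> 0 = (\<lambda>k. 0)" by (simp add: \<phi>_def init[OF \<nu>(1)] init[of 0])
      then show "?f 0 \<le> 1" by (simp add: w1_def[abs_def])
      fix t assume t: "t \<in> {0..T}" and small: "\<And>u. u \<in> {0..t} \<Longrightarrow> ?f u \<le> 1"
      have est: "hs_le s M2 (\<phi> \<nu> t)" "hs_le 0 (K * \<epsilon>) (\<phi> \<nu> t)"
        using estimates[OF \<nu> \<epsilon>(1) q t small] by auto
      have "?f t \<le> 1 / 2"
      proof (rule nonneg_infsum_leI)
        fix G :: "(int ^ 'n) set" assume G: "finite G"
        have "sum (w1 (\<phi> \<nu> t)) G \<le> sum (w1 (\<phi> \<nu> t)) ((G - F) \<union> F)" using G F by (intro sum_mono2) auto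
        also have "\<dots> = sum (w1 (\<phi> \<nu> t)) (G - F) + sum (w1 (\<phi> \<nu> t)) F"
          using G F by (intro sum.union_disjoint) auto
        also have "sum (w1 (\<phi> \<nu> t)) (G - F) \<le> 1 / 4" using G by (intro F(2)[OF est(1)]) auto
        also have "sum (w1 (\<phi> \<nu> t)) F \<le> (\<Sum>k\<in>F. bracket k * (1 / (4 * (R + 1))))"
          unfolding w1_def
        proof (intro sum_mono mult_left_mono)
          fix k
          have "(norm (\<phi> \<nu> t k))\<^sup>2 \<le> \<delta>" using hs_le_norm[OF est(2), of k] \<epsilon>(2) by simp
          then show "norm (\<phi> \<nu> t k) \<le> 1 / (4 * (R + 1))"
            unfolding \<delta>_def by (rule power2_le_imp_le) (use R in auto)
        qed simp
        also have "\<dots> = R * (1 / (4 * (R + 1)))" by (simp only: R_def sum_distrib_right)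
        also have "\<dots> = R / (R + 1) * (1 / 4)" by simp
        also have "\<dots> \<le> 1 * (1 / 4)" using R by (intro mult_right_mono) auto
        finally show "sum (w1 (\<phi> \<nu> t)) G \<le> 1 / 2" by simp
      qed simp
      then show "?f t < 1" by simp
    qed
    show ?thesis
    proof
      fix t assume t: "t \<in> {0..T}"
      show "hs_le s M2 (\<phi> \<nu> t) \<and> hs_le 0 (K * \<epsilon>) (\<phi> \<nu> t)"
        by (rule estimates[OF \<nu> \<epsilon>(1) q t le1]) (use t in auto)
    qed
  qed

  show ?thesis
  proof (intro exI[of _ M2] allI impI)
    fix \<epsilon> :: real assume \<epsilon>: "\<epsilon> > 0"
    define \<eta> where "\<eta> = min \<epsilon> \<delta> / (K + 1)"
    have \<eta>: "\<eta> > 0" using \<epsilon> \<delta> K by (simp add: \<eta>_def)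
    have "K * \<eta> \<le> (K + 1) * \<eta>" using \<eta> by simp
    also have "\<dots> = min \<epsilon> \<delta>" using K by (simp add: \<eta>_def)
    finally have K\<eta>: "K * \<eta> \<le> \<delta>" "K * \<eta> \<le> \<epsilon>" by auto
    have "eventually (\<lambda>\<nu>::real. \<nu> \<in> {0<..<1}) (at_right 0)" by (rule eventually_at_right_real) simp
    with consistency[OF \<eta>] show "eventually (\<lambda>\<nu>. \<forall>t\<in>{0..T}.
        hs_le s M2 (\<lambda>k. fourier_coeff (cx (\<theta> \<nu> t)) k - fourier_coeff (cx (\<theta> 0 t)) k) \<and>
        hs_le 0 \<epsilon> (\<lambda>k. fourier_coeff (cx (\<theta> \<nu> t)) k - fourier_coeff (cx (\<theta> 0 t)) k)) (at_right 0)"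
    proof eventually_elim
      case (elim \<nu>)
      have "\<forall>t\<in>{0..T}. hs_le s M2 (\<phi> \<nu> t) \<and> hs_le 0 (K * \<eta>) (\<phi> \<nu> t)"
        by (rule conclusion[OF _ _ less_imp_le[OF \<eta>] K\<eta>(1)]) (use elim in auto)
      then show ?case unfolding \<phi>_def a_def using hs_le_mono[OF _ K\<eta>(2)] by blast
    qed
  qed
qed

lemma fourier_coeff_regular_diff:
  assumes "regular f" "regular g"
  shows "fourier_coeff (cx (\<lambda>x. f x - g x)) k = fourier_coeff (cx f) k - fourier_coeff (cx g) k"
  using fourier_coeff_diff[of "cx f" "cx g" k] assms
  by (auto intro!: cell_integrable_continuous continuous_intros regular_continuous)

theorem sobolev_inviscid_limit:
  fixes m :: "real \<Rightarrow> 'n::finite symbols"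
  assumes "A1 m" and "A2 m" and "A4 m" and "A5_2 m"
    and s: "s > CARD('n) / 2 + 1" and T: "0 < T"
    and "sobolev_space s (cx \<theta>0)" and "sobolev_space s (cx S)"
    and sol: "\<And>\<nu>. 0 \<le> \<nu> \<Longrightarrow> sobolev_solution (m \<nu>) \<theta>0 S s T (\<theta> \<nu>)"
    and t: "t \<in> {0..T}"
  shows "((\<lambda>\<nu>. sobolev_norm (s - 1) (cx (\<lambda>x. \<theta> \<nu> t x - \<theta> 0 t x))) \<longlongrightarrow> 0) (at_right 0)"
proof (rule tendstoI)
  fix e :: real assume e: "e > 0"
  define \<phi> where "\<phi> = (\<lambda>\<nu> k. fourier_coeff (cx (\<theta> \<nu> t)) k - fourier_coeff (cx (\<theta> 0 t)) k)"
  obtain M where M': "\<forall>\<epsilon>>0. eventually (\<lambda>\<nu>. \<forall>t\<in>{0..T}.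
      hs_le s M (\<lambda>k. fourier_coeff (cx (\<theta> \<nu> t)) k - fourier_coeff (cx (\<theta> 0 t)) k) \<and>
      hs_le 0 \<epsilon> (\<lambda>k. fourier_coeff (cx (\<theta> \<nu> t)) k - fourier_coeff (cx (\<theta> 0 t)) k)) (at_right 0)"
    using sobolev_differences_vanish[OF assms(1-4) s T assms(7-8) sol] by blast
  have M: "eventually (\<lambda>\<nu>. hs_le s M (\<phi> \<nu>) \<and> hs_le 0 \<epsilon> (\<phi> \<nu>)) (at_right 0)" if "\<epsilon> > 0" for \<epsilon>
    unfolding \<phi>_def by (rule eventually_mono[OF M'[rule_format, OF that]]) (use t in blast)
  have pos: "eventually (\<lambda>\<nu>::real. 0 < \<nu>) (at_right 0)" by (rule eventually_at_right_less)
  have reg: "regular (\<theta> \<nu> t)" if \<nu>: "0 \<le> \<nu>" for \<nu>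
  proof -
    obtain M where "sobolev_space s (cx (\<theta> \<nu> t))" "sobolev_norm s (cx (\<theta> \<nu> t)) \<le> M"
      using sol[OF \<nu>] t unfolding sobolev_solution_def by blast
    then have "hs_le s (M\<^sup>2) (fourier_coeff (cx (\<theta> \<nu> t)))" by (rule hs_le_of_sobolev)
    then have "w1 (fourier_coeff (cx (\<theta> \<nu> t))) summable_on UNIV"
      using w1_bounded[OF s, of "M\<^sup>2"] by blast
    then show ?thesis using sol[OF \<nu>] t by (auto simp: regular_def sobolev_solution_def AS_solution_def)
  qed
  have "eventually (\<lambda>\<nu>. \<forall>F. finite F \<longrightarrow>
      (\<Sum>k\<in>F. bracket k powr (2 * (s - 1)) * (norm (\<phi> \<nu> k))\<^sup>2) \<le> (e / 2)\<^sup>2) (at_right 0)"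
  proof (rule weighted_tail_tendsto[where W = "\<lambda>k. bracket k powr (2 * s)" and B = M])
    fix d :: real assume "d > 0"
    from bracket_powr_dominates[of 2, OF _ this]
    obtain F :: "(int ^ 'n) set" where F: "finite F" "\<And>k. k \<notin> F \<Longrightarrow> 1 \<le> d * bracket k powr 2" by auto
    have dom: "bracket k powr (2 * (s - 1)) \<le> d * bracket k powr (2 * s)" if "k \<notin> F" for k :: "int ^ 'n"
    proof -
      have "bracket k powr (2 * (s - 1)) * 1 \<le> bracket k powr (2 * (s - 1)) * (d * bracket k powr 2)"
        by (intro mult_left_mono F(2)[OF that]) simp
      also have "\<dots> = d * (bracket k powr (2 * (s - 1)) * bracket k powr 2)" by (simp only: mult_ac)
      also have "bracket k powr (2 * (s - 1)) * bracket k powr 2 = bracket k powr (2 * s)"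
        unfolding powr_add[symmetric] by (simp add: algebra_simps)
      finally show ?thesis by simp
    qed
    show "\<exists>F::(int ^ 'n) set. finite F \<and> (\<forall>k. k \<notin> F \<longrightarrow> bracket k powr (2 * (s - 1)) \<le> d * bracket k powr (2 * s))"
      by (intro exI[of _ F] conjI allI impI F(1) dom)
  next
    show "eventually (\<lambda>\<nu>. \<forall>F. finite F \<longrightarrow> (\<Sum>k\<in>F. bracket k powr (2 * s) * (norm (\<phi> \<nu> k))\<^sup>2) \<le> M) (at_right 0)"
      using M[of 1] by (simp add: hs_le_def eventually_mono)
  next
    fix k
    show "((\<lambda>\<nu>. norm (\<phi> \<nu> k)) \<longlongrightarrow> 0) (at_right 0)"
    proof (rule tendstoI)
      fix d :: real assume d: "d > 0"
      from M[of "(d / 2)\<^sup>2"] d have "eventually (\<lambda>\<nu>. hs_le 0 ((d / 2)\<^sup>2) (\<phi> \<nu>)) (at_right 0)"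
        by (simp add: eventually_conj_iff)
      then show "eventually (\<lambda>\<nu>. dist (norm (\<phi> \<nu> k)) 0 < d) (at_right 0)"
      proof eventually_elim
        case (elim \<nu>)
        have "norm (\<phi> \<nu> k) \<le> d / 2"
          by (rule power2_le_imp_le) (use hs_le_norm[OF elim, of k] d in auto)
        then show ?case using d by simp
      qed
    qed
  qed (use e in auto)
  with pos show "eventually (\<lambda>\<nu>. dist (sobolev_norm (s - 1) (cx (\<lambda>x. \<theta> \<nu> t x - \<theta> 0 t x))) 0 < e) (at_right 0)"
  proof eventually_elim
    case (elim \<nu>)
    have "fourier_coeff (cx (\<lambda>x. \<theta> \<nu> t x - \<theta> 0 t x)) = \<phi> \<nu>"
      unfolding \<phi>_def using elim(1) by (intro ext fourier_coeff_regular_diff reg) auto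
    then have "sobolev_norm (s - 1) (cx (\<lambda>x. \<theta> \<nu> t x - \<theta> 0 t x)) \<le> e / 2"
      using elim(2) e by (intro sobolev_norm_le) (auto simp: hs_le_def)
    moreover have "0 \<le> sobolev_norm (s - 1) (cx (\<lambda>x. \<theta> \<nu> t x - \<theta> 0 t x))" by (simp add: sobolev_norm_def)
    ultimately show ?case using e by simp
  qed
qed

section \<open>Convergence in Gevrey classes\<close>

lemma wave_lipschitz: "norm (wave k x - wave k y) \<le> bracket k * norm (x - y)"
  for k :: "int ^ 'n::finite"
proof (rule differentiable_bound[where S = UNIV])
  fix x :: "real ^ 'n"
  show "(wave k has_derivative (\<lambda>h. 1 * (\<i> * of_real (freq k \<bullet> h)) * wave k x)) (at x within UNIV)"
    using cis_has_derivative[of 1 k x UNIV] by simp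
  show "onorm (\<lambda>h. 1 * (\<i> * of_real (freq k \<bullet> h)) * wave k x) \<le> bracket k"
  proof (rule onorm_le)
    fix h :: "real ^ 'n"
    have "\<bar>freq k \<bullet> h\<bar> \<le> bracket k * norm h"
      using Cauchy_Schwarz_ineq2[of "freq k" h] mult_right_mono[OF norm_freq_le_bracket[of k], of "norm h"] by simp
    then show "norm (1 * (\<i> * of_real (freq k \<bullet> h)) * wave k x) \<le> bracket k * norm h" by (simp add: norm_mult)
  qed
qed auto

lemma regular_lipschitz:
  assumes f: "regular f" and A: "infsum (w1 (fourier_coeff (cx f))) UNIV \<le> A"
  shows "\<bar>f x - f y\<bar> \<le> A * norm (x - y)"
proof -
  let ?a = "fourier_coeff (cx f)"
  have a: "w1 ?a summable_on UNIV" using f by (simp add: regular_def)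
  have le: "norm (?a k * wave k x - ?a k * wave k y) \<le> w1 ?a k * norm (x - y)" for k
  proof -
    have "norm (?a k * wave k x - ?a k * wave k y) = norm (?a k) * norm (wave k x - wave k y)"
      unfolding right_diff_distrib[symmetric] by (rule norm_mult)
    also have "\<dots> \<le> norm (?a k) * (bracket k * norm (x - y))"
      by (intro mult_left_mono wave_lipschitz) simp
    also have "\<dots> = w1 ?a k * norm (x - y)" by (simp add: w1_def)
    finally show ?thesis .
  qed
  have sm: "(\<lambda>k. w1 ?a k * norm (x - y)) summable_on UNIV" by (intro summable_on_cmult_left a)
  have sm': "(\<lambda>k. norm (?a k * wave k x - ?a k * wave k y)) summable_on UNIV"
    by (rule Infinite_Sum.abs_summable_on_comparison_test'[OF sm]) (rule le)
  have "cx f x - cx f y = (\<Sum>\<^sub>\<infinity>k. ?a k * wave k x - ?a k * wave k y)"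
    unfolding regular_series[OF f, of x] regular_series[OF f, of y]
    by (intro infsum_difference[symmetric] fourier_series_summable w1_norm_summable a)
  also have "norm \<dots> \<le> (\<Sum>\<^sub>\<infinity>k. norm (?a k * wave k x - ?a k * wave k y))"
    by (rule norm_infsum_bound[OF sm'])
  also have "\<dots> \<le> (\<Sum>\<^sub>\<infinity>k. w1 ?a k * norm (x - y))"
    by (rule infsum_mono[OF sm' sm]) (rule le)
  also have "\<dots> = infsum (w1 ?a) UNIV * norm (x - y)" by (rule infsum_cmult_left) (rule a)
  also have "\<dots> \<le> A * norm (x - y)" by (intro mult_right_mono A) simp
  finally show ?thesis by (simp flip: of_real_diff)
qed

text \<open>
  Fourier multipliers applied to a bounded sequence in \<open>H\<^sup>s\<close> whose modes converge uniformly in a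
  parameter: uniform smallness of the \<open>w1\<close> tails reduces the convergence of the series to that of
  finitely many modes.
\<close>

lemma uniform_limit_multiplier_series:
  fixes b :: "nat \<Rightarrow> 't \<Rightarrow> int ^ 'n::finite \<Rightarrow> complex" and c :: "'t \<Rightarrow> int ^ 'n \<Rightarrow> complex"
  assumes s: "s > CARD('n) / 2 + 1"
    and b: "\<And>n t. t \<in> X \<Longrightarrow> hs_le s M (b n t)" and c: "\<And>t. t \<in> X \<Longrightarrow> hs_le s M (c t)"
    and \<mu>: "\<And>n k. norm (\<mu> n k) \<le> D * bracket k" "\<And>k. norm (\<mu>0 k) \<le> D * bracket k"
    and \<mu>lim: "\<And>k. (\<lambda>n. \<mu> n k) \<longlonglongrightarrow> \<mu>0 k"
    and blim: "\<And>k. uniform_limit X (\<lambda>n t. b n t k) (\<lambda>t. c t k) sequentially"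
  shows "uniform_limit X (\<lambda>n t. \<Sum>\<^sub>\<infinity>k. (\<mu> n k * b n t k) * wave k x)
    (\<lambda>t. \<Sum>\<^sub>\<infinity>k. (\<mu>0 k * c t k) * wave k x) sequentially"
proof (rule uniform_limitI)
  fix e :: real assume e: "e > 0"
  have "0 \<le> norm (\<mu>0 0)" by simp
  also have "\<dots> \<le> D" using \<mu>(2)[of 0] by (simp add: bracket_def)
  finally have D: "0 \<le> D" .
  have "e / (8 * (D + 1)) > 0" using e D by simp
  from w1_uniform_tail[OF s this, of M] obtain F :: "(int ^ 'n) set" where F: "finite F"
    "\<And>a G. hs_le s M a \<Longrightarrow> finite G \<Longrightarrow> G \<inter> F = {} \<Longrightarrow> (\<Sum>k\<in>G. w1 a k) \<le> e / (8 * (D + 1))" by blast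
  have mode: "uniform_limit X (\<lambda>n t. \<mu> n k * b n t k) (\<lambda>t. \<mu>0 k * c t k) sequentially" for k
  proof (rule uniform_lim_mult[OF _ blim])
    show "uniform_limit X (\<lambda>n t. \<mu> n k) (\<lambda>t. \<mu>0 k) sequentially"
      using \<mu>lim[of k] unfolding tendsto_iff uniform_limit_iff by (auto elim!: eventually_mono)
    show "bounded ((\<lambda>t. \<mu>0 k) ` X)" by (rule finite_imp_bounded) (rule finite_subset[of _ "{\<mu>0 k}"], auto)
    show "bounded ((\<lambda>t. c t k) ` X)"
    proof (rule boundedI)
      fix z assume "z \<in> (\<lambda>t. c t k) ` X"
      then obtain t where t: "t \<in> X" "z = c t k" by blast
      have "(norm (c t k))\<^sup>2 * 1 \<le> (norm (c t k))\<^sup>2 * bracket k powr (2 * s)"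
        using s by (intro mult_left_mono bracket_powr_ge_1) (auto simp: less_imp_le le_less_trans)
      also have "\<dots> \<le> M" by (rule hs_le_norm[OF c[OF t(1)]])
      finally show "norm z \<le> sqrt M" by (simp add: t(2) real_le_rsqrt)
    qed
  qed
  define d where "d = e / (4 * (real (card F) + 1))"
  have d: "d > 0" unfolding d_def using e by (intro divide_pos_pos) auto
  have "eventually (\<lambda>n. \<forall>k\<in>F. \<forall>t\<in>X. dist (\<mu> n k * b n t k) (\<mu>0 k * c t k) < d) sequentially"
    by (rule eventually_ball_finite[OF F(1)]) (use uniform_limitD[OF mode d] in blast)
  then show "eventually (\<lambda>n. \<forall>t\<in>X. dist (\<Sum>\<^sub>\<infinity>k. (\<mu> n k * b n t k) * wave k x)
      (\<Sum>\<^sub>\<infinity>k. (\<mu>0 k * c t k) * wave k x) < e) sequentially"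
  proof eventually_elim
    case (elim n)
    show ?case
    proof
      fix t assume t: "t \<in> X"
      have w: "w1 (b n t) summable_on UNIV" "w1 (c t) summable_on UNIV"
        using w1_bounded[OF s, of M] b[OF t] c[OF t] by blast+
      have sm: "(\<lambda>k. norm (\<nu> k * a k)) summable_on UNIV"
        if "\<And>k. norm (\<nu> k) \<le> D * bracket k" "w1 a summable_on UNIV" for \<nu> :: "int ^ 'n \<Rightarrow> complex" and a
      proof (rule Infinite_Sum.abs_summable_on_comparison_test')
        show "(\<lambda>k. D * w1 a k) summable_on UNIV" by (intro summable_on_cmult_right that)
        show "norm (\<nu> k * a k) \<le> D * w1 a k" for k
          using mult_right_mono[OF that(1), of "norm (a k)" k] by (simp add: norm_mult w1_def mult.assoc)
      qed
      have diff: "(\<Sum>\<^sub>\<infinity>k. (\<mu> n k * b n t k) * wave k x) - (\<Sum>\<^sub>\<infinity>k. (\<mu>0 k * c t k) * wave k x)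
          = (\<Sum>\<^sub>\<infinity>k. (\<mu> n k * b n t k - \<mu>0 k * c t k) * wave k x)"
        unfolding left_diff_distrib
        by (intro infsum_difference[symmetric] fourier_series_summable sm \<mu> w)
      have fin: "(\<Sum>k\<in>G. norm (\<mu> n k * b n t k - \<mu>0 k * c t k)) \<le> e / 2" if G: "finite G" for G
      proof -
        let ?h = "\<lambda>k. norm (\<mu> n k * b n t k - \<mu>0 k * c t k)"
        have "sum ?h G \<le> sum ?h ((G - F) \<union> F)" using G F by (intro sum_mono2) auto
        also have "\<dots> = sum ?h (G - F) + sum ?h F" using G F by (intro sum.union_disjoint) auto
        also have "sum ?h (G - F) \<le> (\<Sum>k\<in>G - F. D * w1 (b n t) k + D * w1 (c t) k)"
        proof (rule sum_mono)
          fix k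
          have "?h k \<le> norm (\<mu> n k) * norm (b n t k) + norm (\<mu>0 k) * norm (c t k)"
            using norm_triangle_ineq4[of "\<mu> n k * b n t k" "\<mu>0 k * c t k"] by (simp add: norm_mult)
          also have "\<dots> \<le> (D * bracket k) * norm (b n t k) + (D * bracket k) * norm (c t k)"
            by (intro add_mono mult_right_mono \<mu>) auto
          finally show "?h k \<le> D * w1 (b n t) k + D * w1 (c t) k" by (simp add: w1_def mult.assoc)
        qed
        also have "\<dots> = D * (sum (w1 (b n t)) (G - F) + sum (w1 (c t)) (G - F))"
          by (simp add: sum.distrib sum_distrib_left distrib_left)
        also have "\<dots> \<le> (D + 1) * (e / (8 * (D + 1)) + e / (8 * (D + 1)))"
          using D G by (intro mult_mono add_mono F(2) b c t) (auto intro!: add_nonneg_nonneg sum_nonneg)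
        also have "\<dots> = e / 4"
        proof -
          have "E * (e / (8 * E)) = e / 8" if "E \<noteq> 0" for E :: real using that by simp
          from this[of "D + 1"] have "(D + 1) * (e / (8 * (D + 1))) = e / 8" using D by linarith
          then show ?thesis by (simp only: distrib_left[of "D + 1"])
        qed
        also have "sum ?h F \<le> (\<Sum>k\<in>F. d)"
          using elim t by (intro sum_mono) (auto simp: dist_norm intro: less_imp_le)
        also have "\<dots> = real (card F) / (real (card F) + 1) * (e / 4)" by (simp add: d_def)
        also have "\<dots> \<le> 1 * (e / 4)" using e by (intro mult_right_mono) auto
        finally show ?thesis by simp
      qed
      have s2: "(\<lambda>k. norm (\<mu> n k * b n t k - \<mu>0 k * c t k)) summable_on UNIV"
        by (rule nonneg_summable_onI[where B = "e / 2"], rule norm_ge_zero, rule fin)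
      have "norm (\<Sum>\<^sub>\<infinity>k. (\<mu> n k * b n t k - \<mu>0 k * c t k) * wave k x) \<le> e / 2"
        by (rule norm_series_le[OF s2]) (rule nonneg_infsum_leI, rule norm_ge_zero, rule fin)
      then show "dist (\<Sum>\<^sub>\<infinity>k. (\<mu> n k * b n t k) * wave k x) (\<Sum>\<^sub>\<infinity>k. (\<mu>0 k * c t k) * wave k x) < e"
        unfolding dist_norm diff using e by simp
    qed
  qed
qed

lemma uniform_limit_finite_sum:
  fixes f :: "'i \<Rightarrow> 'a \<Rightarrow> 'b \<Rightarrow> 'c::real_normed_vector"
  assumes "finite I" "\<And>i. i \<in> I \<Longrightarrow> uniform_limit X (f i) (l i) F"
  shows "uniform_limit X (\<lambda>n t. \<Sum>i\<in>I. f i n t) (\<lambda>t. \<Sum>i\<in>I. l i t) F"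
  using assms
proof (induction I rule: finite_induct)
  case (insert i I)
  then show ?case unfolding sum.insert[OF insert.hyps] by (intro uniform_limit_add) auto
qed (simp add: uniform_limit_const)

text \<open>
  The velocity loses a full derivative, while a shrinking radius gains only the fraction \<open>1/s\<close> of
  one, so an energy estimate for the difference does not close when \<open>s > 1\<close>. Instead the bound that
  is uniform in \<open>\<nu>\<close> gives compactness. A limit of solutions along \<open>\<nu> \<rightarrow> 0\<close> solves the limiting
  equation pointwise and satisfies the same bound, so by the uniqueness built into \<open>the_gevrey_solution\<close> it is \<open>\<theta> 0\<close>.
\<close>

lemma gevrey_subsequence:
  fixes m :: "real \<Rightarrow> 'n::finite symbols" and f :: "nat \<Rightarrow> real"
  assumes A4: "A4 m" and A5: "A5_1 m"
    and r: "r > CARD('n) / 2 + 3 / 2" and T: "0 < T" and \<tau>: "0 < \<tau>" and C: "0 < C"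
    and sol: "\<And>\<nu>. 0 \<le> \<nu> \<Longrightarrow> the_gevrey_solution (m \<nu>) \<theta>0 S s r \<tau> C T (\<theta> \<nu>)"
    and f: "\<And>n. 0 < f n" "\<And>n. f n < 1" "f \<longlonglongrightarrow> 0"
  shows "\<exists>\<kappa> :: nat \<Rightarrow> nat. strict_mono \<kappa> \<and> (\<forall>t\<in>{0..T}. \<forall>k.
       (\<lambda>n. fourier_coeff (cx (\<theta> (f (\<kappa> n)) t)) k) \<longlonglongrightarrow> fourier_coeff (cx (\<theta> 0 t)) k)"
proof -
  have r1: "r > CARD('n) / 2 + 1" and r0: "0 \<le> r" using r by (auto intro: order_trans[of _ "3/2"] less_imp_le le_less_trans)
  obtain C0 where C0: "C0 > 0" "\<And>\<nu> i j k. 0 \<le> \<nu> \<Longrightarrow> \<nu> \<le> 1 \<Longrightarrow> norm (m \<nu> i j k) \<le> C0"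
  proof -
    from A5 obtain C0 where "C0 > 0" and "\<And>i j. (\<forall>\<nu>\<in>{0<..1}. \<forall>k. norm (m \<nu> i j k) \<le> C0) \<and> (\<forall>k. norm (m 0 i j k) \<le> C0)"
      unfolding A5_1_def by blast
    then show thesis using that[of C0] by (metis greaterThanAtMost_iff order_le_less)
  qed
  define a where "a = (\<lambda>\<nu> t. fourier_coeff (cx (\<theta> \<nu> t)))"
  have gs: "gevrey_solution (m \<nu>) \<theta>0 S s r \<tau> C T (\<theta> \<nu>)" if "0 \<le> \<nu>" for \<nu>
    using sol[OF that] unfolding the_gevrey_solution_def by (rule conjunct1)
  have AS: "AS_solution (m \<nu>) \<theta>0 S T (\<theta> \<nu>)" if "0 \<le> \<nu>" for \<nu>
    using gs[OF that] by (simp add: gevrey_solution_def)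
  have gb: "gevrey_dom s r \<tau> (cx (\<theta> \<nu> t))" "gevrey_norm s r \<tau> (cx (\<theta> \<nu> t)) \<le> C" if "0 \<le> \<nu>" "t \<in> {0..T}" for \<nu> t
    using gs[OF that(1)] that(2) by (auto simp: gevrey_solution_def)
  have mean: "a \<nu> t 0 = 0" if "0 \<le> \<nu>" "t \<in> {0..T}" for \<nu> t
    using AS[OF that(1)] that(2) unfolding AS_solution_def a_def by (simp add: fourier_coeff_0_zero_mean)
  define M where "M = 2 powr r * C\<^sup>2"
  have hs: "hs_le r M (a \<nu> t)" if "0 \<le> \<nu>" "t \<in> {0..T}" for \<nu> t
    unfolding M_def a_def using \<tau> mean[OF that]
    by (intro hs_le_of_gevrey[where \<tau> = \<tau> and s = s] r0 gb that) (auto simp: a_def)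
  obtain A where A: "A > 0" "\<And>a :: int ^ 'n \<Rightarrow> complex. hs_le r M a \<Longrightarrow> w1 a summable_on UNIV \<and> infsum (w1 a) UNIV \<le> A"
    using w1_bounded[OF r1, of M] by metis
  have reg: "regular (\<theta> \<nu> t) \<and> infsum (w1 (fourier_coeff (cx (\<theta> \<nu> t)))) UNIV \<le> A" if "0 \<le> \<nu>" "t \<in> {0..T}" for \<nu> t
    using A(2)[OF hs[OF that]] AS[OF that(1)] that(2) by (auto simp: regular_def AS_solution_def a_def)

  \<comment> \<open>Equicontinuity in space and time gives a uniformly convergent subsequence.\<close>
  define L where "L = 2 * ((real CARD('n))\<^sup>2 * C0 * A\<^sup>2) + 2 * A / T"
  have L: "0 \<le> L" using C0 A(1) T by (simp add: L_def)
  have f1: "0 \<le> f n" "f n \<le> 1" for n using f(1,2)[of n] by auto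
  define \<Theta> where "\<Theta> = (\<lambda>n (p::real \<times> (real ^ 'n)). \<theta> (f n) (fst p) (snd p))"
  have lip: "norm (\<Theta> n p - \<Theta> n p') \<le> (L + A) * norm (p - p')"
    if p: "p \<in> {0..T} \<times> cell" "p' \<in> {0..T} \<times> cell" for n p p'
  proof -
    obtain t x t' x' where tx: "p = (t, x)" "p' = (t', x')" "t \<in> {0..T}" "t' \<in> {0..T}" using p by auto
    have "\<bar>\<theta> (f n) t x - \<theta> (f n) t' x\<bar> \<le> L * \<bar>t - t'\<bar>"
      unfolding L_def by (rule AS_solution_bounds(2)[OF AS T reg]) (use f1 C0(2) tx in auto)
    moreover have "\<bar>\<theta> (f n) t' x - \<theta> (f n) t' x'\<bar> \<le> A * norm (x - x')"
      by (rule regular_lipschitz) (use reg[OF f1(1) tx(4)] in auto)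
    moreover have "L * \<bar>t - t'\<bar> \<le> L * norm (p - p')"
      using L norm_fst_le[of "t - t'" "x - x'"] by (intro mult_left_mono) (auto simp: tx)
    moreover have "A * norm (x - x') \<le> A * norm (p - p')"
      using A(1) norm_snd_le[of "x - x'" "t - t'"] by (intro mult_left_mono) (auto simp: tx)
    ultimately show ?thesis by (simp add: \<Theta>_def tx(1,2) algebra_simps)
  qed
  have "compact ({0..T} \<times> (cell :: (real ^ 'n) set))" by (intro compact_Times) auto
  then obtain g and \<kappa> :: "nat \<Rightarrow> nat" where g: "continuous_on ({0..T} \<times> cell) g" and \<kappa>: "strict_mono \<kappa>"
    and glim: "\<And>e. 0 < e \<Longrightarrow> \<exists>N. \<forall>n x. n \<ge> N \<and> x \<in> {0..T} \<times> cell \<longrightarrow> norm (\<Theta> (\<kappa> n) x - g x) < e"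
  proof (rule Arzela_Ascoli[where \<F> = \<Theta> and M = A])
    fix n and p :: "real \<times> (real ^ 'n)" assume "p \<in> {0..T} \<times> cell"
    then show "norm (\<Theta> n p) \<le> A"
      using regular_bounds(1)[where f = "\<theta> (f n) (fst p)" and A = A and m = "m 0" and B = C0] reg[OF f1(1)] C0(2)[of 0]
      by (auto simp: \<Theta>_def)
  next
    fix p :: "real \<times> (real ^ 'n)" and e :: real assume p: "p \<in> {0..T} \<times> cell" and e: "0 < e"
    show "\<exists>d>0. \<forall>n y. y \<in> {0..T} \<times> cell \<and> norm (p - y) < d \<longrightarrow> norm (\<Theta> n p - \<Theta> n y) < e"
    proof (intro exI[of _ "e / (L + A)"] conjI allI impI)
      show "0 < e / (L + A)" using e L A(1) by simp
      fix n y assume y: "y \<in> {0..T} \<times> cell \<and> norm (p - y) < e / (L + A)"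
      have "norm (\<Theta> n p - \<Theta> n y) \<le> (L + A) * norm (p - y)" using lip[OF p] y by blast
      also have "\<dots> < (L + A) * (e / (L + A))" using y L A(1) by (intro mult_strict_left_mono) auto
      also have "\<dots> = e" using L A(1) by simp
      finally show "norm (\<Theta> n p - \<Theta> n y) < e" .
    qed
  qed blast
  define \<psi> where "\<psi> = (\<lambda>n. f (\<kappa> n))"
  have \<psi>: "0 \<le> \<psi> n" "\<psi> n \<le> 1" "0 < \<psi> n" for n using f1 f(1) by (auto simp: \<psi>_def)
  have "\<psi> \<longlonglongrightarrow> 0" using LIMSEQ_subseq_LIMSEQ[OF f(3) \<kappa>] by (simp add: \<psi>_def o_def)
  then have \<psi>lim: "filterlim \<psi> (at_right 0) sequentially"
    using \<psi>(3) by (intro tendsto_imp_filterlim_at_right) auto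

  \<comment> \<open>The Fourier coefficients of the limit, and the bounds they inherit.\<close>
  define c where "c = (\<lambda>t. fourier_coeff (\<lambda>x. cx (\<lambda>x. g (t, x)) x))"
  have clim: "uniform_limit {0..T} (\<lambda>n t. a (\<psi> n) t k) (\<lambda>t. c t k) sequentially" for k
  proof (rule uniform_limitI)
    fix e :: real assume e: "e > 0"
    have "0 < e / 2" using e by simp
    from glim[OF this] obtain N where
      N: "\<And>n x. n \<ge> N \<Longrightarrow> x \<in> {0..T} \<times> cell \<Longrightarrow> norm (\<Theta> (\<kappa> n) x - g x) < e / 2"
      by blast
    show "eventually (\<lambda>n. \<forall>t\<in>{0..T}. dist (a (\<psi> n) t k) (c t k) < e) sequentially"
      unfolding eventually_sequentially
    proof (intro exI[of _ N] allI impI ballI)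
      fix n t assume n: "N \<le> n" and t: "t \<in> {0..T}"
      have gt: "cell_integrable (cx (\<lambda>x. g (t, x)))"
      proof (intro cell_integrable_continuous continuous_on_of_real)
        show "continuous_on cell (\<lambda>x. g (t, x))"
          by (rule continuous_on_compose2[OF g]) (use t in \<open>auto intro!: continuous_intros\<close>)
      qed
      have tt: "cell_integrable (cx (\<theta> (\<psi> n) t))"
        using reg[OF \<psi>(1) t] by (intro cell_integrable_continuous continuous_intros regular_continuous) auto
      have "norm (fourier_coeff (\<lambda>x. cx (\<theta> (\<psi> n) t) x - cx (\<lambda>x. g (t, x)) x) k) \<le> e / 2"
      proof (rule norm_fourier_coeff_le[OF set_integral_diff(1)[OF tt gt]])
        fix x :: "real ^ 'n" assume x: "x \<in> cell"
        have "norm (\<Theta> (\<kappa> n) (t, x) - g (t, x)) < e / 2" using n t x by (intro N) auto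
        then show "norm (cx (\<theta> (\<psi> n) t) x - cx (\<lambda>x. g (t, x)) x) \<le> e / 2"
          by (simp add: \<Theta>_def \<psi>_def flip: of_real_diff)
      qed
      then show "dist (a (\<psi> n) t k) (c t k) < e"
        using e by (simp add: fourier_coeff_diff[OF tt gt] dist_norm a_def c_def)
    qed
  qed
  have cpt: "(\<lambda>n. a (\<psi> n) t k) \<longlonglongrightarrow> c t k" if "t \<in> {0..T}" for t k
    using clim[of k] that by (rule tendsto_uniform_limitI)
  have closed_bound: "(\<Sum>k\<in>F. W k * (norm (c t k))\<^sup>2) \<le> B"
    if t: "t \<in> {0..T}" and "\<And>n. (\<Sum>k\<in>F. W k * (norm (a (\<psi> n) t k))\<^sup>2) \<le> B" for W :: "int ^ 'n \<Rightarrow> real" and F t B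
  proof (rule LIMSEQ_le_const2)
    show "(\<lambda>n. \<Sum>k\<in>F. W k * (norm (a (\<psi> n) t k))\<^sup>2) \<longlonglongrightarrow> (\<Sum>k\<in>F. W k * (norm (c t k))\<^sup>2)"
      by (intro tendsto_intros cpt t)
  qed (use that in auto)
  have chs: "hs_le r M (c t)" if "t \<in> {0..T}" for t
    unfolding hs_le_def
    by (intro allI impI, rule closed_bound[OF that], rule hs_leD[OF hs[OF \<psi>(1) that]])
  have cw1: "w1 (c t) summable_on UNIV" if "t \<in> {0..T}" for t using A(2)[OF chs[OF that]] by simp

  \<comment> \<open>The limit as a function on the whole space.\<close>
  define G where "G = (\<lambda>t x. Re (\<Sum>\<^sub>\<infinity>k. c t k * wave k x))"
  have series_lim: "uniform_limit {0..T} (\<lambda>n t. cx (\<theta> (\<psi> n) t) x) (\<lambda>t. \<Sum>\<^sub>\<infinity>k. c t k * wave k x) sequentially" for x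
  proof -
    have "uniform_limit {0..T} (\<lambda>n t. \<Sum>\<^sub>\<infinity>k. (1 * a (\<psi> n) t k) * wave k x)
        (\<lambda>t. \<Sum>\<^sub>\<infinity>k. (1 * c t k) * wave k x) sequentially"
      by (rule uniform_limit_multiplier_series[OF r1 hs[OF \<psi>(1)] chs _ _ tendsto_const clim, where D = 1])
         (use bracket_ge_1 in auto)
    moreover have "(\<Sum>\<^sub>\<infinity>k. (1 * a (\<psi> n) t k) * wave k x) = cx (\<theta> (\<psi> n) t) x" if "t \<in> {0..T}" for n t
      using regular_series[of "\<theta> (\<psi> n) t" x] reg[OF \<psi>(1) that] by (simp add: a_def)
    ultimately show ?thesis
      by (subst uniform_limit_cong'[where g = "\<lambda>n t. \<Sum>\<^sub>\<infinity>k. (1 * a (\<psi> n) t k) * wave k x"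
            and i = "\<lambda>t. \<Sum>\<^sub>\<infinity>k. (1 * c t k) * wave k x"]) auto
  qed
  have thlim: "(\<lambda>n. cx (\<theta> (\<psi> n) t) x) \<longlonglongrightarrow> (\<Sum>\<^sub>\<infinity>k. c t k * wave k x)" if "t \<in> {0..T}" for t x
    using series_lim that by (rule tendsto_uniform_limitI)
  have Gser: "cx (G t) x = (\<Sum>\<^sub>\<infinity>k. c t k * wave k x)" if t: "t \<in> {0..T}" for t x
  proof -
    have "(\<lambda>n. Im (cx (\<theta> (\<psi> n) t) x)) \<longlonglongrightarrow> Im (\<Sum>\<^sub>\<infinity>k. c t k * wave k x)" by (intro tendsto_Im thlim t)
    then have "Im (\<Sum>\<^sub>\<infinity>k. c t k * wave k x) = 0" by (simp add: LIMSEQ_const_iff)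
    then show ?thesis by (simp add: G_def complex_eq_iff)
  qed
  have Glim: "(\<lambda>n. \<theta> (\<psi> n) t x) \<longlonglongrightarrow> G t x" if "t \<in> {0..T}" for t x
    using tendsto_Re[OF thlim[OF that, of x]] by (simp add: G_def)
  have Gk: "fourier_coeff (cx (G t)) = c t" if "t \<in> {0..T}" for t
    unfolding Gser[OF that] by (rule ext) (rule fourier_coeff_series[OF w1_norm_summable[OF cw1[OF that]]])
  have Gper: "periodic (G t)" for t
    unfolding G_def using periodic_fourier_series[of "c t"] by (simp add: periodic_def)
  have Greg: "regular (G t)" if t: "t \<in> {0..T}" for t
    unfolding regular_def Gk[OF t]
  proof (intro conjI allI Gper cw1 t)
    fix x
    from fourier_series_has_derivative[OF cw1[OF t], of x]
    show "G t differentiable at x"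
      unfolding G_def[abs_def] by (auto simp: differentiable_def intro!: bounded_linear.has_derivative[OF bounded_linear_Re])
  qed
  have GA: "infsum (w1 (fourier_coeff (cx (G t)))) UNIV \<le> A" if "t \<in> {0..T}" for t
    unfolding Gk[OF that] using A(2)[OF chs[OF that]] by simp

  \<comment> \<open>The advection term converges uniformly in time at every point, so the limit solves the equation.\<close>
  have advlim: "uniform_limit {0..T} (\<lambda>n t. advection (m (\<psi> n)) (\<theta> (\<psi> n) t) x) (\<lambda>t. advection (m 0) (G t) x) sequentially" for x
    unfolding advection_def
  proof (rule uniform_limit_finite_sum[OF finite], rule uniform_lim_mult)
    fix j
    let ?D = "real CARD('n) * C0"
    have "uniform_limit {0..T} (\<lambda>n t. \<Sum>\<^sub>\<infinity>k. (vsym (m (\<psi> n)) j k * a (\<psi> n) t k) * wave k x)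
        (\<lambda>t. \<Sum>\<^sub>\<infinity>k. (vsym (m 0) j k * c t k) * wave k x) sequentially"
    proof (rule uniform_limit_multiplier_series[OF r1 hs[OF \<psi>(1)] chs _ _ _ clim, where D = ?D])
      show "norm (vsym (m (\<psi> n)) j k) \<le> ?D * bracket k" for n k
        by (rule norm_vsym_le_bracket) (rule C0(2)[OF \<psi>(1,2)])
      show "norm (vsym (m 0) j k) \<le> ?D * bracket k" for k
        by (rule norm_vsym_le_bracket) (rule C0(2), auto)
      show "(\<lambda>n. vsym (m (\<psi> n)) j k) \<longlonglongrightarrow> vsym (m 0) j k" for k
        by (rule filterlim_compose[OF vsym_tendsto[OF A4] \<psi>lim])
    qed
    moreover have "(\<Sum>\<^sub>\<infinity>k. (vsym (m (\<psi> n)) j k * a (\<psi> n) t k) * wave k x) = velocity (m (\<psi> n)) (\<theta> (\<psi> n) t) j x" if "t \<in> {0..T}" for n t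
      unfolding a_def using reg[OF \<psi>(1) that] C0(2)[OF \<psi>(1,2)]
      by (intro velocity_series[symmetric, where B = C0]) (auto simp: regular_def)
    moreover have "(\<Sum>\<^sub>\<infinity>k. (vsym (m 0) j k * c t k) * wave k x) = velocity (m 0) (G t) j x" if "t \<in> {0..T}" for t
      unfolding Gk[OF that, symmetric] using Greg[OF that] C0(2)[of 0]
      by (intro velocity_series[symmetric, where B = C0]) (auto simp: regular_def)
    ultimately show "uniform_limit {0..T} (\<lambda>n t. velocity (m (\<psi> n)) (\<theta> (\<psi> n) t) j x) (\<lambda>t. velocity (m 0) (G t) j x) sequentially"
      by (subst uniform_limit_cong'[where g = "\<lambda>n t. \<Sum>\<^sub>\<infinity>k. (vsym (m (\<psi> n)) j k * a (\<psi> n) t k) * wave k x"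
            and i = "\<lambda>t. \<Sum>\<^sub>\<infinity>k. (vsym (m 0) j k * c t k) * wave k x"]) auto
    have "uniform_limit {0..T} (\<lambda>n t. \<Sum>\<^sub>\<infinity>k. ((\<i> * of_int (k $ j)) * a (\<psi> n) t k) * wave k x)
        (\<lambda>t. \<Sum>\<^sub>\<infinity>k. ((\<i> * of_int (k $ j)) * c t k) * wave k x) sequentially"
      by (rule uniform_limit_multiplier_series[OF r1 hs[OF \<psi>(1)] chs _ _ tendsto_const clim, where D = 1])
         (use abs_component_le_bracket in \<open>auto simp: norm_mult\<close>)
    moreover have "(\<Sum>\<^sub>\<infinity>k. ((\<i> * of_int (k $ j)) * a (\<psi> n) t k) * wave k x) = of_real (partial j (\<theta> (\<psi> n) t) x)" if "t \<in> {0..T}" for n t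
      using regular_partial[of "\<theta> (\<psi> n) t" j x] reg[OF \<psi>(1) that] by (simp add: a_def)
    moreover have "(\<Sum>\<^sub>\<infinity>k. ((\<i> * of_int (k $ j)) * c t k) * wave k x) = of_real (partial j (G t) x)" if "t \<in> {0..T}" for t
      using regular_partial[OF Greg[OF that], of j x] Gk[OF that] by simp
    ultimately show "uniform_limit {0..T} (\<lambda>n t. complex_of_real (partial j (\<theta> (\<psi> n) t) x)) (\<lambda>t. complex_of_real (partial j (G t) x)) sequentially"
      by (subst uniform_limit_cong'[where g = "\<lambda>n t. \<Sum>\<^sub>\<infinity>k. ((\<i> * of_int (k $ j)) * a (\<psi> n) t k) * wave k x"
            and i = "\<lambda>t. \<Sum>\<^sub>\<infinity>k. ((\<i> * of_int (k $ j)) * c t k) * wave k x"]) auto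
    show "bounded ((\<lambda>t. velocity (m 0) (G t) j x) ` {0..T})"
      by (rule boundedI[where B = "CARD('n) * C0 * A"]) (use regular_bounds(3)[OF Greg GA C0(2)[of 0]] in auto)
    show "bounded ((\<lambda>t. complex_of_real (partial j (G t) x)) ` {0..T})"
      by (rule boundedI[where B = A]) (use regular_bounds(2)[OF Greg GA C0(2)[of 0]] in auto)
  qed
  have advpt: "(\<lambda>n. advection (m (\<psi> n)) (\<theta> (\<psi> n) t) x) \<longlonglongrightarrow> advection (m 0) (G t) x" if "t \<in> {0..T}" for t x
    using advlim that by (rule tendsto_uniform_limitI)
  have advreal: "Im (advection (m 0) (G t) x) = 0" if t: "t \<in> {0..T}" for t x
  proof -
    have "Im (advection (m (\<psi> n)) (\<theta> (\<psi> n) t) x) = 0" for n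
      using arg_cong[OF AS_solution_derivative(2)[OF AS[OF \<psi>(1)[of n]] t, of x], of Im] by simp
    then show ?thesis using tendsto_Im[OF advpt[OF t, of x]] by (simp add: LIMSEQ_const_iff)
  qed
  have Gderiv: "((\<lambda>t. G t x) has_real_derivative S x - Re (advection (m 0) (G t) x)) (at t within {0..T})" if t: "t \<in> {0..T}" for t x
  proof -
    have "\<exists>h. \<forall>t\<in>{0..T}. (\<lambda>n. \<theta> (\<psi> n) t x) \<longlonglongrightarrow> h t \<and>
        (h has_derivative (*) (S x - Re (advection (m 0) (G t) x))) (at t within {0..T})"
    proof (rule has_derivative_sequence)
      show "((\<lambda>t. \<theta> (\<psi> n) t x) has_derivative (*) (S x - Re (advection (m (\<psi> n)) (\<theta> (\<psi> n) t) x))) (at t within {0..T})"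
        if "t \<in> {0..T}" for n t
        using AS_solution_derivative(1)[OF AS[OF \<psi>(1)] that] unfolding has_field_derivative_def .
      show "0 \<in> {0..T}" using T by simp
      then show "(\<lambda>n. \<theta> (\<psi> n) 0 x) \<longlonglongrightarrow> G 0 x" by (rule Glim)
      fix e :: real assume "e > 0"
      from uniform_limitD[OF advlim this, of x]
      show "\<forall>\<^sub>F n in sequentially. \<forall>t\<in>{0..T}. \<forall>h. norm ((S x - Re (advection (m (\<psi> n)) (\<theta> (\<psi> n) t) x)) * h
          - (S x - Re (advection (m 0) (G t) x)) * h) \<le> e * norm h"
      proof eventually_elim
        case (elim n)
        show ?case
        proof (intro ballI allI)
          fix t and h :: real assume t: "t \<in> {0..T}"
          have "\<bar>Re (advection (m 0) (G t) x) - Re (advection (m (\<psi> n)) (\<theta> (\<psi> n) t) x)\<bar> \<le> e"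
            using abs_Re_le_cmod[of "advection (m 0) (G t) x - advection (m (\<psi> n)) (\<theta> (\<psi> n) t) x"] elim t
            by (force simp: dist_norm norm_minus_commute)
          then have "\<bar>Re (advection (m 0) (G t) x) - Re (advection (m (\<psi> n)) (\<theta> (\<psi> n) t) x)\<bar> * \<bar>h\<bar> \<le> e * \<bar>h\<bar>"
            by (rule mult_right_mono) simp
          then show "norm ((S x - Re (advection (m (\<psi> n)) (\<theta> (\<psi> n) t) x)) * h
              - (S x - Re (advection (m 0) (G t) x)) * h) \<le> e * norm h"
            by (simp add: left_diff_distrib[symmetric] abs_mult)
        qed
      qed
    qed simp
    then obtain h where h: "\<And>t. t \<in> {0..T} \<Longrightarrow> (\<lambda>n. \<theta> (\<psi> n) t x) \<longlonglongrightarrow> h t"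
      "\<And>t. t \<in> {0..T} \<Longrightarrow> (h has_real_derivative S x - Re (advection (m 0) (G t) x)) (at t within {0..T})"
      unfolding has_field_derivative_def by blast
    have "h t = G t x" if "t \<in> {0..T}" for t using h(1)[OF that] Glim[OF that] by (rule LIMSEQ_unique)
    then show ?thesis
      using has_field_derivative_transform_within[OF h(2)[OF t], of 1 "\<lambda>t. G t x"] t by auto
  qed
  have "gevrey_solution (m 0) \<theta>0 S s r \<tau> C T G"
    unfolding gevrey_solution_def AS_solution_def
  proof (intro conjI ballI allI)
    have "(\<lambda>n. \<theta> (\<psi> n) 0 x) \<longlonglongrightarrow> \<theta>0 x" for x
      using AS[OF \<psi>(1)] by (simp add: AS_solution_def)
    then show "G 0 = \<theta>0" using Glim[of 0] T by (auto simp: fun_eq_iff intro: LIMSEQ_unique)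
    fix t assume t: "t \<in> {0..T}"
    have cont: "continuous_on UNIV (cx (G t))"
      by (intro continuous_intros regular_continuous Greg t)
    show "periodic (G t)" by (rule Gper)
    have "c t 0 = 0" using cpt[OF t, of 0] mean[OF \<psi>(1) t] by (simp add: LIMSEQ_const_iff)
    then show "zero_mean (G t)"
      unfolding fourier_coeff_0_zero_mean Gk[OF t]
      by (auto intro!: cell_integrable_continuous regular_continuous Greg t)
    have b: "(\<Sum>k\<in>F. gevrey_weight s r \<tau> k * (norm (fourier_coeff (cx (G t)) k))\<^sup>2) \<le> C\<^sup>2"
      if "finite F" "0 \<notin> F" for F
      unfolding Gk[OF t] using gevrey_boundD[OF gb[OF \<psi>(1) t] that]
      by (intro closed_bound t) (auto simp: a_def)
    show "gevrey_norm s r \<tau> (cx (G t)) \<le> C" using b C by (intro gevrey_norm_le) auto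
    have "gevrey_sum s r \<tau> (cx (G t)) \<le> ennreal (C\<^sup>2)" using b by (subst gevrey_sum_le_iff) auto
    then have "gevrey_sum s r \<tau> (cx (G t)) < \<infinity>" by (rule order_le_less_trans) simp
    moreover have "L2_torus (cx (G t))" by (rule L2_torus_continuous[OF cont]) (use Gper in \<open>simp add: periodic_def\<close>)
    ultimately show "gevrey_dom s r \<tau> (cx (G t))" by (simp add: gevrey_dom_def)
    fix x
    show "G t differentiable at x" using Greg[OF t] by (simp add: regular_def)
    show "\<exists>D. ((\<lambda>t'. G t' x) has_real_derivative D) (at t within {0..T}) \<and>
        complex_of_real D + (\<Sum>j\<in>UNIV. velocity (m 0) (G t) j x * complex_of_real (partial j (G t) x)) = complex_of_real (S x)"
      using Gderiv[OF t, of x] advreal[OF t, of x]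
      unfolding advection_def[symmetric] by (intro exI conjI) (auto simp: complex_eq_iff)
  qed
  then have "\<forall>t\<in>{0..T}. G t = \<theta> 0 t"
    using sol[of 0, OF order_refl, unfolded the_gevrey_solution_def, THEN conjunct2, rule_format, of G] by blast
  then have ck: "c t = fourier_coeff (cx (\<theta> 0 t))" if "t \<in> {0..T}" for t
    using Gk[OF that] that by simp
  have "(\<lambda>n. fourier_coeff (cx (\<theta> (f (\<kappa> n)) t)) k) \<longlonglongrightarrow> fourier_coeff (cx (\<theta> 0 t)) k"
    if "t \<in> {0..T}" for t k
    using cpt[OF that, of k] unfolding ck[OF that] a_def \<psi>_def .
  then show ?thesis using \<kappa> by blast
qed

text \<open>Halving the radius gains an exponential factor, which is small at high frequencies.\<close>

lemma gevrey_weight_small: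
  fixes e :: real
  assumes s: "1 \<le> s" and \<tau>: "0 < \<tau>" and e: "0 < e"
  shows "\<exists>F. finite F \<and> (\<forall>k::int ^ 'n::finite. k \<notin> F \<longrightarrow> gevrey_weight s r (\<tau> / 2) k \<le> e * gevrey_weight s r \<tau> k)"
proof (intro exI conjI allI impI)
  define N where "N = (\<bar>ln e\<bar> / \<tau>) powr s + 1"
  show "finite (modes N :: (int ^ 'n) set)" by simp
  fix k :: "int ^ 'n" assume "k \<notin> modes N"
  then have "N < bracket k" by (simp add: modes_def)
  also have "bracket k \<le> norm (freq k) + 1"
    using bracket_lipschitz[of k 0] by (simp add: bracket_def[of 0])
  finally have "(\<bar>ln e\<bar> / \<tau>) powr s \<le> norm (freq k)" by (simp add: N_def)
  then have "((\<bar>ln e\<bar> / \<tau>) powr s) powr (1 / s) \<le> norm (freq k) powr (1 / s)"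
    using s by (intro powr_mono2) auto
  then have "\<bar>ln e\<bar> / \<tau> \<le> norm (freq k) powr (1 / s)" using s \<tau> by (simp add: powr_powr)
  then have "- ln e \<le> \<tau> * norm (freq k) powr (1 / s)" using \<tau> by (simp add: field_simps)
  then have "exp (- \<tau> * norm (freq k) powr (1 / s)) \<le> exp (ln e)" by simp
  then have le: "exp (- \<tau> * norm (freq k) powr (1 / s)) \<le> e" using e by simp
  have "gevrey_weight s r (\<tau> / 2) k = exp (- \<tau> * norm (freq k) powr (1 / s)) * gevrey_weight s r \<tau> k"
    unfolding gevrey_weight_def by (simp add: exp_add[symmetric] mult.left_commute)
  also have "\<dots> \<le> e * gevrey_weight s r \<tau> k" by (intro mult_right_mono le) simp
  finally show "gevrey_weight s r (\<tau> / 2) k \<le> e * gevrey_weight s r \<tau> k" .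
qed

theorem gevrey_inviscid_limit:
  fixes m :: "real \<Rightarrow> 'n::finite symbols"
  assumes A4: "A4 m" and A5: "A5_1 m"
    and s: "1 \<le> s" and r: "r > CARD('n) / 2 + 3 / 2" and T: "0 < T" and \<tau>: "0 < \<tau>" and C: "0 < C"
    and sol: "\<And>\<nu>. 0 \<le> \<nu> \<Longrightarrow> the_gevrey_solution (m \<nu>) \<theta>0 S s r \<tau> C T (\<theta> \<nu>)"
    and t: "t \<in> {0..T}"
  shows "((\<lambda>\<nu>. gevrey_norm s r (\<tau> / 2) (cx (\<lambda>x. \<theta> \<nu> t x - \<theta> 0 t x))) \<longlongrightarrow> 0) (at_right 0)"
proof (rule tendstoI)
  fix e :: real assume e: "e > 0"
  let ?d = "\<lambda>\<nu>. cx (\<lambda>x. \<theta> \<nu> t x - \<theta> 0 t x)"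
  let ?P = "\<lambda>\<nu>. dist (gevrey_norm s r (\<tau> / 2) (?d \<nu>)) 0 < e"
  define \<phi> where "\<phi> = (\<lambda>\<nu> k. fourier_coeff (cx (\<theta> \<nu> t)) k - fourier_coeff (cx (\<theta> 0 t)) k)"
  have gs: "gevrey_dom s r \<tau> (cx (\<theta> \<nu> t))" "gevrey_norm s r \<tau> (cx (\<theta> \<nu> t)) \<le> C" if "0 \<le> \<nu>" for \<nu>
  proof -
    have "gevrey_solution (m \<nu>) \<theta>0 S s r \<tau> C T (\<theta> \<nu>)"
      using sol[OF that] unfolding the_gevrey_solution_def by (rule conjunct1)
    then show "gevrey_dom s r \<tau> (cx (\<theta> \<nu> t))" "gevrey_norm s r \<tau> (cx (\<theta> \<nu> t)) \<le> C"
      using t by (simp_all add: gevrey_solution_def)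
  qed
  have \<phi>: "fourier_coeff (?d \<nu>) = \<phi> \<nu>" if \<nu>: "0 \<le> \<nu>" for \<nu>
  proof
    fix k
    have i: "cell_integrable (cx (\<theta> \<mu> t))" if "0 \<le> \<mu>" for \<mu>
      using gs(1)[OF that] by (intro L2_torus_integrable) (simp add: gevrey_dom_def)
    show "fourier_coeff (?d \<nu>) k = \<phi> \<nu> k"
      using fourier_coeff_diff[OF i[OF \<nu>] i[of 0], of k] by (simp add: \<phi>_def)
  qed
  show "eventually ?P (at_right 0)"
  proof (rule sequentially_imp_eventually_at_right[of 0 1])
    fix f :: "nat \<Rightarrow> real" assume f: "\<And>n. 0 < f n" "\<And>n. f n < 1" "f \<longlonglongrightarrow> 0"
    show "eventually (\<lambda>n. ?P (f n)) sequentially"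
    proof (rule ccontr)
      assume "\<not> eventually (\<lambda>n. ?P (f n)) sequentially"
      then obtain \<rho> :: "nat \<Rightarrow> nat" where \<rho>: "strict_mono \<rho>" "\<And>n. \<not> ?P (f (\<rho> n))"
        using not_eventually_sequentiallyD by blast
      have "\<exists>\<kappa> :: nat \<Rightarrow> nat. strict_mono \<kappa> \<and> (\<forall>t\<in>{0..T}. \<forall>k.
          (\<lambda>n. fourier_coeff (cx (\<theta> (f (\<rho> (\<kappa> n))) t)) k) \<longlonglongrightarrow> fourier_coeff (cx (\<theta> 0 t)) k)"
      proof (rule gevrey_subsequence[where f = "\<lambda>n. f (\<rho> n)", OF A4 A5 r T \<tau> C sol])
        show "(\<lambda>n. f (\<rho> n)) \<longlonglongrightarrow> 0" using LIMSEQ_subseq_LIMSEQ[OF f(3) \<rho>(1)] by (simp add: o_def)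
      qed (auto intro: f)
      then
      obtain \<kappa> :: "nat \<Rightarrow> nat" where \<kappa>: "\<forall>t\<in>{0..T}. \<forall>k.
          (\<lambda>n. fourier_coeff (cx (\<theta> (f (\<rho> (\<kappa> n))) t)) k) \<longlonglongrightarrow> fourier_coeff (cx (\<theta> 0 t)) k"
        by - (erule exE, erule conjE, rule that, assumption)
      define \<psi> where "\<psi> = (\<lambda>n. f (\<rho> (\<kappa> n)))"
      have \<psi>: "0 \<le> \<psi> n" for n using f(1) by (simp add: \<psi>_def less_imp_le)
      \<comment> \<open>The mean is not controlled by the homogeneous norm, so its weight is set to zero.\<close>
      let ?w = "\<lambda>\<tau> (k :: int ^ 'n). if k = 0 then 0 else gevrey_weight s r \<tau> k"
      have "eventually (\<lambda>n. \<forall>F. finite F \<longrightarrow> (\<Sum>k\<in>F. ?w (\<tau> / 2) k * (norm (\<phi> (\<psi> n) k))\<^sup>2) \<le> (e / 2)\<^sup>2) sequentially"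
      proof (rule weighted_tail_tendsto[where W = "?w \<tau>" and B = "4 * C\<^sup>2"])
        fix d :: real assume "d > 0"
        from gevrey_weight_small[OF s \<tau> this, of r] obtain F :: "(int ^ 'n) set" where F: "finite F"
          "\<And>k. k \<notin> F \<Longrightarrow> gevrey_weight s r (\<tau> / 2) k \<le> d * gevrey_weight s r \<tau> k" by blast
        show "\<exists>F. finite F \<and> (\<forall>k. k \<notin> F \<longrightarrow> ?w (\<tau> / 2) k \<le> d * ?w \<tau> k)"
          by (intro exI[of _ F] conjI allI impI F(1)) (use F(2) in auto)
      next
        have "(\<Sum>k\<in>F. ?w \<tau> k * (norm (\<phi> (\<psi> n) k))\<^sup>2) \<le> 4 * C\<^sup>2" if F: "finite F" for F n
        proof -
          have b: "(\<Sum>k\<in>F - {0}. gevrey_weight s r \<tau> k * (norm (fourier_coeff (cx (\<theta> \<nu> t)) k))\<^sup>2) \<le> C\<^sup>2" if "0 \<le> \<nu>" for \<nu>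
            using F by (intro gevrey_boundD gs that) auto
          have "(\<Sum>k\<in>F. ?w \<tau> k * (norm (\<phi> (\<psi> n) k))\<^sup>2) = (\<Sum>k\<in>F - {0}. gevrey_weight s r \<tau> k * (norm (\<phi> (\<psi> n) k))\<^sup>2)"
            using F by (intro sum.mono_neutral_cong_right) auto
          also have "\<dots> \<le> (\<Sum>k\<in>F - {0}. gevrey_weight s r \<tau> k *
              (2 * (norm (fourier_coeff (cx (\<theta> (\<psi> n) t)) k))\<^sup>2 + 2 * (norm (fourier_coeff (cx (\<theta> 0 t)) k))\<^sup>2))"
            unfolding \<phi>_def by (intro sum_mono mult_left_mono norm_diff_square_le) simp
          also have "\<dots> = 2 * (\<Sum>k\<in>F - {0}. gevrey_weight s r \<tau> k * (norm (fourier_coeff (cx (\<theta> (\<psi> n) t)) k))\<^sup>2)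
              + 2 * (\<Sum>k\<in>F - {0}. gevrey_weight s r \<tau> k * (norm (fourier_coeff (cx (\<theta> 0 t)) k))\<^sup>2)"
            by (simp add: sum.distrib sum_distrib_left algebra_simps)
          also have "\<dots> \<le> 4 * C\<^sup>2" using b[OF \<psi>[of n]] b[of 0] by simp
          finally show ?thesis .
        qed
        then show "eventually (\<lambda>n. \<forall>F. finite F \<longrightarrow> (\<Sum>k\<in>F. ?w \<tau> k * (norm (\<phi> (\<psi> n) k))\<^sup>2) \<le> 4 * C\<^sup>2) sequentially"
          by simp
      next
        fix k
        have "(\<lambda>n. \<phi> (\<psi> n) k) \<longlonglongrightarrow> 0" unfolding \<phi>_def \<psi>_def by (rule LIM_zero) (rule \<kappa>[rule_format, OF t])
        then show "(\<lambda>n. norm (\<phi> (\<psi> n) k)) \<longlonglongrightarrow> 0" by (rule tendsto_norm_zero)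
      qed (use e in auto)
      then obtain n where n: "\<And>F. finite F \<Longrightarrow> (\<Sum>k\<in>F. ?w (\<tau> / 2) k * (norm (\<phi> (\<psi> n) k))\<^sup>2) \<le> (e / 2)\<^sup>2"
        unfolding eventually_sequentially by blast
      have "gevrey_norm s r (\<tau> / 2) (?d (\<psi> n)) \<le> e / 2"
      proof (rule gevrey_norm_le)
        fix F :: "(int ^ 'n) set" assume F: "finite F" "0 \<notin> F"
        have "(\<Sum>k\<in>F. gevrey_weight s r (\<tau> / 2) k * (norm (\<phi> (\<psi> n) k))\<^sup>2) = (\<Sum>k\<in>F. ?w (\<tau> / 2) k * (norm (\<phi> (\<psi> n) k))\<^sup>2)"
          using F by (intro sum.cong) auto
        then show "(\<Sum>k\<in>F. gevrey_weight s r (\<tau> / 2) k * (norm (fourier_coeff (?d (\<psi> n)) k))\<^sup>2) \<le> (e / 2)\<^sup>2"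
          using n[OF F(1)] unfolding \<phi>[OF \<psi>] by (simp only:)
      qed (use e in simp)
      moreover have "0 \<le> gevrey_norm s r (\<tau> / 2) (?d (\<psi> n))" by (simp add: gevrey_norm_def)
      ultimately have "?P (\<psi> n)" using e by simp
      then show False using \<rho>(2) by (simp add: \<psi>_def)
    qed
  qed simp
qed

theorem theorem2p5:
  fixes m :: "real \<Rightarrow> 'n::finite symbols"
  assumes dim: "CARD('n) \<ge> 2"
    and "A1 m" and "A2 m" and "A3 m" and "A4 m"
  shows
    "(A5_1 m \<longrightarrow>
       (\<forall>(s::real) (r::real) (K0::real) (\<tau>0::real) (\<theta>0 :: real ^ 'n \<Rightarrow> real) (S :: real ^ 'n \<Rightarrow> real)
          (Tbar::real) (\<tau>bar::real) (C::real) (\<theta> :: real \<Rightarrow> real \<Rightarrow> real ^ 'n \<Rightarrow> real).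
          s \<ge> 1 \<and> r > CARD('n) / 2 + 3 / 2 \<and> K0 > 0 \<and> \<tau>0 > 0 \<and>
          gevrey_dom s r \<tau>0 (cx \<theta>0) \<and> gevrey_norm s r \<tau>0 (cx \<theta>0) \<le> K0 \<and>
          gevrey_dom s r \<tau>0 (cx S) \<and> gevrey_norm s r \<tau>0 (cx S) \<le> K0 \<and> zero_mean S \<and>
          Tbar > 0 \<and> \<tau>bar > 0 \<and> C > 0 \<and>
          (\<forall>\<nu>\<ge>0. the_gevrey_solution (m \<nu>) \<theta>0 S s r \<tau>bar C Tbar (\<theta> \<nu>))
          \<longrightarrow>
          (\<exists>T \<tau>. 0 < T \<and> T < Tbar \<and>
             (\<forall>t\<in>{0..T}. 0 < \<tau> t \<and> \<tau> t < \<tau>bar \<and>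
                ((\<lambda>\<nu>. gevrey_norm s r (\<tau> t) (cx (\<lambda>x. \<theta> \<nu> t x - \<theta> 0 t x))) \<longlongrightarrow> 0) (at_right 0)))))
     \<and>
     (A5_2 m \<longrightarrow>
       (\<forall>(s::real) (\<theta>0 :: real ^ 'n \<Rightarrow> real) (S :: real ^ 'n \<Rightarrow> real)
          (T::real) (\<theta> :: real \<Rightarrow> real \<Rightarrow> real ^ 'n \<Rightarrow> real).
          s > CARD('n) / 2 + 1 \<and>
          sobolev_space s (cx \<theta>0) \<and> zero_mean \<theta>0 \<and> sobolev_space s (cx S) \<and> zero_mean S \<and>
          T > 0 \<and> (\<forall>\<nu>\<ge>0. sobolev_solution (m \<nu>) \<theta>0 S s T (\<theta> \<nu>))
          \<longrightarrow>
          (\<forall>t\<in>{0..T}.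
             ((\<lambda>\<nu>. sobolev_norm (s - 1) (cx (\<lambda>x. \<theta> \<nu> t x - \<theta> 0 t x))) \<longlongrightarrow> 0) (at_right 0))))"
proof (rule conjI; intro impI allI; elim conjE)
  fix s r K0 \<tau>0 :: real and \<theta>0 S :: "real ^ 'n \<Rightarrow> real" and Tbar \<tau>bar C :: real
    and \<theta> :: "real \<Rightarrow> real \<Rightarrow> real ^ 'n \<Rightarrow> real"
  assume A5: "A5_1 m" and s: "s \<ge> 1" and r: "r > CARD('n) / 2 + 3 / 2"
    and T: "Tbar > 0" and \<tau>: "\<tau>bar > 0" and C: "C > 0"
    and sol: "\<forall>\<nu>\<ge>0. the_gevrey_solution (m \<nu>) \<theta>0 S s r \<tau>bar C Tbar (\<theta> \<nu>)"
  show "\<exists>T \<tau>. 0 < T \<and> T < Tbar \<and> (\<forall>t\<in>{0..T}. 0 < \<tau> t \<and> \<tau> t < \<tau>bar \<and>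
      ((\<lambda>\<nu>. gevrey_norm s r (\<tau> t) (cx (\<lambda>x. \<theta> \<nu> t x - \<theta> 0 t x))) \<longlongrightarrow> 0) (at_right 0))"
  proof (intro exI[of _ "Tbar / 2"] exI[of _ "\<lambda>_. \<tau>bar / 2"] conjI ballI)
    fix t assume "t \<in> {0..Tbar / 2}"
    then have "t \<in> {0..Tbar}" using T by auto
    then show "((\<lambda>\<nu>. gevrey_norm s r (\<tau>bar / 2) (cx (\<lambda>x. \<theta> \<nu> t x - \<theta> 0 t x))) \<longlongrightarrow> 0) (at_right 0)"
      using sol by (intro gevrey_inviscid_limit[OF \<open>A4 m\<close> A5 s r T \<tau> C]) auto
  qed (use T \<tau> in auto)
next
  fix s T :: real and \<theta>0 S :: "real ^ 'n \<Rightarrow> real" and \<theta> :: "real \<Rightarrow> real \<Rightarrow> real ^ 'n \<Rightarrow> real"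
  assume A5: "A5_2 m" and s: "s > CARD('n) / 2 + 1"
    and data: "sobolev_space s (cx \<theta>0)" "sobolev_space s (cx S)"
    and T: "T > 0" and "\<forall>\<nu>\<ge>0. sobolev_solution (m \<nu>) \<theta>0 S s T (\<theta> \<nu>)"
  then show "\<forall>t\<in>{0..T}. ((\<lambda>\<nu>. sobolev_norm (s - 1) (cx (\<lambda>x. \<theta> \<nu> t x - \<theta> 0 t x))) \<longlongrightarrow> 0) (at_right 0)"
    by (intro ballI sobolev_inviscid_limit[OF \<open>A1 m\<close> \<open>A2 m\<close> \<open>A4 m\<close> A5 s T data]) auto
qed

end
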